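(* Let $k\ge2$ be a natural number, $p$ an integer with $\gcd(|p|,k)=1$, and let $$G(z)= e^{Az^k+A_0z^{-k}}\, z^{p}\,\frac{\prod_{\nu>0} \left(1+\frac{z^k}{a_\nu}\right)}{\prod_{\mu>0} \left(1-\frac{z^k}{b_\mu}\right)}\cdot\frac{\prod_{\nu>0} \left(1+\frac{z^{-k}}{c_\nu}\right)}{\prod_{\mu>0} \left(1-\frac{z^{-k}}{d_\mu}\right)},\qquad G(z)\not\equiv z^p,$$ where $A,A_0\ge0$ and $a_\nu,b_\mu,c_\nu,d_\mu>0$ for all $\nu,\mu$. Let $\alpha\ne0$ with $\Im\alpha^k=0$, let $s$ be an integer such that $\Im(\alpha e_{ps})=0$, and, given an integer $m$, let $l$ denote an integer with $p(m-l)\equiv1\pmod{k}$. Put $z_i^*:=\overline{z_i}\,e_{-2s}$. (a) A point $z$ satisfies $G(z)=\alpha$ and $|z|=|z_i|$ if and only if $z\in\{z_i,z_i^*\}$. (b) If $z_i\in Q_{2m}\cup Q_{-2s-2m-1}$ for some integer $m$, then $z_i^*\ne z_i$, both $z_i$ and $z_i^*$ are simple $\alpha$-points, and $z_{i+1}\in\overline{Q}_{2l}\cup\overline{Q}_{-2s-2l-1}$ (when $|z_{i+1}|\in\Xi$). (c) If $z_i^*=z_i$ and $\arg z_i=\arg z_{i+1}$, then both $z_i,z_{i+1}$ are simple, $\arg z_i\ne\arg z_{i-1}$ provided that $|z_{i-1}|\in\Xi$, and $\arg z_{i+1}\ne\arg z_{i+2}$ provided that $|z_{i+2}|\in\Xi$.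 (d) If $z_i^*=z_i$ and $\arg z_i\ne\arg z_{i+1}$, then $z_i$ is simple or double (which corresponds to, respectively, $\arg z_i=\arg z_{i-1}$ or $\arg z_i\ne\arg z_{i-1}$, on condition that $|z_{i-1}|\in\Xi$). Furthermore, $z_i\in\overline{Q}_{2m}\cap\overline{Q}_{-2s-2m-1}$ (where necessarily $m\equiv-\lceil\frac s2\rceil\pmod k$ if $z_ie_s>0$, and $m\equiv-\lceil\frac{s-k}2\rceil\pmod k$ if $z_ie_s<0$) implies $z_{i+1}\in\overline{Q}_{2l}\cup\overline{Q}_{-2s-2l-1}$. (e) If $z_i^*=z_i$ and $|z_{i+1}|\notin\Xi$ (that is, there are no $\alpha$-points of greater absolute value), then the multiplicity of $z_i$ is at most $2$.
   Context: $e_m:=\exp\left(i\frac{m}{k}\pi\right)$ and, for $s\in\mathbb{Z}$, $Q_s:=\{z\in\mathbb{C}\setminus\{0\}:0<\operatorname{Arg}(ze_{-s})<\frac{\pi}{k}\}$ ($\operatorname{Arg}$ the principal argument), so $Q_{s+2k}=Q_s$; $\overline{Q}_s$ is the closure. The products are finite, infinite or empty and absolutely convergent. An $\alpha$-point of $G$ is a $z$ with $G(z)=\alpha$; it has multiplicity $n$ if $G'(z)=\dots=G^{(n-1)}(z)=0\neq G^{(n)}(z)$ (simple: $n=1$; double: $n=2$). $\Xi:=\{\xi>0:\exists\theta\in(-\pi,\pi],\ G(\xi e^{i\theta})=\alpha\}$ is the set of absolute values of $\alpha$-points, enumerated as $\cdots<\xi_i<\xi_{i+1}<\cdots$, and $z_i$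 denotes any $\alpha$-point with $|z_i|=\xi_i$; the condition $|z_{j}|\in\Xi$ means that the entry $\xi_j$ exists. Equality of arguments is modulo $2\pi$. *)

theory Defs
  imports "HOL-Analysis.Analysis" "HOL-Number_Theory.Cong"
begin

definition epi :: "nat \<Rightarrow> int \<Rightarrow> complex" where
  "epi k m = exp (\<i> * of_real (of_int m / of_nat k * pi))"

definition Qsector :: "nat \<Rightarrow> int \<Rightarrow> complex set" where
  "Qsector k s = {z. z \<noteq> 0 \<and> 0 < Arg (z * epi k (- s)) \<and> Arg (z * epi k (- s)) < pi / real k}"

text \<open>A product that may be empty, finite or infinite is indexed by a set \<open>N\<close> of natural
  numbers; the factors outside \<open>N\<close> are replaced by 1 so that the library's infinite
  products apply. Repeated parameters are allowed.\<close>

definition factors :: "nat set \<Rightarrow> (nat \<Rightarrow> complex) \<Rightarrow> nat \<Rightarrow> complex" where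
  "factors N f = (\<lambda>\<nu>. if \<nu> \<in> N then f \<nu> else 1)"

text \<open>At a pole, and at 0, the value of \<open>Gfun\<close> is the conventional \<open>0\<close>
  (division by zero, and \<open>p \<noteq> 0\<close>), hence never a nonzero \<open>\<alpha>\<close>.\<close>

definition Gfun ::
  "nat \<Rightarrow> int \<Rightarrow> real \<Rightarrow> real \<Rightarrow>
   nat set \<Rightarrow> (nat \<Rightarrow> real) \<Rightarrow> nat set \<Rightarrow> (nat \<Rightarrow> real) \<Rightarrow>
   nat set \<Rightarrow> (nat \<Rightarrow> real) \<Rightarrow> nat set \<Rightarrow> (nat \<Rightarrow> real) \<Rightarrow> complex \<Rightarrow> complex" where
  "Gfun k p A A0 Na a Nb b Nc c Nd d z =
     exp (of_real A * z ^ k + of_real A0 * z powi (- int k)) * z powi p *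
     (prodinf (factors Na (\<lambda>\<nu>. 1 + z ^ k / of_real (a \<nu>))) /
      prodinf (factors Nb (\<lambda>\<mu>. 1 - z ^ k / of_real (b \<mu>)))) *
     (prodinf (factors Nc (\<lambda>\<nu>. 1 + z powi (- int k) / of_real (c \<nu>))) /
      prodinf (factors Nd (\<lambda>\<mu>. 1 - z powi (- int k) / of_real (d \<mu>))))"

definition products_abs_convergent ::
  "nat \<Rightarrow> nat set \<Rightarrow> (nat \<Rightarrow> real) \<Rightarrow> nat set \<Rightarrow> (nat \<Rightarrow> real) \<Rightarrow>
   nat set \<Rightarrow> (nat \<Rightarrow> real) \<Rightarrow> nat set \<Rightarrow> (nat \<Rightarrow> real) \<Rightarrow> bool" where
  "products_abs_convergent k Na a Nb b Nc c Nd d \<longleftrightarrow>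
     (\<forall>z::complex. z \<noteq> 0 \<longrightarrow>
        abs_convergent_prod (factors Na (\<lambda>\<nu>. 1 + z ^ k / of_real (a \<nu>))) \<and>
        abs_convergent_prod (factors Nb (\<lambda>\<mu>. 1 - z ^ k / of_real (b \<mu>))) \<and>
        abs_convergent_prod (factors Nc (\<lambda>\<nu>. 1 + z powi (- int k) / of_real (c \<nu>))) \<and>
        abs_convergent_prod (factors Nd (\<lambda>\<mu>. 1 - z powi (- int k) / of_real (d \<mu>))))"

definition alpha_mult :: "(complex \<Rightarrow> complex) \<Rightarrow> complex \<Rightarrow> complex \<Rightarrow> nat \<Rightarrow> bool" where
  "alpha_mult G \<alpha> z n \<longleftrightarrow>
     G z = \<alpha> \<and> 1 \<le> n \<and> (\<forall>j\<in>{1..<n}. (deriv ^^ j) G z = 0) \<and> (deriv ^^ n) G z \<noteq> 0"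

definition Xi :: "(complex \<Rightarrow> complex) \<Rightarrow> complex \<Rightarrow> real set" where
  "Xi G \<alpha> = {\<xi>. \<xi> > 0 \<and> (\<exists>\<theta>\<in>{- pi<..pi}. G (of_real \<xi> * exp (\<i> * of_real \<theta>)) = \<alpha>)}"

text \<open>The increasing enumeration \<open>\<dots> < \<xi> i < \<xi> (i + 1) < \<dots>\<close> of a set \<open>X\<close>. It may stop on
  either side, so its indices run through a set \<open>J\<close> of consecutive integers, and the entry
  \<open>\<xi> i\<close> exists iff \<open>i \<in> J\<close>.\<close>

definition increasing_enumeration :: "int set \<Rightarrow> (int \<Rightarrow> real) \<Rightarrow> real set \<Rightarrow> bool" where
  "increasing_enumeration J \<xi> X \<longleftrightarrow>
     (\<forall>i\<in>J. \<forall>j\<in>J. {i..j} \<subseteq> J) \<and> strict_mono_on J \<xi> \<and> \<xi> ` J = X"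

text \<open>The possible values of \<open>z\<^sub>i\<close>.\<close>

definition alpha_pts :: "(complex \<Rightarrow> complex) \<Rightarrow> complex \<Rightarrow> (int \<Rightarrow> real) \<Rightarrow> int \<Rightarrow> complex set" where
  "alpha_pts G \<alpha> \<xi> i = {z. G z = \<alpha> \<and> norm z = \<xi> i}"

definition zstar :: "nat \<Rightarrow> int \<Rightarrow> complex \<Rightarrow> complex" where
  "zstar k s z = cnj z * epi k (- 2 * s)"

end

(*
  Put z = e_{2m} exp(tau / k) with tau in the closed strip 0 <= Im tau <= pi; up to the symmetry z -> z^*
  every nonzero z has this form, and G(z) = e_{2mp} F(tau), where F = exp L away from the zeros (which
  lie on the upper boundary line) and the poles (on the lower one). The derivative q = L' = p/k + h(exp tau)
  has positive imaginary part inside the strip, because h = w g'/g is a sum of terms mapping the upper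
  half-plane to itself. Integrating q along chords gives Im ((L t - L s) / (t - s)) > 0: |F| strictly
  decreases in Im tau, so the level set |F| = |alpha| is part of a graph Im tau = theta(Re tau), and the
  argument V = Im L increases along it. Extending the graph by clamping theta to 0 or pi, where V is
  constant, the intermediate value theorem shows that V grows by exactly 2 pi / k between consecutive
  alpha-points, unless both lie on one boundary line with |F| on one side of |alpha| between them. On
  these lines L is real up to a constant and strictly convex (below) or concave (above), which controls
  the sign of q at such a pair, and the multiplicities.
*)

theory Submission
  imports Defs "HOL-Complex_Analysis.Complex_Analysis"
begin


section \<open>Products of genus zero with negative zeros\<close>

text \<open>One strip serves all sectors at once. As p is coprime to k, the constants e_{2mp} run
  through all k-th roots of unity, so a point of the level curve gives an \<alpha>-point in some
  sector exactly when its argument lies in Arg \<alpha> + (2 pi / k) Z, and the argument determines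
  the sector index modulo k. An increase by 2 pi / k is the congruence p (m - l) = 1 of the
  statement. The obstacle is that the level set may consist of several arcs, and consecutive
  \<alpha>-points may lie on different ones. Clamping bridges the gaps at no cost in V, and the
  chord inequality compares any two points of the level set directly, without tangents or an
  implicit function. Signs of q decide (c), (d) and (e). Two consecutive points on one boundary ray
  have cos b * q < 0 at the first and > 0 at the second; for any other pair the weak opposite signs
  hold at those ends that are on the boundary. A boundary point with neighbours of other arguments
  on both sides therefore has q = 0, and strict convexity or concavity keeps its multiplicity at
  2.\<close>

definition genus0 :: "(nat \<Rightarrow> real) \<Rightarrow> complex \<Rightarrow> complex" where
  "genus0 u w = prodinf (\<lambda>n. 1 + of_real (u n) * w)"

text \<open>The factor w makes this the derivative of log \<open>genus0 u (exp \<tau>)\<close> in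
  \<tau>, and makes every summand u w / (1 + u w) a map of the upper half-plane into its
  closure.\<close>

definition genus0_ld :: "(nat \<Rightarrow> real) \<Rightarrow> complex \<Rightarrow> complex" where
  "genus0_ld u w = w * deriv (genus0 u) w / genus0 u w"

locale weights =
  fixes u :: "nat \<Rightarrow> real"
  assumes nonneg: "u n \<ge> 0" and summable: "summable u"
begin

lemma convergent_genus0: "convergent_prod (\<lambda>n. 1 + of_real (u n) * (w::complex))"
proof -
  have "summable (\<lambda>n. norm (1 + of_real (u n) * w - 1))"
    using summable_mult2[OF summable, of "norm w"] nonneg by (simp add: norm_mult)
  then show ?thesis
    by (intro abs_convergent_prod_imp_convergent_prod summable_imp_abs_convergent_prod)
qed

lemma genus0_limit: "(\<lambda>n. \<Prod>k<n. 1 + of_real (u k) * w) \<longlonglongrightarrow> genus0 u w"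
  using convergent_prod_LIMSEQ[OF convergent_genus0]
  unfolding genus0_def by (subst (asm) LIMSEQ_lessThan_iff_atMost[symmetric])

text \<open>Convergence of a product excludes the limit 0 unless some factor is 0.\<close>

lemma genus0_eq_0_iff: "genus0 u w = 0 \<longleftrightarrow> (\<exists>n. 1 + of_real (u n) * w = 0)"
  using has_prod_eq_0_iff[OF convergent_prod_has_prod[OF convergent_genus0[of w]]]
  by (auto simp: genus0_def)

lemma genus0_nonzero:
  assumes "Im w \<noteq> 0 \<or> Re w \<ge> 0"
  shows "genus0 u w \<noteq> 0"
proof
  assume "genus0 u w = 0"
  then obtain n where n: "1 + of_real (u n) * w = 0" by (auto simp: genus0_eq_0_iff)
  then have "u n * Im w = 0" "1 + u n * Re w = 0"
    by (auto simp: complex_eq_iff)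
  then show False using assms nonneg[of n]
    by (metis add_nonneg_pos mult_eq_0_iff mult_nonneg_nonneg mult_zero_left add.commute
        add.right_neutral less_irrefl zero_less_one)
qed

lemma uniform_limit_genus0:
  "uniform_limit (cball 0 R) (\<lambda>n w. \<Prod>k<n. 1 + of_real (u k) * w) (genus0 u) sequentially"
proof -
  have "uniformly_convergent_on (cball 0 R) (\<lambda>N w. \<Prod>n<N. 1 + of_real (u n) * (w::complex))"
  proof (rule uniformly_convergent_on_prod)
    show "uniformly_convergent_on (cball 0 R) (\<lambda>N w. \<Sum>n<N. norm (of_real (u n) * (w::complex)))"
    proof (rule Weierstrass_m_test'_ev)
      show "\<forall>\<^sub>F n in sequentially. \<forall>w\<in>cball 0 R. norm (norm (of_real (u n) * (w::complex))) \<le> u n * R"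
        using nonneg by (auto simp: norm_mult intro!: mult_left_mono always_eventually)
    qed (rule summable_mult2[OF summable])
  qed (auto intro!: continuous_intros)
  then obtain l where l: "uniform_limit (cball 0 R) (\<lambda>N w. \<Prod>n<N. 1 + of_real (u n) * (w::complex)) l sequentially"
    unfolding uniformly_convergent_on_def by blast
  have "l w = genus0 u w" if "w \<in> cball 0 R" for w
    by (rule LIMSEQ_unique[OF tendsto_uniform_limitI[OF l that] genus0_limit])
  then show ?thesis
    using l by (subst (asm) uniform_limit_cong'[OF refl]) auto
qed

lemma holomorphic_genus0: "genus0 u holomorphic_on A"
proof -
  have "genus0 u field_differentiable at w" for w
  proof -
    have "genus0 u holomorphic_on ball 0 (norm w + 1)"
    proof (rule holomorphic_uniform_limit[THEN conjunct2])
      show "uniform_limit (cball 0 (norm w + 1)) (\<lambda>n w. \<Prod>k<n. 1 + of_real (u k) * w) (genus0 u) sequentially"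
        by (rule uniform_limit_genus0)
    qed (auto intro!: always_eventually continuous_intros holomorphic_intros)
    then show ?thesis
      using holomorphic_on_imp_differentiable_at[of "genus0 u" "ball 0 (norm w + 1)" w] by auto
  qed
  then show ?thesis
    by (simp add: holomorphic_on_def field_differentiable_at_within)
qed

lemma continuous_genus0: "continuous_on A (genus0 u)"
  by (rule holomorphic_on_imp_continuous_on[OF holomorphic_genus0])

lemma genus0_has_derivative: "(genus0 u has_field_derivative deriv (genus0 u) w) (at w)"
  using holomorphic_genus0[of UNIV] holomorphic_derivI by blast

lemma genus0_cnj: "genus0 u (cnj w) = cnj (genus0 u w)"
proof -
  have "(\<lambda>n. cnj (\<Prod>k<n. 1 + of_real (u k) * w)) \<longlonglongrightarrow> cnj (genus0 u w)"
    by (intro tendsto_cnj genus0_limit)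
  then have "(\<lambda>n. (\<Prod>k<n. 1 + of_real (u k) * cnj w)) \<longlonglongrightarrow> cnj (genus0 u w)"
    by simp
  then show ?thesis by (rule LIMSEQ_unique[OF genus0_limit])
qed

text \<open>Locally uniform convergence of the partial products permits logarithmic differentiation
  factor by factor.\<close>

lemma genus0_ld_sums:
  assumes "genus0 u w \<noteq> 0"
  shows "(\<lambda>n. of_real (u n) * w / (1 + of_real (u n) * w)) sums genus0_ld u w"
proof -
  have "(\<lambda>n. deriv (\<lambda>w. 1 + of_real (u n) * w) w / (1 + of_real (u n) * w)) sums (deriv (genus0 u) w / genus0 u w)"
  proof (rule logderiv_prodinf_complex_uniform_limit)
    show "uniform_limit (ball 0 (norm w + 1)) (\<lambda>n w. \<Prod>k<n. 1 + of_real (u k) * w) (genus0 u) sequentially"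
      by (rule uniform_limit_on_subset[OF uniform_limit_genus0[of "norm w + 1"]]) auto
  qed (use assms in \<open>auto intro!: holomorphic_intros\<close>)
  moreover have "deriv (\<lambda>w. 1 + of_real (u n) * w) w = of_real (u n)" for n
    by (rule DERIV_imp_deriv) (auto intro!: derivative_eq_intros)
  ultimately have "(\<lambda>n. of_real (u n) / (1 + of_real (u n) * w)) sums (deriv (genus0 u) w / genus0 u w)"
    by simp
  from sums_mult[OF this, of w] show ?thesis
    by (simp add: genus0_ld_def mult_ac)
qed

lemma Im_genus0_term:
  "Im (of_real (u n) * w / (1 + of_real (u n) * w)) = u n * Im w / (cmod (1 + of_real (u n) * w))\<^sup>2"
  by (simp add: Im_divide cmod_power2 algebra_simps)

lemma genus0_ld_real:
  assumes "w \<in> \<real>" "genus0 u w \<noteq> 0"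
  shows "genus0_ld u w \<in> \<real>"
proof -
  have "(\<lambda>n. Im (of_real (u n) * w / (1 + of_real (u n) * w))) sums Im (genus0_ld u w)"
    by (rule sums_Im[OF genus0_ld_sums[OF assms(2)]])
  moreover have "Im w = 0" using assms(1) by (simp add: complex_is_Real_iff)
  ultimately have "(\<lambda>n. 0) sums Im (genus0_ld u w)" by (simp only: Im_genus0_term) simp
  then show ?thesis
    using sums_unique2[OF _ sums_zero] complex_is_Real_iff by blast
qed

text \<open>No summand has negative imaginary part, so a single positive weight already makes the
  sum strictly positive.\<close>

lemma Im_genus0_ld:
  assumes "Im w > 0"
  shows "Im (genus0_ld u w) \<ge> 0" and "u j > 0 \<Longrightarrow> Im (genus0_ld u w) > 0"
proof -
  have s: "(\<lambda>n. Im (of_real (u n) * w / (1 + of_real (u n) * w))) sums Im (genus0_ld u w)"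
    by (rule sums_Im, rule genus0_ld_sums, rule genus0_nonzero) (use assms in simp)
  have nn: "0 \<le> Im (of_real (u n) * w / (1 + of_real (u n) * w))" for n
    unfolding Im_genus0_term using nonneg[of n] assms by simp
  show "Im (genus0_ld u w) \<ge> 0" by (rule sums_le[OF nn sums_zero s])
  have "1 + of_real (u j) * w \<noteq> 0"
    using genus0_nonzero[of w] genus0_eq_0_iff[of w] assms by auto
  then have "Im (of_real (u j) * w / (1 + of_real (u j) * w)) > 0" if "u j > 0"
    unfolding Im_genus0_term using that assms by simp
  moreover have "Im (of_real (u j) * w / (1 + of_real (u j) * w)) \<le> Im (genus0_ld u w)"
    using sum_le_suminf[OF sums_summable[OF s], of "{j}"] nn sums_unique[OF s] by simp
  ultimately show "u j > 0 \<Longrightarrow> Im (genus0_ld u w) > 0" by simp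
qed

lemma genus0_ld_has_derivative:
  assumes "genus0 u w \<noteq> 0"
  shows "(genus0_ld u has_field_derivative deriv (genus0_ld u) w) (at w)"
proof -
  have "open {w. genus0 u w \<noteq> 0}"
    by (intro open_Collect_neq continuous_on_const continuous_genus0)
  moreover have "genus0_ld u holomorphic_on {w. genus0 u w \<noteq> 0}"
    unfolding genus0_ld_def
    by (intro holomorphic_intros holomorphic_genus0
        holomorphic_deriv[of _ UNIV, THEN holomorphic_on_subset]) auto
  ultimately show ?thesis using assms holomorphic_derivI by blast
qed

text \<open>Along real increments the difference quotient is the real series of u n / ((1 + u n y)
  (1 + u n x)), with nonnegative terms for y near x. Keeping only term j and letting y tend to x
  gives the bound without differentiating the series termwise.\<close>

lemma deriv_genus0_ld_real:
  assumes nz: "genus0 u (of_real x) \<noteq> 0"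
  shows "deriv (genus0_ld u) (of_real x) \<in> \<real>"
    and "Re (deriv (genus0_ld u) (of_real x)) \<ge> u j / (1 + u j * x)\<^sup>2"
proof -
  let ?D = "deriv (genus0_ld u) (of_real x)"
  have op: "open {y::real. genus0 u (of_real y) \<noteq> 0}"
    by (intro open_Collect_neq continuous_on_const continuous_on_compose2[OF continuous_genus0[of UNIV]])
       (auto intro!: continuous_intros)
  then obtain \<epsilon> where \<epsilon>: "\<epsilon> > 0" "ball x \<epsilon> \<subseteq> {y. genus0 u (of_real y) \<noteq> 0}"
    using nz openE[OF op, of x] by auto
  have nzy: "genus0 u (of_real y) \<noteq> 0" if "dist y x < \<epsilon>" for y
    using \<epsilon>(2) that by (auto simp: ball_def dist_commute)
  let ?q = "\<lambda>y. (genus0_ld u (of_real y) - genus0_ld u (of_real x)) / (of_real y - of_real x)"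
  have "((\<lambda>w. (genus0_ld u w - genus0_ld u (of_real x)) / (w - of_real x)) \<longlongrightarrow> ?D) (at (of_real x))"
    using genus0_ld_has_derivative[OF nz] by (simp add: has_field_derivative_iff)
  then have lim: "(?q \<longlongrightarrow> ?D) (at x)"
  proof (rule filterlim_compose)
    show "filterlim of_real (at (complex_of_real x)) (at x)"
      unfolding filterlim_at
      by (auto simp: eventually_at_filter intro!: tendsto_of_real)
  qed
  have ev: "\<forall>\<^sub>F y in at x. dist y x < \<epsilon> \<and> y \<noteq> x"
    using \<epsilon>(1) by (auto simp: eventually_at)
  have "\<forall>\<^sub>F y in at x. Im (?q y) = 0"
    using ev
  proof eventually_elim
    case (elim y)
    then have "genus0_ld u (of_real y) \<in> \<real>" "genus0_ld u (of_real x) \<in> \<real>"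
      using genus0_ld_real nzy nz by auto
    then have "?q y \<in> \<real>" by (intro Reals_divide Reals_diff) auto
    then show ?case by (simp add: complex_is_Real_iff)
  qed
  then have "((\<lambda>y. Im (?q y)) \<longlongrightarrow> 0) (at x)" by (rule tendsto_eventually)
  moreover have "((\<lambda>y. Im (?q y)) \<longlongrightarrow> Im ?D) (at x)" by (intro tendsto_Im lim)
  ultimately have "Im ?D = 0" using tendsto_unique[OF trivial_limit_at] by blast
  then show "?D \<in> \<real>" by (simp add: complex_is_Real_iff)
  have nz1: "1 + u n * y \<noteq> 0" if "dist y x < \<epsilon>" for n y
  proof
    assume "1 + u n * y = 0"
    then have "1 + of_real (u n) * complex_of_real y = 0"
      by (metis of_real_0 of_real_1 of_real_add of_real_mult)
    then show False using nzy[OF that] genus0_eq_0_iff by blast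
  qed
  \<comment> \<open>A change of sign would put the zero -1 / u n of the factor between x and y,
    within \<epsilon> of x, where the product has no zero.\<close>
  have pos: "(1 + u n * y) * (1 + u n * x) > 0" if "dist y x < \<epsilon>" for n y
  proof (rule ccontr)
    assume "\<not> ?thesis"
    then have neg: "(1 + u n * y) * (1 + u n * x) < 0"
      using nz1[OF that, of n] nz1[of x n] \<epsilon>(1) by (metis dist_self linorder_neqE_linordered_idom mult_eq_0_iff)
    then have un: "u n > 0" using nonneg[of n] by (cases "u n = 0") (auto)
    define t where "t = - 1 / u n"
    have t: "1 + u n * t = 0" unfolding t_def using un by simp
    have "u n * (y - t) = 1 + u n * y" "u n * (x - t) = 1 + u n * x"
      using t by (simp_all add: algebra_simps)
    with neg have "(u n * (y - t)) * (u n * (x - t)) < 0"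
      by simp
    then have "(y - t) * (x - t) < 0" using un
      by (simp add: mult_less_0_iff zero_less_mult_iff)
    then have "dist t x < \<epsilon>" using that by (auto simp: mult_less_0_iff dist_real_def)
    then show False using nz1 t by blast
  qed
  have "\<forall>\<^sub>F y in at x. u j / ((1 + u j * y) * (1 + u j * x)) \<le> Re (?q y)"
    using ev
  proof eventually_elim
    case (elim y)
    have "(\<lambda>n. (of_real (u n) * of_real y / (1 + of_real (u n) * of_real y)
             - of_real (u n) * of_real x / (1 + of_real (u n) * of_real x)) / (of_real y - of_real x))
          sums ?q y"
      using elim by (intro sums_divide sums_diff genus0_ld_sums nzy nz) auto
    moreover have "(of_real (u n) * of_real y / (1 + of_real (u n) * of_real y)
             - of_real (u n) * of_real x / (1 + of_real (u n) * of_real x)) / (of_real y - of_real x)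
        = complex_of_real (u n / ((1 + u n * y) * (1 + u n * x)))" for n
    proof -
      have "(u n * y / (1 + u n * y) - u n * x / (1 + u n * x)) / (y - x) = u n / ((1 + u n * y) * (1 + u n * x))"
        using elim nz1[of y n] nz1[of x n] \<epsilon>(1) by (simp add: divide_simps) (simp add: algebra_simps)
      from arg_cong[OF this, of complex_of_real] show ?thesis by simp
    qed
    ultimately have s: "(\<lambda>n. complex_of_real (u n / ((1 + u n * y) * (1 + u n * x)))) sums ?q y"
      by simp
    from sums_Re[OF this] have s: "(\<lambda>n. u n / ((1 + u n * y) * (1 + u n * x))) sums Re (?q y)"
      by simp
    have "u n / ((1 + u n * y) * (1 + u n * x)) \<ge> 0" for n
      using pos[of y n] elim nonneg[of n] by simp
    then show ?case
      using sum_le_suminf[OF sums_summable[OF s], of "{j}"] sums_unique[OF s] by simp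
  qed
  moreover have "((\<lambda>y. u j / ((1 + u j * y) * (1 + u j * x))) \<longlongrightarrow> u j / ((1 + u j * x) * (1 + u j * x))) (at x)"
    using nz1[of x j] \<epsilon>(1) by (auto intro!: tendsto_intros)
  moreover have "((\<lambda>y. Re (?q y)) \<longlongrightarrow> Re ?D) (at x)" by (intro tendsto_Re lim)
  ultimately show "Re ?D \<ge> u j / (1 + u j * x)\<^sup>2"
    unfolding power2_eq_square by (intro tendsto_le[OF trivial_limit_at])
qed

lemma deriv_genus0_ld_nonneg:
  assumes "genus0 u (of_real x) \<noteq> 0"
  shows "Re (deriv (genus0_ld u) (of_real x)) \<ge> 0"
    and "u j > 0 \<Longrightarrow> Re (deriv (genus0_ld u) (of_real x)) > 0"
proof -
  have "u 0 / (1 + u 0 * x)\<^sup>2 \<ge> 0" using nonneg by simp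
  then show "Re (deriv (genus0_ld u) (of_real x)) \<ge> 0"
    using deriv_genus0_ld_real(2)[OF assms, of 0] by linarith
  assume j: "u j > 0"
  have "1 + u j * x \<noteq> 0"
  proof
    assume "1 + u j * x = 0"
    from arg_cong[OF this, of complex_of_real] have "1 + of_real (u j) * complex_of_real x = 0" by simp
    then show False using assms genus0_eq_0_iff by blast
  qed
  then have "u j / (1 + u j * x)\<^sup>2 > 0" using j by simp
  then show "Re (deriv (genus0_ld u) (of_real x)) > 0"
    using deriv_genus0_ld_real(2)[OF assms, of j] by linarith
qed

lemma genus0_ld_cnj:
  assumes "genus0 u w \<noteq> 0"
  shows "genus0_ld u (cnj w) = cnj (genus0_ld u w)"
proof (rule sums_unique2)
  have "genus0 u (cnj w) \<noteq> 0" using assms by (simp add: genus0_cnj)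
  from genus0_ld_sums[OF this]
  show "(\<lambda>n. cnj (of_real (u n) * w / (1 + of_real (u n) * w))) sums genus0_ld u (cnj w)" by simp
  show "(\<lambda>n. cnj (of_real (u n) * w / (1 + of_real (u n) * w))) sums cnj (genus0_ld u w)"
    by (subst sums_cnj) (rule genus0_ld_sums[OF assms])
qed

end


section \<open>Level curves in a strip\<close>

text \<open>As cos b is 1 on the lower line and -1 on the upper one, \<open>q_mono\<close> states
  convexity of Re L below and concavity above in one formula. It speaks only of intervals inside
  \<open>T\<close>, because poles and zeros interrupt the lines.\<close>

locale log_strip =
  fixes T :: "complex set" and L q :: "complex \<Rightarrow> complex"
  assumes T_strip: "\<tau> \<in> T \<Longrightarrow> 0 \<le> Im \<tau> \<and> Im \<tau> \<le> pi"
    and T_interior: "0 < Im \<tau> \<Longrightarrow> Im \<tau> < pi \<Longrightarrow> \<tau> \<in> T"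
    and T_line: "Complex x b \<in> T \<Longrightarrow> b \<in> {0, pi} \<Longrightarrow> \<exists>\<epsilon>>0. \<forall>y. \<bar>y - x\<bar> < \<epsilon> \<longrightarrow> Complex y b \<in> T"
    and L_deriv: "\<tau> \<in> T \<Longrightarrow> (L has_field_derivative q \<tau>) (at \<tau> within T)"
    and q_interior: "0 < Im \<tau> \<Longrightarrow> Im \<tau> < pi \<Longrightarrow> Im (q \<tau>) > 0"
    and q_line: "Complex x b \<in> T \<Longrightarrow> b \<in> {0, pi} \<Longrightarrow> Im (q (Complex x b)) = 0"
    and q_mono: "b \<in> {0, pi} \<Longrightarrow> x < y \<Longrightarrow> (\<And>u. u \<in> {x..y} \<Longrightarrow> Complex u b \<in> T) \<Longrightarrow>
      cos b * Re (q (Complex x b)) < cos b * Re (q (Complex y b))"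
begin

lemma L_cont: "continuous_on T L"
  by (rule DERIV_continuous_on) (rule L_deriv)

text \<open>The open segment lies in the open strip, and along it Im (L / (t - s)) has derivative Im
  q > 0, the factor t - s cancelling. Two ends on the same boundary line are excluded because q is
  real there.\<close>

lemma chord:
  assumes st: "s \<in> T" "t \<in> T" "s \<noteq> t" and off: "Im s \<noteq> Im t \<or> Im s \<notin> {0, pi}"
  shows "Im ((L t - L s) / (t - s)) > 0"
proof -
  define P where "P u = s + of_real u * (t - s)" for u :: real
  define \<phi> where "\<phi> u = Im (L (P u) / (t - s))" for u
  let ?U = "{\<tau>. 0 < Im \<tau> \<and> Im \<tau> < pi}"
  have opU: "open ?U"
    by (intro open_Collect_conj open_Collect_less continuous_intros)
  have PU: "P u \<in> ?U" if "0 < u" "u < 1" for u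
  proof -
    have e: "Im (P u) = (1 - u) * Im s + u * Im t"
      by (simp add: P_def algebra_simps)
    have b: "0 \<le> Im s" "Im s \<le> pi" "0 \<le> Im t" "Im t \<le> pi" using T_strip st by auto
    have "0 < Im s \<or> 0 < Im t" "Im s < pi \<or> Im t < pi" using b off by auto
    then have "0 < Im (P u)" "0 < (1 - u) * (pi - Im s) + u * (pi - Im t)"
      unfolding e using b that
      by (metis add_nonneg_pos add_pos_nonneg diff_gt_0_iff_gt less_eq_real_def mult_nonneg_nonneg mult_pos_pos diff_ge_0_iff_ge)+
    moreover have "(1 - u) * (pi - Im s) + u * (pi - Im t) = pi - Im (P u)"
      unfolding e by (simp add: algebra_simps)
    ultimately show ?thesis by simp
  qed
  have PT: "P u \<in> T" if u: "u \<in> {0..1}" for u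
  proof -
    have "u = 0 \<or> u = 1 \<or> 0 < u \<and> u < 1" using u by force
    moreover have "P 0 = s" "P 1 = t" by (simp_all add: P_def)
    ultimately show ?thesis using PU[of u] T_interior[of "P u"] st by auto
  qed
  have "\<phi> 0 < \<phi> 1"
  proof (rule DERIV_pos_imp_increasing_open[of 0 1 \<phi>])
    fix u :: real assume u: "0 < u" "u < 1"
    have "(L has_field_derivative q (P u)) (at (P u) within ?U)"
      by (rule has_field_derivative_subset[OF L_deriv]) (use PT u T_interior in auto)
    then have d: "(L has_field_derivative q (P u)) (at (P u))"
      using at_within_open[OF PU[OF u] opU] by simp
    have "(P has_vector_derivative (t - s)) (at u)"
      unfolding P_def by (auto intro!: derivative_eq_intros)
    from field_vector_diff_chain_at[OF this d]
    have "((\<lambda>u. L (P u) / (t - s)) has_vector_derivative (t - s) * q (P u) / (t - s)) (at u)"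
      unfolding o_def by (rule has_vector_derivative_divide)
    then have "((\<lambda>u. L (P u) / (t - s)) has_vector_derivative q (P u)) (at u)"
      using st(3) by simp
    from bounded_linear.has_vector_derivative[OF bounded_linear_Im this]
    have "(\<phi> has_real_derivative Im (q (P u))) (at u)"
      unfolding \<phi>_def has_real_derivative_iff_has_vector_derivative by simp
    then show "\<exists>y. (\<phi> has_real_derivative y) (at u) \<and> 0 < y"
      using q_interior PU[OF u] by blast
  next
    have "continuous_on {0..1} P" unfolding P_def by (intro continuous_intros)
    moreover have "P ` {0..1} \<subseteq> T" using PT by blast
    ultimately have "continuous_on {0..1} (\<lambda>u. L (P u))"
      by (rule continuous_on_compose2[OF L_cont])
    then show "continuous_on {0..1} \<phi>"
      unfolding \<phi>_def using st(3) by (intro continuous_intros) auto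
  qed simp
  then show ?thesis by (simp add: \<phi>_def P_def diff_divide_distrib)
qed

text \<open>The chord is i times a positive number, so dividing by it turns an imaginary part into
  minus a real part.\<close>

lemma vertical:
  assumes "Complex x y \<in> T" "Complex x y' \<in> T" "y < y'"
  shows "Re (L (Complex x y')) < Re (L (Complex x y))"
proof -
  have "Im ((L (Complex x y') - L (Complex x y)) / (Complex x y' - Complex x y)) > 0"
    by (rule chord) (use assms in auto)
  moreover have "Complex x y' - Complex x y = \<i> * of_real (y' - y)"
    by (simp add: complex_eq_iff)
  ultimately show ?thesis using assms(3)
    by (simp add: Im_divide power2_eq_square divide_simps zero_less_mult_iff)
qed

end

text \<open>Re L decreases upwards, so over each abscissa it passes c at most once. Where it stays
  below c the height is set to 0, where it stays above c to pi; this keeps \<theta> total and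
  continuous across the gaps of the level set.\<close>

locale level_curve = log_strip +
  fixes c :: real and \<theta> :: "real \<Rightarrow> real"
  assumes \<theta>_cont: "continuous_on UNIV \<theta>"
    and \<theta>_T: "Complex x (\<theta> x) \<in> T"
    and \<theta>_clamp: "Re (L (Complex x (\<theta> x))) = c \<or> \<theta> x = 0 \<and> Re (L (Complex x (\<theta> x))) < c
      \<or> \<theta> x = pi \<and> Re (L (Complex x (\<theta> x))) > c"
begin

definition \<gamma> where "\<gamma> x = Complex x (\<theta> x)"
definition V where "V x = Im (L (\<gamma> x))"
text \<open>Singles out the abscissae whose curve point really lies on the level set, as opposed to
  the merely clamped ones.\<close>

definition X where "X x \<longleftrightarrow> Re (L (\<gamma> x)) = c"

lemma \<theta>_range: "0 \<le> \<theta> x" "\<theta> x \<le> pi"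
  using T_strip[OF \<theta>_T[of x]] by auto

lemma \<gamma>_cont: "continuous_on A \<gamma>"
  unfolding \<gamma>_def Complex_eq
  by (intro continuous_intros continuous_on_subset[OF \<theta>_cont]) auto

lemma L\<gamma>_cont: "continuous_on A (\<lambda>x. L (\<gamma> x))"
  by (rule continuous_on_compose2[OF L_cont \<gamma>_cont]) (use \<theta>_T in \<open>auto simp: \<gamma>_def\<close>)

lemma V_cont: "continuous_on A V"
  unfolding V_def by (intro continuous_intros L\<gamma>_cont)

lemma X_if_interior: "0 < \<theta> x \<Longrightarrow> \<theta> x < pi \<Longrightarrow> X x"
  using \<theta>_clamp[of x] by (auto simp: X_def \<gamma>_def)

text \<open>Strict decrease along the vertical leaves room for no second height, clamped or
  not.\<close>

lemma \<theta>_unique: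
  assumes "\<tau> \<in> T" "Re (L \<tau>) = c"
  shows "\<theta> (Re \<tau>) = Im \<tau>"
proof (rule ccontr)
  define x y where "x = Re \<tau>" and "y = Im \<tau>"
  have xy: "\<tau> = Complex x y" by (simp add: x_def y_def)
  assume "\<not> ?thesis"
  then consider "\<theta> x < y" | "y < \<theta> x" by (force simp: x_def y_def)
  then show False
  proof cases
    case 1
    then show ?thesis using vertical[of x "\<theta> x" y] \<theta>_clamp[of x] \<theta>_T[of x] assms T_strip[OF assms(1)]
      by (auto simp: xy)
  next
    case 2
    then show ?thesis using vertical[of x y "\<theta> x"] \<theta>_clamp[of x] \<theta>_T[of x] assms T_strip[OF assms(1)]
      by (auto simp: xy)
  qed
qed

text \<open>The sign condition reads Re L < c on the lower line and Re L > c on the upper one; in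
  both cases \<open>vertical\<close> keeps every other height over x strictly on that side of
  c.\<close>

lemma \<theta>_clamped:
  assumes "Complex x b \<in> T" "b \<in> {0, pi}" "cos b * (Re (L (Complex x b)) - c) < 0"
  shows "\<theta> x = b"
proof (rule ccontr)
  assume ne: "\<theta> x \<noteq> b"
  show False
  proof (cases "b = 0")
    case True
    then have "Re (L (Complex x (\<theta> x))) < Re (L (Complex x b))"
      using vertical[OF assms(1) \<theta>_T[of x]] \<theta>_range[of x] ne by auto
    then show False using assms(3) True \<theta>_clamp[of x] ne by auto
  next
    case False
    then have b: "b = pi" using assms by auto
    then have "Re (L (Complex x (\<theta> x))) > Re (L (Complex x b))"
      using vertical[OF \<theta>_T[of x] assms(1)] \<theta>_range[of x] ne by auto
    then show False using assms(3) b \<theta>_clamp[of x] ne by auto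
  qed
qed

text \<open>Both points have Re L = c, so the increment of L is i (V y - V x), and the chord
  inequality says that (V y - V x) (y - x) is positive.\<close>

lemma V_less:
  assumes "X x" "X y" "x < y" and "\<theta> x \<noteq> \<theta> y \<or> \<theta> x \<notin> {0, pi}"
  shows "V x < V y"
proof -
  have p: "Im ((L (\<gamma> y) - L (\<gamma> x)) / (\<gamma> y - \<gamma> x)) > 0"
    by (rule chord) (use assms \<theta>_T in \<open>auto simp: \<gamma>_def\<close>)
  have e: "L (\<gamma> y) - L (\<gamma> x) = \<i> * of_real (V y - V x)"
    using assms by (simp add: complex_eq_iff V_def X_def)
  have "Im (\<i> * of_real (V y - V x) / (\<gamma> y - \<gamma> x)) = (V y - V x) * ((y - x) / (cmod (\<gamma> y - \<gamma> x))\<^sup>2)"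
    by (simp add: Im_divide cmod_power2 \<gamma>_def)
  then have "0 < (V y - V x) * ((y - x) / (cmod (\<gamma> y - \<gamma> x))\<^sup>2)"
    using p unfolding e by simp
  moreover have "(y - x) / (cmod (\<gamma> y - \<gamma> x))\<^sup>2 \<ge> 0" using assms by simp
  moreover have "a > 0" if "0 < a * r" "0 \<le> r" for a r :: real
    using that by (auto simp: zero_less_mult_iff)
  ultimately have "V y - V x > 0" by meson
  then show ?thesis by simp
qed

lemma line_deriv:
  assumes "\<And>u. u \<in> S \<Longrightarrow> Complex u b \<in> T" "u \<in> S"
  shows "((\<lambda>u. L (Complex u b)) has_vector_derivative q (Complex u b)) (at u within S)"
proof -
  have "((\<lambda>u. Complex u b) has_vector_derivative 1) (at u within S)"
    unfolding Complex_eq by (auto intro!: derivative_eq_intros)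
  moreover have "(L has_field_derivative q (Complex u b)) (at (Complex u b) within (\<lambda>u. Complex u b) ` S)"
    by (rule has_field_derivative_subset[OF L_deriv]) (use assms in auto)
  ultimately show ?thesis
    using field_vector_diff_chain_within[of "\<lambda>u. Complex u b" 1 u S L "q (Complex u b)"] by (simp add: o_def)
qed

lemma line_deriv_Re:
  assumes "\<And>u. u \<in> S \<Longrightarrow> Complex u b \<in> T" "u \<in> S"
  shows "((\<lambda>u. cos b * Re (L (Complex u b))) has_real_derivative cos b * Re (q (Complex u b))) (at u within S)"
proof (rule DERIV_cmult)
  show "((\<lambda>u. Re (L (Complex u b))) has_real_derivative Re (q (Complex u b))) (at u within S)"
    using bounded_linear.has_vector_derivative[OF bounded_linear_Re line_deriv[OF assms]]
    by (simp add: has_real_derivative_iff_has_vector_derivative)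
qed

text \<open>Along a boundary line Im L has derivative Im q = 0.\<close>

lemma V_line:
  assumes b: "b \<in> {0, pi}" and "x \<le> y" and \<theta>b: "\<And>u. u \<in> {x..y} \<Longrightarrow> \<theta> u = b"
  shows "V x = V y"
proof -
  have T: "Complex u b \<in> T" if "u \<in> {x..y}" for u using \<theta>_T[of u] \<theta>b[OF that] by simp
  have "((\<lambda>u. Im (L (Complex u b))) has_real_derivative 0) (at u within {x..y})" if "u \<in> {x..y}" for u
    using bounded_linear.has_vector_derivative[OF bounded_linear_Im line_deriv[OF T that]] q_line[OF T[OF that] b]
    by (simp add: has_real_derivative_iff_has_vector_derivative)
  then obtain k where "\<And>u. u \<in> {x..y} \<Longrightarrow> Im (L (Complex u b)) = k"
    using has_field_derivative_zero_constant[of "{x..y}" "\<lambda>u. Im (L (Complex u b))"] by auto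
  then show ?thesis using \<theta>b assms(2) by (simp add: V_def \<gamma>_def)
qed

text \<open>The chord inequality fails to apply only to two ends on the same boundary line. If the
  curve leaves that line in between, an interior point of the level set splits the pair into two
  admissible chords.\<close>

lemma V_mono:
  assumes "X x" "X y" "x < y"
  shows "V x < V y \<or> V x = V y \<and> (\<exists>b\<in>{0,pi}. \<forall>u\<in>{x..y}. \<theta> u = b)"
proof (cases "\<theta> x \<noteq> \<theta> y \<or> \<theta> x \<notin> {0, pi}")
  case True
  then show ?thesis using V_less assms by blast
next
  case ends: False
  show ?thesis
  proof (cases "\<forall>u\<in>{x..y}. \<theta> u = \<theta> x")
    case True
    then have "V x = V y" by (intro V_line[of "\<theta> x"]) (use ends assms in blast, use assms in simp, blast)
    then show ?thesis using True ends by blast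
  next
    case False
    then obtain u where u: "u \<in> {x..y}" "\<theta> u \<noteq> \<theta> x" by blast
    then have "u \<noteq> x" "u \<noteq> y" using ends by auto
    then have xu: "x < u" "u < y" using u(1) by auto
    \<comment> \<open>Halfway between a boundary height and a different height the curve is strictly
      inside the strip, hence not clamped.\<close>
    define m where "m = (\<theta> x + \<theta> u) / 2"
    have m: "0 < m" "m < pi" "m \<noteq> \<theta> x"
      using ends u \<theta>_range[of u] by (auto simp: m_def)
    obtain v where v: "x \<le> v" "v \<le> u" "\<theta> v = m"
    proof (cases "\<theta> x \<le> \<theta> u")
      case True
      then show ?thesis using IVT'[of \<theta> x m u] xu that continuous_on_subset[OF \<theta>_cont, of "{x..u}"]
        by (auto simp: m_def)
    next
      case False
      then show ?thesis using IVT2'[of \<theta> u m x] xu that continuous_on_subset[OF \<theta>_cont, of "{x..u}"]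
        by (auto simp: m_def)
    qed
    have "v \<noteq> x" using v m by auto
    then have "x < v" "v < y" using v xu by auto
    moreover have "X v" using X_if_interior v m by simp
    ultimately have "V x < V v" "V v < V y"
      using V_less[of x v] V_less[of v y] assms v m by auto
    then show ?thesis by simp
  qed
qed

text \<open>The strict inequality between Re L and c persists nearby by continuity and pins the
  curve to the same boundary line.\<close>

lemma V_locally_constant:
  assumes "\<not> X u"
  shows "\<exists>\<epsilon>>0. \<forall>v. \<bar>v - u\<bar> < \<epsilon> \<longrightarrow> V v = V u"
proof -
  define b where "b = \<theta> u"
  have b: "b \<in> {0, pi}" "cos b * (Re (L (\<gamma> u)) - c) < 0"
    using \<theta>_clamp[of u] assms by (auto simp: X_def \<gamma>_def b_def)
  have "open {v. cos b * (Re (L (\<gamma> v)) - c) < 0}"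
    by (intro open_Collect_less continuous_intros L\<gamma>_cont)
  from openE[OF this, of u] b(2)
  obtain \<epsilon> where \<epsilon>: "\<epsilon> > 0" "ball u \<epsilon> \<subseteq> {v. cos b * (Re (L (\<gamma> v)) - c) < 0}" by auto
  have \<epsilon>: "\<epsilon> > 0" "\<And>v. \<bar>v - u\<bar> < \<epsilon> \<Longrightarrow> cos b * (Re (L (\<gamma> v)) - c) < 0"
    using \<epsilon> by (auto simp: dist_real_def subset_iff abs_minus_commute)
  have \<theta>b: "\<theta> v = b" if "\<bar>v - u\<bar> < \<epsilon>" for v
    using \<epsilon>(2)[OF that] \<theta>_clamp[of v] b(1) by (auto simp: \<gamma>_def)
  have "V v = V u" if "\<bar>v - u\<bar> < \<epsilon>" for v
  proof (cases "u \<le> v")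
    case True
    show ?thesis by (rule V_line[OF b(1) True, symmetric], rule \<theta>b) (use that in auto)
  next
    case False
    show ?thesis by (rule V_line[OF b(1)], use False in simp, rule \<theta>b) (use that in auto)
  qed
  then show ?thesis using \<epsilon>(1) by blast
qed

text \<open>On the line, cos b * Re L has slope cos b * Re q. A negative slope puts it below cos b *
  c just to the right of x, so there the curve is clamped to the line and V stands still; a positive
  slope has the same effect on the left.\<close>

lemma start_constant:
  assumes "X x" and b: "\<theta> x = b" "b \<in> {0, pi}"
  shows "cos b * Re (q (\<gamma> x)) < 0 \<Longrightarrow> \<exists>\<epsilon>>0. \<forall>u\<in>{x..<x+\<epsilon>}. V u = V x"
    and "cos b * Re (q (\<gamma> x)) > 0 \<Longrightarrow> \<exists>\<epsilon>>0. \<forall>u\<in>{x-\<epsilon><..x}. V u = V x"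
proof -
  obtain \<epsilon> where \<epsilon>: "\<epsilon> > 0" "\<And>y. \<bar>y - x\<bar> < \<epsilon> \<Longrightarrow> Complex y b \<in> T"
    using T_line[OF \<theta>_T[of x], unfolded b(1), OF b(2)] by blast
  let ?f = "\<lambda>u. cos b * Re (L (Complex u b))"
  have "(?f has_real_derivative cos b * Re (q (Complex x b))) (at x within ball x \<epsilon>)"
    by (rule line_deriv_Re) (use \<epsilon> in \<open>auto simp: dist_real_def\<close>)
  then have d: "(?f has_real_derivative cos b * Re (q (\<gamma> x))) (at x)"
    using \<epsilon>(1) at_within_open[of x "ball x \<epsilon>"] by (simp add: \<gamma>_def b)
  have fx: "?f x = cos b * c" using assms by (simp add: X_def \<gamma>_def)
  have cl: "\<theta> u = b" if "\<bar>u - x\<bar> < \<epsilon>" "?f u < ?f x" for u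
  proof (rule \<theta>_clamped)
    show "cos b * (Re (L (Complex u b)) - c) < 0" using that(2) fx by (simp add: right_diff_distrib)
  qed (use that(1) \<epsilon>(2) b(2) in simp_all)
  show "\<exists>\<epsilon>>0. \<forall>u\<in>{x..<x+\<epsilon>}. V u = V x" if neg: "cos b * Re (q (\<gamma> x)) < 0"
  proof -
    obtain \<delta> where \<delta>: "\<delta> > 0" "\<And>h. 0 < h \<Longrightarrow> h < \<delta> \<Longrightarrow> ?f (x + h) < ?f x"
      using DERIV_neg_dec_right[OF d neg] by blast
    have \<theta>b: "\<theta> u = b" if "u \<in> {x..<x + min \<epsilon> \<delta>}" for u
    proof (cases "u = x")
      case False
      then have "0 < u - x" "u - x < \<epsilon>" "u - x < \<delta>" using that by auto
      then show ?thesis using cl[of u] \<delta>(2)[of "u - x"] by simp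
    qed (simp add: b(1))
    have "V u = V x" if "u \<in> {x..<x + min \<epsilon> \<delta>}" for u
      by (rule V_line[OF b(2), symmetric], use that in simp, rule \<theta>b) (use that in auto)
    moreover have "min \<epsilon> \<delta> > 0" using \<epsilon>(1) \<delta>(1) by simp
    ultimately show ?thesis by blast
  qed
  show "\<exists>\<epsilon>>0. \<forall>u\<in>{x-\<epsilon><..x}. V u = V x" if pos: "cos b * Re (q (\<gamma> x)) > 0"
  proof -
    obtain \<delta> where \<delta>: "\<delta> > 0" "\<And>h. 0 < h \<Longrightarrow> h < \<delta> \<Longrightarrow> ?f (x - h) < ?f x"
      using DERIV_pos_inc_left[OF d pos] by blast
    have \<theta>b: "\<theta> u = b" if "u \<in> {x - min \<epsilon> \<delta><..x}" for u
    proof (cases "u = x")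
      case False
      then have "0 < x - u" "x - u < \<epsilon>" "x - u < \<delta>" using that by auto
      then show ?thesis using cl[of u] \<delta>(2)[of "x - u"] by simp
    qed (simp add: b(1))
    have "V u = V x" if "u \<in> {x - min \<epsilon> \<delta><..x}" for u
      by (rule V_line[OF b(2)], use that in simp, rule \<theta>b) (use that in auto)
    moreover have "min \<epsilon> \<delta> > 0" using \<epsilon>(1) \<delta>(1) by simp
    ultimately show ?thesis by blast
  qed
qed

text \<open>The last point u of the interval with V u \<le> v must lie on the level set: elsewhere V
  is locally constant and u could be moved to the right. When v = V x, it is \<open>start\<close>
  that prevents u from being x itself.\<close>

lemma crossing_right:
  assumes "x < y" and v: "V x \<le> v" "v < V y"
    and start: "v = V x \<Longrightarrow> \<exists>\<epsilon>>0. \<forall>u\<in>{x..<x+\<epsilon>}. V u = V x"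
  shows "\<exists>u. x < u \<and> u < y \<and> X u \<and> V u = v"
proof -
  define S where "S = {u \<in> {x..y}. V u \<le> v}"
  have "S = {x..y} \<inter> V -` {..v}" by (auto simp: S_def)
  then have "closed S" by (simp add: continuous_closed_preimage[OF V_cont])
  moreover have "bdd_above S" by (rule bdd_aboveI[of _ y]) (simp add: S_def)
  moreover have "x \<in> S" using assms by (simp add: S_def)
  ultimately have S: "closed S" "bdd_above S" "x \<in> S" .
  define u where "u = Sup S"
  have uS: "u \<in> S" unfolding u_def using closed_contains_Sup[of S] S by auto
  have umax: "u' \<le> u" if "u' \<in> S" for u' unfolding u_def by (rule cSup_upper[OF that S(2)])
  have "u \<noteq> y" using uS v by (auto simp: S_def)
  then have uy: "u < y" using uS by (auto simp: S_def)
  have "\<exists>u'\<ge>u. u' \<le> y \<and> V u' = v"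
    by (rule IVT'[OF _ _ _ V_cont]) (use uS v uy in \<open>auto simp: S_def\<close>)
  then obtain u' where u': "u \<le> u'" "u' \<le> y" "V u' = v" by blast
  then have "u' \<in> S" using uS by (auto simp: S_def)
  then have Vu: "V u = v" using umax[of u'] u' by simp
  \<comment> \<open>Maximality of u forbids V to stand still immediately to its right.\<close>
  have nc: False if "\<epsilon> > 0" "\<And>u'. u \<le> u' \<Longrightarrow> u' < u + \<epsilon> \<Longrightarrow> V u' = V u" for \<epsilon>
  proof -
    have "min (u + \<epsilon>/2) y \<in> S" using that(2)[of "min (u + \<epsilon>/2) y"] that(1) uS uy by (auto simp: S_def)
    from umax[OF this] show False using that(1) uy by auto
  qed
  have "X u"
  proof (rule ccontr)
    assume "\<not> X u"
    then obtain \<epsilon> where \<epsilon>: "\<epsilon> > 0" "\<And>v. \<bar>v - u\<bar> < \<epsilon> \<Longrightarrow> V v = V u"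
      using V_locally_constant by blast
    show False by (rule nc[OF \<epsilon>(1)], rule \<epsilon>(2)) auto
  qed
  moreover have "u \<noteq> x"
  proof
    assume "u = x"
    then obtain \<epsilon> where \<epsilon>: "\<epsilon> > 0" "\<forall>u'\<in>{x..<x+\<epsilon>}. V u' = V x" using start Vu by blast
    show False by (rule nc[OF \<epsilon>(1)], unfold \<open>u = x\<close>, rule bspec[OF \<epsilon>(2)]) simp
  qed
  ultimately show ?thesis using uS uy Vu by (intro exI[of _ u]) (auto simp: S_def)
qed

text \<open>Mirror image of \<open>crossing_right\<close> for the first point where V reaches V y.
  The target is the end value itself, so the local constancy before y is always required.\<close>

lemma crossing_left:
  assumes "x < y" and v: "V x < V y"
    and start: "\<exists>\<epsilon>>0. \<forall>u\<in>{y-\<epsilon><..y}. V u = V y"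
  shows "\<exists>u. x < u \<and> u < y \<and> X u \<and> V u = V y"
proof -
  define S where "S = {u \<in> {x..y}. V y \<le> V u}"
  have "S = {x..y} \<inter> V -` {V y..}" by (auto simp: S_def)
  then have "closed S" by (simp add: continuous_closed_preimage[OF V_cont])
  moreover have "bdd_below S" by (rule bdd_belowI[of _ x]) (simp add: S_def)
  moreover have "y \<in> S" using assms by (simp add: S_def)
  ultimately have S: "closed S" "bdd_below S" "y \<in> S" .
  define u where "u = Inf S"
  have uS: "u \<in> S" unfolding u_def using closed_contains_Inf[of S] S by auto
  have umin: "u \<le> u'" if "u' \<in> S" for u' unfolding u_def by (rule cInf_lower[OF that S(2)])
  have "u \<noteq> x" using uS v by (auto simp: S_def)
  then have uy: "x < u" using uS by (auto simp: S_def)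
  have "\<exists>u'\<ge>x. u' \<le> u \<and> V u' = V y"
    by (rule IVT'[OF _ _ _ V_cont]) (use uS v uy in \<open>auto simp: S_def\<close>)
  then obtain u' where u': "x \<le> u'" "u' \<le> u" "V u' = V y" by blast
  then have "u' \<in> S" using uS by (auto simp: S_def)
  then have Vu: "V u = V y" using umin[of u'] u' by simp
  have nc: False if "\<epsilon> > 0" "\<And>u'. u' \<le> u \<Longrightarrow> u - \<epsilon> < u' \<Longrightarrow> V u' = V u" for \<epsilon>
  proof -
    have "max (u - \<epsilon>/2) x \<in> S" using that(2)[of "max (u - \<epsilon>/2) x"] that(1) uS uy Vu by (auto simp: S_def)
    from umin[OF this] show False using that(1) uy by auto
  qed
  have "X u"
  proof (rule ccontr)
    assume "\<not> X u"
    then obtain \<epsilon> where \<epsilon>: "\<epsilon> > 0" "\<And>v. \<bar>v - u\<bar> < \<epsilon> \<Longrightarrow> V v = V u"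
      using V_locally_constant by blast
    show False by (rule nc[OF \<epsilon>(1)], rule \<epsilon>(2)) auto
  qed
  moreover have "u \<noteq> y"
  proof
    assume "u = y"
    then obtain \<epsilon> where \<epsilon>: "\<epsilon> > 0" "\<forall>u'\<in>{y-\<epsilon><..y}. V u' = V y" using start by blast
    show False by (rule nc[OF \<epsilon>(1)], unfold \<open>u = y\<close>, rule bspec[OF \<epsilon>(2)]) simp
  qed
  ultimately show ?thesis using uS uy Vu by (intro exI[of _ u]) (auto simp: S_def)
qed

section \<open>Consecutive level points whose argument lies on an arithmetic progression\<close>

definition lattice_points :: "real \<Rightarrow> real \<Rightarrow> real set" where
  "lattice_points v0 \<delta> = {x. X x \<and> (\<exists>n::int. V x = v0 + of_int n * \<delta>)}"

text \<open>Between level points V either stands still on a boundary line or rises. A rise is at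
  least one step of the lattice, and a larger rise would create a lattice point in between.\<close>

lemma consecutive_lattice_points:
  assumes \<delta>: "\<delta> > 0" and x: "x \<in> lattice_points v0 \<delta>" and y: "y \<in> lattice_points v0 \<delta>"
    and xy: "x < y" and gap: "\<And>u. x < u \<Longrightarrow> u < y \<Longrightarrow> u \<notin> lattice_points v0 \<delta>"
  shows "V y = V x \<and> \<theta> x \<in> {0, pi} \<and> \<theta> y = \<theta> x \<and> cos (\<theta> x) * Re (q (\<gamma> x)) < 0 \<and> cos (\<theta> y) * Re (q (\<gamma> y)) > 0
    \<or> V y = V x + \<delta> \<and> (\<theta> x \<in> {0, pi} \<longrightarrow> cos (\<theta> x) * Re (q (\<gamma> x)) \<ge> 0)
        \<and> (\<theta> y \<in> {0, pi} \<longrightarrow> cos (\<theta> y) * Re (q (\<gamma> y)) \<le> 0)"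
proof -
  obtain m n :: int where mn: "V x = v0 + of_int m * \<delta>" "V y = v0 + of_int n * \<delta>" and X: "X x" "X y"
    using x y by (auto simp: lattice_points_def)
  consider (eq) b where "V x = V y" "b \<in> {0,pi}" "\<forall>u\<in>{x..y}. \<theta> u = b" | (less) "V x < V y"
    using V_mono[OF X xy] by blast
  then show ?thesis
  proof cases
    case eq
    have T: "Complex u b \<in> T" if "u \<in> {x..y}" for u using \<theta>_T[of u] eq(3) that by auto
    let ?f = "\<lambda>u. cos b * Re (L (Complex u b))"
    have ends: "?f x = ?f y" using X eq(3) xy by (simp add: X_def \<gamma>_def)
    have d: "(?f has_real_derivative cos b * Re (q (Complex u b))) (at u within {x..y})" if "u \<in> {x..y}" for u
      by (rule line_deriv_Re) (use T that in auto)
    have d': "(?f has_real_derivative cos b * Re (q (Complex u b))) (at u)" if "x < u" "u < y" for u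
      using d[of u] that at_within_Icc_at[of x u y] by simp
    have "continuous_on {x..y} ?f"
      by (rule DERIV_continuous_on) (rule d)
    \<comment> \<open>Re L equals c at both ends, so its slope vanishes somewhere between them, and
      strict monotonicity of cos b * Re q gives the two ends opposite signs.\<close>
    from Rolle_deriv[OF xy ends this, of "\<lambda>u h. (cos b * Re (q (Complex u b))) * h"]
    obtain z where z: "x < z" "z < y" "(\<lambda>h. (cos b * Re (q (Complex z b))) * h) = (\<lambda>h. 0)"
      using d' by (auto simp: has_field_derivative_def)
    from fun_cong[OF z(3), of 1] have z0: "cos b * Re (q (Complex z b)) = 0" by simp
    have "cos b * Re (q (Complex x b)) < 0" "0 < cos b * Re (q (Complex y b))"
      using q_mono[OF eq(2), of x z] q_mono[OF eq(2), of z y] z z0 T by auto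
    then show ?thesis using eq xy by (auto simp: \<gamma>_def)
  next
    case less
    have between: False if "X u" "V u = v0 + of_int j * \<delta>" "x < u" "u < y" for u j
      using gap[OF that(3,4)] that by (auto simp: lattice_points_def)
    have "V y \<ge> V x + \<delta>"
    proof -
      have "m < n" using less mn \<delta> by simp
      then have "of_int (m + 1) * \<delta> \<le> of_int n * \<delta>" using \<delta> by (intro mult_right_mono) auto
      then show ?thesis using mn by (simp add: algebra_simps)
    qed
    moreover have "\<not> V y > V x + \<delta>"
    proof
      assume "V y > V x + \<delta>"
      then obtain u where "x < u" "u < y" "X u" "V u = V x + \<delta>"
        using crossing_right[OF xy, of "V x + \<delta>"] \<delta> by auto
      then show False using between[of u "m + 1"] mn by (simp add: algebra_simps)
    qed
    ultimately have "V y = V x + \<delta>" by simp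
    \<comment> \<open>With a negative slope V would stand still to the right of x, and the last
      point with value V x would be a lattice point strictly between x and y.\<close>
    moreover have "cos (\<theta> x) * Re (q (\<gamma> x)) \<ge> 0" if "\<theta> x \<in> {0, pi}"
    proof (rule ccontr)
      assume "\<not> ?thesis"
      then have "\<exists>\<epsilon>>0. \<forall>u\<in>{x..<x+\<epsilon>}. V u = V x" using start_constant(1)[OF X(1) refl that] by simp
      then show False using crossing_right[OF xy, of "V x"] less between mn by (metis order_refl)
    qed
    moreover have "cos (\<theta> y) * Re (q (\<gamma> y)) \<le> 0" if "\<theta> y \<in> {0, pi}"
    proof (rule ccontr)
      assume "\<not> ?thesis"
      then have "\<exists>\<epsilon>>0. \<forall>u\<in>{y-\<epsilon><..y}. V u = V y" using start_constant(2)[OF X(2) refl that] by simp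
      then show False using crossing_left[OF xy less] between mn by metis
    qed
    ultimately show ?thesis by simp
  qed
qed

end

text \<open>Only the sign of \<phi> is required to be monotone in y, a property that survives
  multiplication by a positive function. Continuity holds because, for heights in the range, "y lies
  below \<theta> x" means \<phi> x y > 0 and "y lies above \<theta> x" means \<phi> x y < 0, both
  open conditions on x.\<close>

lemma continuous_clamped_root:
  fixes \<phi> :: "real \<Rightarrow> real \<Rightarrow> real" and B :: real
  assumes B: "0 < B"
    and cont1: "\<And>y. 0 \<le> y \<Longrightarrow> y \<le> B \<Longrightarrow> continuous_on UNIV (\<lambda>x. \<phi> x y)"
    and cont2: "\<And>x. continuous_on {0..B} (\<phi> x)"
    and dec: "\<And>x y y'. 0 \<le> y \<Longrightarrow> y < y' \<Longrightarrow> y' \<le> B \<Longrightarrow> \<phi> x y \<le> 0 \<Longrightarrow> \<phi> x y' < 0"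
  obtains \<theta> where "continuous_on UNIV \<theta>" "\<And>x. 0 \<le> \<theta> x" "\<And>x. \<theta> x \<le> B"
    "\<And>x. \<phi> x (\<theta> x) = 0 \<or> \<theta> x = 0 \<and> \<phi> x (\<theta> x) < 0 \<or> \<theta> x = B \<and> \<phi> x (\<theta> x) > 0"
proof -
  have "\<exists>y. 0 \<le> y \<and> y \<le> B \<and> (\<phi> x y = 0 \<or> y = 0 \<and> \<phi> x y < 0 \<or> y = B \<and> \<phi> x y > 0)" for x
  proof -
    consider "\<phi> x 0 < 0" | "\<phi> x B > 0" | "\<phi> x B \<le> 0" "0 \<le> \<phi> x 0" by linarith
    then show ?thesis
    proof cases
      case 1 then show ?thesis using B by (intro exI[of _ 0]) simp
    next
      case 2 then show ?thesis using B by (intro exI[of _ B]) simp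
    next
      case 3 then show ?thesis using IVT2'[of "\<phi> x" B 0 0] cont2 B by auto
    qed
  qed
  then obtain \<theta> where \<theta>: "\<And>x. 0 \<le> \<theta> x" "\<And>x. \<theta> x \<le> B"
    "\<And>x. \<phi> x (\<theta> x) = 0 \<or> \<theta> x = 0 \<and> \<phi> x (\<theta> x) < 0 \<or> \<theta> x = B \<and> \<phi> x (\<theta> x) > 0"
    by metis
  have "isCont \<theta> x0" for x0
    unfolding isCont_def
  proof (rule order_tendstoI)
    fix y assume y: "y < \<theta> x0"
    show "\<forall>\<^sub>F x in at x0. y < \<theta> x"
    proof (cases "y < 0")
      case True
      then show ?thesis using \<theta>(1) by (intro always_eventually allI) (meson less_le_trans)
    next
      case False
      have yB: "y \<le> B" using y \<theta>(2)[of x0] by simp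
      have "open {x. 0 < \<phi> x y}"
        by (intro open_Collect_less continuous_on_const cont1) (use False yB in auto)
      moreover have "0 < \<phi> x0 y"
        using dec[of y "\<theta> x0" x0] \<theta>(2)[of x0] \<theta>(3)[of x0] y False by (cases "\<phi> x0 y \<le> 0") auto
      ultimately have "\<forall>\<^sub>F x in at x0. 0 < \<phi> x y"
        using eventually_at_topological by blast
      then show ?thesis
      proof eventually_elim
        case (elim x)
        show ?case
        proof (rule ccontr)
          assume n: "\<not> y < \<theta> x"
          then have "\<phi> x (\<theta> x) > 0"
            using dec[of "\<theta> x" y x] \<theta>(1)[of x] yB elim by (cases "\<theta> x = y") force+
          then have "\<theta> x = B" using \<theta>(3)[of x] by auto
          then show False using n y \<theta>(2)[of x0] by simp
        qed
      qed
    qed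
  next
    fix y assume y: "\<theta> x0 < y"
    show "\<forall>\<^sub>F x in at x0. \<theta> x < y"
    proof (cases "B < y")
      case True
      then show ?thesis using \<theta>(2) by (intro always_eventually allI) (meson le_less_trans)
    next
      case False
      have y0: "0 < y" using y \<theta>(1)[of x0] by simp
      have "open {x. \<phi> x y < 0}"
        by (intro open_Collect_less continuous_on_const cont1) (use False y0 in auto)
      moreover have "\<phi> x0 y < 0"
        using dec[of "\<theta> x0" y x0] \<theta>(1)[of x0] \<theta>(3)[of x0] y False by auto
      ultimately have "\<forall>\<^sub>F x in at x0. \<phi> x y < 0"
        using eventually_at_topological by blast
      then show ?thesis
      proof eventually_elim
        case (elim x)
        show ?case
        proof (rule ccontr)
          assume n: "\<not> \<theta> x < y"
          then have "\<phi> x (\<theta> x) < 0"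
            using dec[of y "\<theta> x" x] \<theta>(2)[of x] y0 elim by (cases "\<theta> x = y") force+
          then have "\<theta> x = 0" using \<theta>(3)[of x] by auto
          then show False using n y0 by simp
        qed
      qed
    qed
  qed
  then have "continuous_on UNIV \<theta>" by (simp add: continuous_on_eq_continuous_at)
  then show ?thesis using that \<theta> by blast
qed

text \<open>Near \<tau> the branch equals L \<tau> + Ln (F t / F \<tau>), since continuity keeps |Im
  (L t - L \<tau>)| below pi. The derivative is taken within \<open>T\<close> because \<tau> may lie
  on its boundary.\<close>

lemma has_field_derivative_log_branch:
  fixes L F :: "complex \<Rightarrow> complex"
  assumes cont: "continuous_on T L" and \<tau>: "\<tau> \<in> T" and F: "\<And>t. t \<in> T \<Longrightarrow> F t = exp (L t)"
    and d: "(F has_field_derivative F \<tau> * d) (at \<tau> within T)"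
  shows "(L has_field_derivative d) (at \<tau> within T)"
proof -
  have "F \<tau> \<noteq> 0" using F \<tau> by simp
  have "((\<lambda>t. F t / F \<tau>) has_field_derivative d) (at \<tau> within T)"
    using DERIV_cdivide[OF d, of "F \<tau>"] \<open>F \<tau> \<noteq> 0\<close> by simp
  moreover have "(Ln has_field_derivative 1) (at (F \<tau> / F \<tau>))"
    using has_field_derivative_Ln[of 1] \<open>F \<tau> \<noteq> 0\<close> by simp
  ultimately have "((\<lambda>t. Ln (F t / F \<tau>)) has_field_derivative 1 * d) (at \<tau> within T)"
    by (rule DERIV_chain2[rotated])
  from DERIV_add[OF DERIV_const[of "L \<tau>"] this]
  have D: "((\<lambda>t. L \<tau> + Ln (F t / F \<tau>)) has_field_derivative d) (at \<tau> within T)"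
    by simp
  obtain \<delta> where \<delta>: "\<delta> > 0" "\<And>t. t \<in> T \<Longrightarrow> dist t \<tau> < \<delta> \<Longrightarrow> dist (L t) (L \<tau>) < pi"
    using cont \<tau> pi_gt_zero unfolding continuous_on_iff by meson
  show ?thesis
  proof (rule has_field_derivative_transform_within[OF D \<delta>(1) \<tau>])
    fix t assume t: "t \<in> T" "dist t \<tau> < \<delta>"
    have "\<bar>Im (L t - L \<tau>)\<bar> < pi"
      using \<delta>(2)[OF t] abs_Im_le_cmod[of "L t - L \<tau>"] unfolding dist_norm by linarith
    then have "Ln (exp (L t - L \<tau>)) = L t - L \<tau>" by (intro Ln_exp) auto
    then show "L \<tau> + Ln (F t / F \<tau>) = L t"
      using F t \<tau> by (simp add: exp_diff)
  qed
qed


section \<open>The logarithm of the product in the strip\<close>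

lemma log_derivative_mult:
  fixes f g :: "'a::real_normed_field \<Rightarrow> 'a"
  assumes "(f has_field_derivative f w * x) (at w)" "(g has_field_derivative g w * y) (at w)"
  shows "((\<lambda>w. f w * g w) has_field_derivative f w * g w * (x + y)) (at w)"
  using DERIV_mult[OF assms] by (simp add: algebra_simps)

lemma log_derivative_divide:
  fixes f g :: "'a::real_normed_field \<Rightarrow> 'a"
  assumes "(f has_field_derivative f w * x) (at w)" "(g has_field_derivative g w * y) (at w)" "g w \<noteq> 0"
  shows "((\<lambda>w. f w / g w) has_field_derivative f w / g w * (x - y)) (at w)"
proof -
  have "(f w * x * g w - f w * (g w * y)) / (g w * g w) = f w / g w * (x - y)"
    using assms(3) by (simp add: field_simps)
  then show ?thesis using DERIV_divide[OF assms] by simp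
qed

lemma (in weights) genus0_compose_log_derivative:
  assumes "(f has_field_derivative f') (at w)" "genus0 u (f w) \<noteq> 0" "f w \<noteq> 0"
  shows "((\<lambda>w. genus0 u (f w)) has_field_derivative genus0 u (f w) * (genus0_ld u (f w) * f' / f w)) (at w)"
  using DERIV_chain2[OF genus0_has_derivative assms(1)] assms(2,3) by (simp add: genus0_ld_def)

text \<open>The part of G that depends on w = z^k only. \<open>nontrivial\<close> is what remains of
  the assumption that G is not z^p; it makes Im h and, on the real axis, h' strictly
  positive.\<close>

locale pick_factor =
  a: weights ua + b: weights ub + c: weights uc + d: weights ud
  for ua ub uc ud :: "nat \<Rightarrow> real" +
  fixes A A0 :: real
  assumes A_nonneg: "A \<ge> 0" and A0_nonneg: "A0 \<ge> 0"
    and nontrivial: "A > 0 \<or> A0 > 0 \<or> (\<exists>j. ua j > 0 \<or> ub j > 0 \<or> uc j > 0 \<or> ud j > 0)"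
begin

text \<open>The quotient is arranged so that \<open>num\<close> vanishes only on the negative
  half-axis and \<open>den\<close> only on the positive one.\<close>

definition num where
  "num w = exp (of_real A * w + of_real A0 / w) * (genus0 ua w * genus0 uc (1 / w))"
definition den where
  "den w = genus0 ub (- w) * genus0 ud (- (1 / w))"
definition g where "g w = num w / den w"
text \<open>This is w g' / g; each sign combines that of the inner derivative with that of the
  division by \<open>den\<close>.\<close>

definition h where
  "h w = of_real A * w - of_real A0 / w + genus0_ld ua w - genus0_ld ub (- w)
     - genus0_ld uc (1 / w) + genus0_ld ud (- (1 / w))"
definition h' where
  "h' w = of_real A + of_real A0 / w\<^sup>2 + deriv (genus0_ld ua) w + deriv (genus0_ld ub) (- w)
     + deriv (genus0_ld uc) (1 / w) / w\<^sup>2 + deriv (genus0_ld ud) (- (1 / w)) / w\<^sup>2"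

lemma num_nonzero: "Im w \<noteq> 0 \<or> Re w > 0 \<Longrightarrow> num w \<noteq> 0"
  by (auto simp: num_def Im_divide Re_divide intro!: a.genus0_nonzero c.genus0_nonzero)

lemma den_nonzero: "Im w \<noteq> 0 \<or> Re w < 0 \<Longrightarrow> den w \<noteq> 0"
  by (auto simp: den_def Im_divide Re_divide divide_nonpos_nonneg intro!: b.genus0_nonzero d.genus0_nonzero)

lemma g_deriv:
  assumes "w \<noteq> 0" "num w \<noteq> 0" "den w \<noteq> 0"
  shows "(g has_field_derivative g w * (h w / w)) (at w)"
proof -
  have nz: "genus0 ua w \<noteq> 0" "genus0 uc (1 / w) \<noteq> 0" "genus0 ub (- w) \<noteq> 0" "genus0 ud (- (1 / w)) \<noteq> 0"
    using assms by (auto simp: num_def den_def)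
  have e: "((\<lambda>w. exp (of_real A * w + of_real A0 / w)) has_field_derivative
      exp (of_real A * w + of_real A0 / w) * (of_real A - of_real A0 / w\<^sup>2)) (at w)"
    using assms(1) by (auto intro!: derivative_eq_intros simp: power2_eq_square)
  have i: "((\<lambda>w. 1 / w) has_field_derivative - (1 / w\<^sup>2)) (at w)"
    using assms(1) by (auto intro!: derivative_eq_intros simp: power2_eq_square)
  have ni: "((\<lambda>w. - (1 / w)) has_field_derivative 1 / w\<^sup>2) (at w)"
    using DERIV_minus[OF i] by simp
  have n: "((\<lambda>w. - w) has_field_derivative - 1) (at w)"
    by (auto intro!: derivative_eq_intros)
  have "((\<lambda>w. num w / den w) has_field_derivative num w / den w *
     (of_real A - of_real A0 / w\<^sup>2 + (genus0_ld ua w * 1 / w + genus0_ld uc (1 / w) * (- (1 / w\<^sup>2)) / (1 / w))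
      - (genus0_ld ub (- w) * (- 1) / (- w) + genus0_ld ud (- (1 / w)) * (1 / w\<^sup>2) / (- (1 / w))))) (at w)"
    unfolding num_def den_def
    by (intro log_derivative_divide log_derivative_mult e
        a.genus0_compose_log_derivative b.genus0_compose_log_derivative
        c.genus0_compose_log_derivative d.genus0_compose_log_derivative i ni n DERIV_ident nz)
       (use nz assms in auto)
  moreover have "(of_real A - of_real A0 / w\<^sup>2 + (genus0_ld ua w * 1 / w + genus0_ld uc (1 / w) * (- (1 / w\<^sup>2)) / (1 / w))
      - (genus0_ld ub (- w) * (- 1) / (- w) + genus0_ld ud (- (1 / w)) * (1 / w\<^sup>2) / (- (1 / w)))) = h w / w"
    using assms(1) by (simp add: h_def field_simps power2_eq_square)
  ultimately show ?thesis unfolding g_def[abs_def] by (simp only:)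
qed

lemma h_deriv:
  assumes "w \<noteq> 0" "num w \<noteq> 0" "den w \<noteq> 0"
  shows "(h has_field_derivative h' w) (at w)"
proof -
  have nz: "genus0 ua w \<noteq> 0" "genus0 uc (1 / w) \<noteq> 0" "genus0 ub (- w) \<noteq> 0" "genus0 ud (- (1 / w)) \<noteq> 0"
    using assms by (auto simp: num_def den_def)
  have i: "((\<lambda>w. 1 / w) has_field_derivative - (1 / w\<^sup>2)) (at w)"
    using assms(1) by (auto intro!: derivative_eq_intros simp: power2_eq_square)
  have ni: "((\<lambda>w. - (1 / w)) has_field_derivative 1 / w\<^sup>2) (at w)"
    using DERIV_minus[OF i] by simp
  have n: "((\<lambda>w. - w) has_field_derivative - 1) (at w)"
    by (auto intro!: derivative_eq_intros)
  have "((\<lambda>w. of_real A * w - of_real A0 / w) has_field_derivative of_real A + of_real A0 / w\<^sup>2) (at w)"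
    using assms(1) by (auto intro!: derivative_eq_intros simp: power2_eq_square)
  from DERIV_add[OF DERIV_diff[OF DERIV_diff[OF DERIV_add[OF this a.genus0_ld_has_derivative[OF nz(1)]]
        DERIV_chain2[OF b.genus0_ld_has_derivative[OF nz(3)] n]]
        DERIV_chain2[OF c.genus0_ld_has_derivative[OF nz(2)] i]]
        DERIV_chain2[OF d.genus0_ld_has_derivative[OF nz(4)] ni]]
  show ?thesis unfolding h_def[abs_def] h'_def by (simp add: algebra_simps)
qed

lemma Im_h_pos:
  assumes "Im w > 0"
  shows "Im (h w) > 0"
proof -
  have w: "w \<noteq> 0" using assms by auto
  \<comment> \<open>The arguments - w and 1 / w lie in the lower half-plane. Conjugation turns the
    negative terms of \<open>h\<close> into positive ones at points of the upper half-plane.\<close>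
  have neg: "Im (genus0_ld u (cnj v)) = - Im (genus0_ld u v)" if "weights u" "Im v > 0" for u v
    using weights.genus0_ld_cnj[OF that(1), of v] weights.genus0_nonzero[OF that(1), of v] that(2) by auto
  have iw: "Im (- (1 / w)) > 0" "Im (cnj (1 / w)) > 0" "Im (cnj (- w)) > 0"
    using assms w by (auto simp: Im_divide divide_neg_pos sum_power2_gt_zero_iff complex_eq_iff)
  have t: "Im (of_real A * w - of_real A0 / w) = A * Im w + A0 * Im w / (cmod w)\<^sup>2"
    by (simp add: Im_divide cmod_power2)
  have t1: "Im (of_real A * w - of_real A0 / w) \<ge> 0"
    unfolding t using A_nonneg A0_nonneg assms by simp
  have t2: "Im (of_real A * w - of_real A0 / w) > 0" if "A > 0 \<or> A0 > 0"
  proof -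
    have "A * Im w \<ge> 0" "A0 * Im w / (cmod w)\<^sup>2 \<ge> 0" using A_nonneg A0_nonneg assms by auto
    moreover have "A * Im w > 0 \<or> A0 * Im w / (cmod w)\<^sup>2 > 0" using that assms w by auto
    ultimately show ?thesis unfolding t by linarith
  qed
  have e: "Im (h w) = Im (of_real A * w - of_real A0 / w) + Im (genus0_ld ua w)
      + Im (genus0_ld ub (cnj (- w))) + Im (genus0_ld uc (cnj (1 / w))) + Im (genus0_ld ud (- (1 / w)))"
    using neg[OF b.weights_axioms iw(3)] neg[OF c.weights_axioms iw(2)] by (simp add: h_def)
  have nn: "0 \<le> Im (genus0_ld ua w)" "0 \<le> Im (genus0_ld ub (cnj (- w)))"
     "0 \<le> Im (genus0_ld uc (cnj (1 / w)))" "0 \<le> Im (genus0_ld ud (- (1 / w)))"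
    using a.Im_genus0_ld(1)[OF assms] b.Im_genus0_ld(1)[OF iw(3)] c.Im_genus0_ld(1)[OF iw(2)]
      d.Im_genus0_ld(1)[OF iw(1)] by auto
  from nontrivial consider "A > 0 \<or> A0 > 0" | j where "ua j > 0" | j where "ub j > 0"
    | j where "uc j > 0" | j where "ud j > 0" by blast
  then show ?thesis
  proof cases
    case 1 then show ?thesis using e nn t2 by linarith
  next
    case 2 then show ?thesis using e nn t1 a.Im_genus0_ld(2)[OF assms] by smt
  next
    case 3 then show ?thesis using e nn t1 b.Im_genus0_ld(2)[OF iw(3)] by smt
  next
    case 4 then show ?thesis using e nn t1 c.Im_genus0_ld(2)[OF iw(2)] by smt
  next
    case 5 then show ?thesis using e nn t1 d.Im_genus0_ld(2)[OF iw(1)] by smt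
  qed
qed

lemma h_cnj:
  assumes "w \<noteq> 0" "num w \<noteq> 0" "den w \<noteq> 0"
  shows "h (cnj w) = cnj (h w)"
proof -
  have nz: "genus0 ua w \<noteq> 0" "genus0 uc (1 / w) \<noteq> 0" "genus0 ub (- w) \<noteq> 0" "genus0 ud (- (1 / w)) \<noteq> 0"
    using assms by (auto simp: num_def den_def)
  show ?thesis
    using a.genus0_ld_cnj[OF nz(1)] b.genus0_ld_cnj[OF nz(3)] c.genus0_ld_cnj[OF nz(2)] d.genus0_ld_cnj[OF nz(4)]
    by (simp add: h_def)
qed

text \<open>The lower half-plane matters as well, since z^k lies there for z in an odd sector;
  conjugation symmetry covers it.\<close>

lemma Im_h_nonzero:
  assumes "Im w \<noteq> 0"
  shows "Im (h w) \<noteq> 0"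
proof (cases "Im w > 0")
  case True then show ?thesis using Im_h_pos[of w] by simp
next
  case False
  then have i: "Im (cnj w) > 0" using assms by simp
  have "h (cnj (cnj w)) = cnj (h (cnj w))"
    by (rule h_cnj) (use i num_nonzero[of "cnj w"] den_nonzero[of "cnj w"] in auto)
  then show ?thesis using Im_h_pos[OF i] by simp
qed

lemma h_real:
  assumes "w \<in> \<real>" "w \<noteq> 0" "num w \<noteq> 0" "den w \<noteq> 0"
  shows "h w \<in> \<real>"
  using h_cnj[OF assms(2-4)] assms(1) by (simp add: Reals_cnj_iff)

text \<open>Every term is nonnegative on the real axis and \<open>nontrivial\<close> supplies a
  positive one. This gives strict convexity or concavity on the boundary lines, and the bound 2 on
  multiplicities.\<close>

lemma h'_pos:
  assumes "r \<noteq> 0" "num (of_real r) \<noteq> 0" "den (of_real r) \<noteq> 0"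
  shows "h' (of_real r) \<in> \<real>" "Re (h' (of_real r)) > 0"
proof -
  have nz: "genus0 ua (of_real r) \<noteq> 0" "genus0 uc (of_real (1 / r)) \<noteq> 0"
      "genus0 ub (of_real (- r)) \<noteq> 0" "genus0 ud (of_real (- (1 / r))) \<noteq> 0"
    using assms by (auto simp: num_def den_def)
  let ?a = "deriv (genus0_ld ua) (of_real r)" and ?b = "deriv (genus0_ld ub) (of_real (- r))"
  let ?c = "deriv (genus0_ld uc) (of_real (1 / r))" and ?d = "deriv (genus0_ld ud) (of_real (- (1 / r)))"
  have e: "h' (of_real r) = of_real A + of_real (A0 / r\<^sup>2) + ?a + ?b + ?c * of_real (1 / r\<^sup>2) + ?d * of_real (1 / r\<^sup>2)"
    by (simp add: h'_def)
  show "h' (of_real r) \<in> \<real>" unfolding e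
    using a.deriv_genus0_ld_real(1)[OF nz(1)] b.deriv_genus0_ld_real(1)[OF nz(3)]
      c.deriv_genus0_ld_real(1)[OF nz(2)] d.deriv_genus0_ld_real(1)[OF nz(4)]
    by (intro Reals_add Reals_mult Reals_of_real)
  have r: "1 / r\<^sup>2 > 0" using assms(1) by simp
  have rr: "Re (h' (of_real r)) = A + A0 * (1 / r\<^sup>2) + Re ?a + Re ?b + Re ?c * (1 / r\<^sup>2) + Re ?d * (1 / r\<^sup>2)"
    unfolding e by simp
  have nn: "0 \<le> Re ?a" "0 \<le> Re ?b" "0 \<le> Re ?c * (1 / r\<^sup>2)" "0 \<le> Re ?d * (1 / r\<^sup>2)" "0 \<le> A0 * (1 / r\<^sup>2)"
    using a.deriv_genus0_ld_nonneg(1)[OF nz(1)] b.deriv_genus0_ld_nonneg(1)[OF nz(3)]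
      c.deriv_genus0_ld_nonneg(1)[OF nz(2)] d.deriv_genus0_ld_nonneg(1)[OF nz(4)] A0_nonneg r
    by (auto simp del: of_real_minus of_real_divide)
  from nontrivial consider "A > 0" | "A0 > 0" | j where "ua j > 0" | j where "ub j > 0"
    | j where "uc j > 0" | j where "ud j > 0" by blast
  then show "Re (h' (of_real r)) > 0"
  proof cases
    case 1 then show ?thesis using rr nn A_nonneg by linarith
  next
    case 2 then have "A0 * (1 / r\<^sup>2) > 0" using r by simp
    then show ?thesis using rr nn A_nonneg by linarith
  next
    case 3 then have "Re ?a > 0" using a.deriv_genus0_ld_nonneg(2)[OF nz(1)] by blast
    then show ?thesis using rr nn A_nonneg by linarith
  next
    case 4 then have "Re ?b > 0" using b.deriv_genus0_ld_nonneg(2)[OF nz(3)] by blast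
    then show ?thesis using rr nn A_nonneg by linarith
  next
    case 5 then have "Re ?c * (1 / r\<^sup>2) > 0" using c.deriv_genus0_ld_nonneg(2)[OF nz(2)] r
      by (simp del: of_real_minus of_real_divide)
    then show ?thesis using rr nn A_nonneg by linarith
  next
    case 6 then have "Re ?d * (1 / r\<^sup>2) > 0" using d.deriv_genus0_ld_nonneg(2)[OF nz(4)] r
      by (simp del: of_real_minus of_real_divide)
    then show ?thesis using rr nn A_nonneg by linarith
  qed
qed

end

section \<open>The product in the coordinate \<tau> = k log z\<close>

locale strip_product = pick_factor +
  fixes k :: nat and p :: int
  assumes k_pos: "k > 0"
begin

definition F where "F \<tau> = exp (of_int p * \<tau> / of_nat k) * g (exp \<tau>)"
definition q where "q \<tau> = of_int p / of_nat k + h (exp \<tau>)"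
definition T where "T = {\<tau>. 0 \<le> Im \<tau> \<and> Im \<tau> \<le> pi \<and> num (exp \<tau>) \<noteq> 0 \<and> den (exp \<tau>) \<noteq> 0}"

lemma continuous_num: "continuous_on (- {0}) num"
  unfolding num_def
  by (intro continuous_intros continuous_on_compose2[OF a.continuous_genus0[of UNIV]]
      continuous_on_compose2[OF c.continuous_genus0[of UNIV]]) auto

lemma continuous_den: "continuous_on (- {0}) den"
  unfolding den_def
  by (intro continuous_intros continuous_on_compose2[OF b.continuous_genus0[of UNIV]]
      continuous_on_compose2[OF d.continuous_genus0[of UNIV]]) auto

lemma continuous_num_exp: "continuous_on S f \<Longrightarrow> continuous_on S (\<lambda>x. num (exp (f x)))"
  by (rule continuous_on_compose2[OF continuous_num]) (auto intro: continuous_on_exp)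

lemma continuous_den_exp: "continuous_on S f \<Longrightarrow> continuous_on S (\<lambda>x. den (exp (f x)))"
  by (rule continuous_on_compose2[OF continuous_den]) (auto intro: continuous_on_exp)

lemma Im_exp_pos: "0 < Im \<tau> \<Longrightarrow> Im \<tau> < pi \<Longrightarrow> Im (exp \<tau>) > 0"
  by (simp add: Im_exp sin_gt_zero)

lemma T_interior: "0 < Im \<tau> \<Longrightarrow> Im \<tau> < pi \<Longrightarrow> \<tau> \<in> T"
  using Im_exp_pos[of \<tau>] num_nonzero[of "exp \<tau>"] den_nonzero[of "exp \<tau>"] by (simp add: T_def)

lemma F_nonzero: "\<tau> \<in> T \<Longrightarrow> F \<tau> \<noteq> 0"
  by (simp add: T_def F_def g_def)

lemma F_deriv:
  assumes "\<tau> \<in> T"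
  shows "(F has_field_derivative F \<tau> * q \<tau>) (at \<tau>)"
proof -
  have "(g has_field_derivative g (exp \<tau>) * (h (exp \<tau>) / exp \<tau>)) (at (exp \<tau>))"
    by (rule g_deriv) (use assms in \<open>auto simp: T_def\<close>)
  from DERIV_chain2[OF this DERIV_exp]
  have "((\<lambda>\<tau>. g (exp \<tau>)) has_field_derivative g (exp \<tau>) * h (exp \<tau>)) (at \<tau>)" by simp
  moreover have "((\<lambda>\<tau>. exp (of_int p * \<tau> / of_nat k)) has_field_derivative
      exp (of_int p * \<tau> / of_nat k) * (of_int p / of_nat k)) (at \<tau>)"
    using k_pos by (auto intro!: derivative_eq_intros)
  ultimately show ?thesis
    unfolding F_def[abs_def] q_def by (intro log_derivative_mult)
qed

lemma q_deriv:
  assumes "\<tau> \<in> T"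
  shows "(q has_field_derivative h' (exp \<tau>) * exp \<tau>) (at \<tau>)"
proof -
  have "(h has_field_derivative h' (exp \<tau>)) (at (exp \<tau>))"
    by (rule h_deriv) (use assms in \<open>auto simp: T_def\<close>)
  from DERIV_add[OF DERIV_const DERIV_chain2[OF this DERIV_exp]]
  show ?thesis unfolding q_def[abs_def] by simp
qed

text \<open>The missing points may split a boundary line, so \<open>T\<close> need not be convex;
  but a segment from i pi / 2 can meet the boundary only at its other end. Contractibility yields a
  logarithm of \<open>F\<close> on all of \<open>T\<close>.\<close>

lemma contractible_T: "contractible T"
proof (rule starlike_imp_contractible)
  let ?a = "\<i> * of_real (pi / 2)"
  have "closed_segment ?a x \<subseteq> T" if x: "x \<in> T" for x
  proof
    fix y assume "y \<in> closed_segment ?a x"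
    then obtain u where u: "0 \<le> u" "u \<le> 1" "y = (1 - u) *\<^sub>R ?a + u *\<^sub>R x"
      by (auto simp: closed_segment_def)
    show "y \<in> T"
    proof (cases "u = 1")
      case True then show ?thesis using u x by simp
    next
      case False
      have e: "Im y = (1 - u) * (pi / 2) + u * Im x" using u by simp
      have xs: "0 \<le> Im x" "Im x \<le> pi" using x by (auto simp: T_def)
      have "(1 - u) * (pi / 2) > 0" using False u by simp
      moreover have "0 \<le> u * Im x" "u * Im x \<le> u * pi" using u xs by (auto intro: mult_left_mono)
      moreover have "(1 - u) * (pi / 2) + u * pi = pi - (1 - u) * (pi / 2)" by (simp add: field_simps)
      ultimately show ?thesis using T_interior[of y] unfolding e by linarith
    qed
  qed
  moreover have "?a \<in> T" by (rule T_interior) auto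
  ultimately show "starlike T" unfolding starlike_def by blast
qed

lemma exp_line: "b \<in> {0, pi} \<Longrightarrow> exp (Complex x b) = of_real (exp x * cos b)"
  by (auto simp: complex_eq_iff Re_exp Im_exp)

lemma q_line:
  assumes "Complex x b \<in> T" "b \<in> {0, pi}"
  shows "Im (q (Complex x b)) = 0"
proof -
  have "h (exp (Complex x b)) \<in> \<real>"
    by (rule h_real) (use assms exp_line[OF assms(2), of x] in \<open>auto simp: T_def\<close>)
  then show ?thesis by (simp add: q_def complex_is_Real_iff)
qed

text \<open>On a boundary line exp \<tau> is real with the sign of cos b, and it multiplies the
  positive number h' (exp \<tau>).\<close>

lemma q'_line:
  assumes "Complex x b \<in> T" "b \<in> {0, pi}"
  shows "cos b * Re (h' (exp (Complex x b)) * exp (Complex x b)) > 0"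
proof -
  let ?r = "exp x * cos b"
  have r: "?r \<noteq> 0" using assms(2) by auto
  have e: "exp (Complex x b) = of_real ?r" by (rule exp_line[OF assms(2)])
  have "Re (h' (of_real ?r)) > 0"
    using h'_pos(2)[OF r] assms(1) unfolding T_def mem_Collect_eq e by blast
  moreover have "cos b * Re (h' (exp (Complex x b)) * exp (Complex x b)) = Re (h' (of_real ?r)) * exp x * (cos b)\<^sup>2"
    unfolding e by (simp add: power2_eq_square)
  moreover have "(cos b)\<^sup>2 = 1" using assms(2) by auto
  ultimately show ?thesis by simp
qed

lemma q_mono:
  assumes b: "b \<in> {0, pi}" and "x < y" and T: "\<And>u. u \<in> {x..y} \<Longrightarrow> Complex u b \<in> T"
  shows "cos b * Re (q (Complex x b)) < cos b * Re (q (Complex y b))"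
proof (rule DERIV_pos_imp_increasing[OF assms(2), of "\<lambda>u. cos b * Re (q (Complex u b))"])
  fix u assume "x \<le> u" "u \<le> y"
  then have uT: "Complex u b \<in> T" using T by simp
  have "((\<lambda>u. Complex u b) has_vector_derivative 1) (at u)"
    unfolding Complex_eq by (auto intro!: derivative_eq_intros)
  from field_vector_diff_chain_at[OF this q_deriv[OF uT]]
  have "((\<lambda>u. q (Complex u b)) has_vector_derivative h' (exp (Complex u b)) * exp (Complex u b)) (at u)"
    by (simp add: o_def)
  from bounded_linear.has_vector_derivative[OF bounded_linear_Re this]
  have "((\<lambda>u. Re (q (Complex u b))) has_real_derivative Re (h' (exp (Complex u b)) * exp (Complex u b))) (at u)"
    by (simp add: has_real_derivative_iff_has_vector_derivative)
  from DERIV_cmult[OF this, of "cos b"] q'_line[OF uT b]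
  show "\<exists>d. ((\<lambda>u. cos b * Re (q (Complex u b))) has_real_derivative d) (at u) \<and> d > 0" by blast
qed

lemma T_line:
  assumes "Complex x b \<in> T"
  shows "\<exists>\<epsilon>>0. \<forall>y. \<bar>y - x\<bar> < \<epsilon> \<longrightarrow> Complex y b \<in> T"
proof -
  have "continuous_on UNIV (\<lambda>y. Complex y b)" unfolding Complex_eq by (intro continuous_intros)
  then have "open {y. num (exp (Complex y b)) \<noteq> 0 \<and> den (exp (Complex y b)) \<noteq> 0}"
    by (intro open_Collect_conj open_Collect_neq continuous_on_const continuous_num_exp continuous_den_exp)
  from openE[OF this, of x] assms obtain \<epsilon> where \<epsilon>: "\<epsilon> > 0"
    "ball x \<epsilon> \<subseteq> {y. num (exp (Complex y b)) \<noteq> 0 \<and> den (exp (Complex y b)) \<noteq> 0}"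
    by (auto simp: T_def)
  then have "Complex y b \<in> T" if "\<bar>y - x\<bar> < \<epsilon>" for y
    using assms that by (auto simp: T_def dist_real_def subset_iff abs_minus_commute)
  then show ?thesis using \<epsilon>(1) by blast
qed

lemma log_strip_exists:
  obtains L where "log_strip T L q" "\<And>\<tau>. \<tau> \<in> T \<Longrightarrow> F \<tau> = exp (L \<tau>)"
proof -
  have "continuous_on T F"
    by (rule DERIV_continuous_on, rule has_field_derivative_at_within, rule F_deriv)
  then obtain L where L: "continuous_on T L" "\<And>\<tau>. \<tau> \<in> T \<Longrightarrow> F \<tau> = exp (L \<tau>)"
    by (rule continuous_logarithm_on_contractible[OF _ contractible_T F_nonzero]) blast+
  have "log_strip T L q"
  proof
    fix \<tau> assume \<tau>: "\<tau> \<in> T"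
    show "(L has_field_derivative q \<tau>) (at \<tau> within T)"
      by (rule has_field_derivative_log_branch[OF L(1) \<tau> L(2) has_field_derivative_at_within[OF F_deriv[OF \<tau>]]])
    show "0 \<le> Im \<tau> \<and> Im \<tau> \<le> pi" using \<tau> by (simp add: T_def)
  next
    fix \<tau> assume "0 < Im \<tau>" "Im \<tau> < pi"
    then show "\<tau> \<in> T" "0 < Im (q \<tau>)"
      using T_interior[of \<tau>] Im_h_pos[OF Im_exp_pos[of \<tau>]] by (auto simp: q_def)
  qed (rule T_line q_line q_mono; assumption)+
  then show ?thesis using that L(2) by blast
qed

text \<open>Clearing the denominator in |F| = exp c gives the function N - D, which is continuous on
  the whole closed strip, zeros and poles included, and on \<open>T\<close> has the sign of Re L -
  c.\<close>

lemma level_curve_exists: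
  assumes "log_strip T L q" and L: "\<And>\<tau>. \<tau> \<in> T \<Longrightarrow> F \<tau> = exp (L \<tau>)"
  obtains \<theta> where "level_curve T L q c \<theta>"
proof -
  interpret log_strip T L q by fact
  define N where "N \<tau> = cmod (exp (of_int p * \<tau> / of_nat k) * num (exp \<tau>))" for \<tau>
  define D where "D \<tau> = exp c * cmod (den (exp \<tau>))" for \<tau>
  define \<phi> where "\<phi> x y = N (Complex x y) - D (Complex x y)" for x y
  have cont: "continuous_on S (\<lambda>x. N (f x) - D (f x))" if "continuous_on S f" for f and S :: "real set"
    unfolding N_def D_def using that k_pos
    by (intro continuous_intros continuous_num_exp continuous_den_exp) auto
  have line0: "num (exp (Complex x 0)) \<noteq> 0" for x
    by (rule num_nonzero) (simp add: Re_exp)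
  have linepi: "den (exp (Complex x pi)) \<noteq> 0" for x
    by (rule den_nonzero) (simp add: Re_exp)
  \<comment> \<open>A missing point on the lower line is a pole, with D = 0 < N; one on the upper
    line is a zero, with N = 0 < D. These signs are opposite to those of a clamped value, so the
    curve avoids both.\<close>
  have off_T: "y = 0 \<and> \<phi> x y > 0 \<or> y = pi \<and> \<phi> x y < 0"
    if "Complex x y \<notin> T" "0 \<le> y" "y \<le> pi" for x y
  proof -
    have "y = 0 \<or> y = pi" using T_interior[of "Complex x y"] that by force
    then show ?thesis
      using that line0[of x] linepi[of x] by (auto simp: \<phi>_def N_def D_def T_def)
  qed
  have on_T: "\<phi> x y = cmod (den (exp (Complex x y))) * (exp (Re (L (Complex x y))) - exp c)"
      and den: "cmod (den (exp (Complex x y))) > 0"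
    if t: "Complex x y \<in> T" for x y
  proof -
    show "cmod (den (exp (Complex x y))) > 0" using t by (simp add: T_def)
    have "exp (Re (L (Complex x y))) = cmod (F (Complex x y))" using L[OF t] by simp
    also have "\<dots> = N (Complex x y) / cmod (den (exp (Complex x y)))"
      by (simp add: F_def g_def N_def norm_mult norm_divide)
    finally show "\<phi> x y = cmod (den (exp (Complex x y))) * (exp (Re (L (Complex x y))) - exp c)"
      using t by (simp add: \<phi>_def D_def T_def field_simps)
  qed
  have sgn_T: "\<phi> x y < 0 \<longleftrightarrow> Re (L (Complex x y)) < c" "\<phi> x y = 0 \<longleftrightarrow> Re (L (Complex x y)) = c"
      "\<phi> x y > 0 \<longleftrightarrow> Re (L (Complex x y)) > c"
    if t: "Complex x y \<in> T" for x y
    unfolding on_T[OF t] using den[OF t] by (simp_all add: mult_less_0_iff zero_less_mult_iff)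
  obtain \<theta> where \<theta>: "continuous_on UNIV \<theta>" "\<And>x. 0 \<le> \<theta> x" "\<And>x. \<theta> x \<le> pi"
    "\<And>x. \<phi> x (\<theta> x) = 0 \<or> \<theta> x = 0 \<and> \<phi> x (\<theta> x) < 0 \<or> \<theta> x = pi \<and> \<phi> x (\<theta> x) > 0"
  proof (rule continuous_clamped_root[of pi \<phi>])
    show "continuous_on UNIV (\<lambda>x. \<phi> x y)" for y
      unfolding \<phi>_def by (rule cont) (unfold Complex_eq, intro continuous_intros)
    show "continuous_on {0..pi} (\<phi> x)" for x
      unfolding \<phi>_def by (rule cont) (unfold Complex_eq, intro continuous_intros)
    show "\<phi> x y' < 0" if y: "0 \<le> y" "y < y'" "y' \<le> pi" "\<phi> x y \<le> 0" for x y y'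
    proof (cases "Complex x y \<in> T \<and> Complex x y' \<in> T")
      case True
      then have "Re (L (Complex x y')) < Re (L (Complex x y))" using vertical y by blast
      then show ?thesis using True sgn_T[of x y] sgn_T[of x y'] y(4) by auto
    next
      case False
      then show ?thesis using off_T[of x y] off_T[of x y'] y by auto
    qed
  qed auto
  have \<theta>T: "Complex x (\<theta> x) \<in> T" for x
  proof (rule ccontr)
    assume "Complex x (\<theta> x) \<notin> T"
    from off_T[OF this] \<theta>(2-4)[of x] show False by auto
  qed
  have "level_curve T L q c \<theta>"
  proof unfold_locales
    show "Re (L (Complex x (\<theta> x))) = c \<or> \<theta> x = 0 \<and> Re (L (Complex x (\<theta> x))) < c
      \<or> \<theta> x = pi \<and> Re (L (Complex x (\<theta> x))) > c" for x
      using \<theta>(4)[of x] sgn_T[OF \<theta>T[of x]] by auto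
  qed (fact \<theta>(1) \<theta>T)+
  then show ?thesis using that by blast
qed

end


section \<open>Sectors\<close>

lemma epi_cis: "epi k m = cis (of_int m * pi / of_nat k)"
  by (simp add: epi_def cis_conv_exp mult.commute)

lemma norm_epi [simp]: "norm (epi k m) = 1"
  by (simp add: epi_cis)

lemma epi_nonzero [simp]: "epi k m \<noteq> 0"
  by (simp add: epi_cis)

lemma epi_0 [simp]: "epi k 0 = 1"
  by (simp add: epi_cis)

lemma epi_add: "epi k (m + n) = epi k m * epi k n"
  by (simp add: epi_cis cis_mult add_divide_distrib distrib_right)

lemma cnj_epi [simp]: "cnj (epi k m) = epi k (- m)"
  by (simp add: epi_cis cis_cnj)

lemma epi_inverse: "epi k m * epi k (- m) = 1"
  using epi_add[of k m "- m"] by simp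

lemma epi_powi: "epi k m powi p = epi k (m * p)"
  by (simp add: epi_def exp_power_int mult_ac)

lemma epi_eq_1_iff:
  assumes "k > 0"
  shows "epi k n = 1 \<longleftrightarrow> 2 * int k dvd n"
proof -
  have "epi k n = 1 \<longleftrightarrow> (\<exists>j::int. of_int n / real k * pi = of_int (2 * j) * pi)"
    unfolding epi_def by (subst exp_eq_1) simp
  also have "\<dots> \<longleftrightarrow> (\<exists>j::int. of_int n = (of_int (2 * int k * j) :: real))"
    using assms by (simp add: field_simps)
  also have "\<dots> \<longleftrightarrow> 2 * int k dvd n"
    unfolding of_int_eq_iff dvd_def ..
  finally show ?thesis .
qed

lemma epi_eq_iff:
  assumes "k > 0"
  shows "epi k m = epi k n \<longleftrightarrow> 2 * int k dvd m - n"
proof -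
  have "epi k m = epi k (m - n) * epi k n" by (simp flip: epi_add)
  then show ?thesis using epi_eq_1_iff[OF assms, of "m - n"] by simp
qed

lemma epi_even_pow: "k > 0 \<Longrightarrow> epi k (2 * m) ^ k = 1"
  using epi_powi[of k "2 * m" "int k"] epi_eq_1_iff[of k "2 * m * int k"] by simp

lemma mem_Qsector_iff:
  assumes "k > 0"
  shows "z \<in> Qsector k n \<longleftrightarrow> (\<exists>r t. r > 0 \<and> 0 < t \<and> t < pi / real k \<and> z = of_real r * cis t * epi k n)"
proof
  assume z: "z \<in> Qsector k n"
  define y where "y = z * epi k (- n)"
  have "y = of_real (cmod y) * cis (Arg y)" using Arg_eq[of y] by (cases "y = 0") (auto simp: cis_conv_exp)
  moreover have "z = y * epi k n" using epi_inverse[of k n] by (simp add: y_def mult_ac)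
  moreover have "cmod y > 0" using z by (auto simp: y_def Qsector_def)
  ultimately show "\<exists>r t. r > 0 \<and> 0 < t \<and> t < pi / real k \<and> z = of_real r * cis t * epi k n"
    using z unfolding Qsector_def mem_Collect_eq y_def[symmetric] by metis
next
  assume "\<exists>r t. r > 0 \<and> 0 < t \<and> t < pi / real k \<and> z = of_real r * cis t * epi k n"
  then obtain r t where rt: "r > 0" "0 < t" "t < pi / real k" "z = of_real r * cis t * epi k n" by blast
  have "pi / real k \<le> pi" using assms by (simp add: field_simps)
  have e: "z * epi k (- n) = of_real r * cis t" using epi_inverse[of k n] rt by (simp add: mult_ac)
  have a: "Arg (of_real r * cis t) = t"
    by (rule Arg_unique) (use rt \<open>pi / real k \<le> pi\<close> in \<open>auto simp: cis_conv_exp\<close>)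
  show "z \<in> Qsector k n" unfolding Qsector_def mem_Collect_eq e a using rt by simp
qed

lemma epi_1: "epi k 1 = cis (pi / real k)"
  by (simp add: epi_cis)

text \<open>\<open>zstar\<close> reflects in the line of all z with z e_s real. The angle t measured
  inside a sector becomes pi / k - t, and this reversal accounts for the -1 in the index.\<close>

lemma zstar_Qsector:
  assumes "k > 0" "z \<in> Qsector k n"
  shows "zstar k s z \<in> Qsector k (- 2 * s - n - 1)"
proof -
  obtain r t where rt: "r > 0" "0 < t" "t < pi / real k" "z = of_real r * cis t * epi k n"
    using assms mem_Qsector_iff by blast
  have "epi k (- n) * epi k (- 2 * s) = epi k 1 * epi k (- 2 * s - n - 1)"
    by (simp add: algebra_simps flip: epi_add)
  then have "zstar k s z = of_real r * (cis (- t) * epi k 1) * epi k (- 2 * s - n - 1)"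
    unfolding zstar_def rt(4) by (simp add: cis_cnj mult_ac)
  also have "cis (- t) * epi k 1 = cis (pi / real k - t)" by (simp add: epi_1 cis_mult)
  finally show ?thesis
    using rt assms(1) unfolding mem_Qsector_iff[OF assms(1)]
    by - (rule exI[of _ r], rule exI[of _ "pi / real k - t"], simp)
qed

lemma zstar_zstar [simp]: "zstar k s (zstar k s z) = z"
  using epi_inverse[of k "2 * s"] by (simp add: zstar_def mult_ac)

lemma norm_zstar [simp]: "norm (zstar k s z) = norm z"
  by (simp add: zstar_def norm_mult)

lemma zstar_of_real_mult: "zstar k s (of_real r * z) = of_real r * zstar k s z"
  by (simp add: zstar_def)

lemma zstar_power:
  assumes "k > 0"
  shows "zstar k s z ^ k = cnj (z ^ k)"
  using epi_even_pow[OF assms, of "- s"] by (simp add: zstar_def power_mult_distrib)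

section \<open>The strip as a chart of the closed even sectors\<close>

definition strip_to_sector :: "nat \<Rightarrow> int \<Rightarrow> complex \<Rightarrow> complex" where
  "strip_to_sector k m \<tau> = epi k (2 * m) * exp (\<tau> / of_nat k)"

definition in_strip :: "complex \<Rightarrow> bool" where
  "in_strip \<tau> \<longleftrightarrow> 0 \<le> Im \<tau> \<and> Im \<tau> \<le> pi"

lemma strip_to_sector_polar:
  "strip_to_sector k m \<tau> = of_real (exp (Re \<tau> / real k)) * cis (Im \<tau> / real k) * epi k (2 * m)"
  by (simp add: strip_to_sector_def exp_eq_polar)

lemma norm_strip_to_sector: "norm (strip_to_sector k m \<tau>) = exp (Re \<tau> / real k)"
  by (simp add: strip_to_sector_def norm_mult)

lemma strip_to_sector_power:
  assumes "k > 0"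
  shows "strip_to_sector k m \<tau> ^ k = exp \<tau>"
  using assms by (simp add: strip_to_sector_def power_mult_distrib epi_even_pow exp_divide_power_eq)

lemma strip_to_sector_cong:
  assumes "k > 0" "[m = l] (mod int k)"
  shows "strip_to_sector k m \<tau> = strip_to_sector k l \<tau>"
proof -
  have "int k dvd m - l" using assms(2) by (simp add: cong_iff_dvd_diff)
  then have "2 * int k dvd 2 * m - 2 * l" by (metis mult_dvd_mono dvd_refl right_diff_distrib)
  then have "epi k (2 * m) = epi k (2 * l)" using epi_eq_iff[OF assms(1)] by blast
  then show ?thesis by (simp add: strip_to_sector_def)
qed

lemma strip_to_sector_mem:
  assumes "k > 0" "0 < Im \<tau>" "Im \<tau> < pi"
  shows "strip_to_sector k m \<tau> \<in> Qsector k (2 * m)"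
  using assms unfolding strip_to_sector_polar mem_Qsector_iff[OF assms(1)]
  by - (rule exI[of _ "exp (Re \<tau> / real k)"], rule exI[of _ "Im \<tau> / real k"],
      auto intro: divide_strict_right_mono)

lemma polar_strip_to_sector:
  assumes "k > 0" "r > 0"
  shows "of_real r * cis t * epi k (2 * m) = strip_to_sector k m (Complex (real k * ln r) (real k * t))"
  using assms by (simp add: strip_to_sector_polar)

lemma Qsector_even_cases:
  assumes "k > 0" "z \<in> Qsector k (2 * m)"
  obtains \<tau> where "0 < Im \<tau>" "Im \<tau> < pi" "z = strip_to_sector k m \<tau>"
proof -
  obtain r t where rt: "r > 0" "0 < t" "t < pi / real k" "z = of_real r * cis t * epi k (2 * m)"
    using assms mem_Qsector_iff by blast
  show ?thesis
    by (rule that[of "Complex (real k * ln r) (real k * t)"])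
       (use rt assms(1) polar_strip_to_sector[OF assms(1) rt(1)] in \<open>auto simp: field_simps\<close>)
qed

lemma strip_to_sector_limit:
  assumes "k > 0" "in_strip \<tau>"
  obtains f where "\<And>n::nat. f n \<in> Qsector k (2 * m)" "f \<longlonglongrightarrow> strip_to_sector k m \<tau>"
proof -
  \<comment> \<open>Moving \<tau> towards the midline Im = pi / 2 by the fraction 1 / (n + 2) of the
    way lands in the open strip.\<close>
  define t where "t n = \<tau> + of_real (1 / real (Suc (Suc n))) * (\<i> * of_real (pi / 2 - Im \<tau>))" for n
  have "strip_to_sector k m (t n) \<in> Qsector k (2 * m)" for n
  proof (rule strip_to_sector_mem[OF assms(1)])
    define u where "u = 1 / real (Suc (Suc n))"
    have u: "0 < u" "u < 1" by (auto simp: u_def)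
    have e: "Im (t n) = (1 - u) * Im \<tau> + u * (pi / 2)" by (simp add: t_def u_def algebra_simps)
    have "0 \<le> (1 - u) * Im \<tau>" "(1 - u) * Im \<tau> \<le> (1 - u) * pi" "u * (pi / 2) > 0"
      using u assms(2) by (auto simp: in_strip_def intro!: mult_left_mono mult_nonneg_nonneg)
    moreover have "(1 - u) * pi + u * (pi / 2) = pi - u * (pi / 2)" by (simp add: field_simps)
    ultimately show "0 < Im (t n)" "Im (t n) < pi" unfolding e by linarith+
  qed
  moreover have "(\<lambda>n. 1 / real (Suc (Suc n))) \<longlonglongrightarrow> 0"
    using LIMSEQ_Suc[OF LIMSEQ_inverse_real_of_nat] by (simp add: inverse_eq_divide)
  then have "t \<longlonglongrightarrow> \<tau> + of_real 0 * (\<i> * of_real (pi / 2 - Im \<tau>))"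
    unfolding t_def by (intro tendsto_intros)
  then have "t \<longlonglongrightarrow> \<tau>" by simp
  then have "(\<lambda>n. strip_to_sector k m (t n)) \<longlonglongrightarrow> strip_to_sector k m \<tau>"
    unfolding strip_to_sector_def using assms(1) by (intro tendsto_intros) auto
  ultimately show ?thesis using that[of "\<lambda>n. strip_to_sector k m (t n)"] by blast
qed

lemma strip_to_sector_closure:
  assumes "k > 0" "in_strip \<tau>"
  shows "strip_to_sector k m \<tau> \<in> closure (Qsector k (2 * m))"
    and "zstar k s (strip_to_sector k m \<tau>) \<in> closure (Qsector k (- 2 * s - 2 * m - 1))"
proof -
  obtain f where f: "\<And>n::nat. f n \<in> Qsector k (2 * m)" "f \<longlonglongrightarrow> strip_to_sector k m \<tau>"
    using strip_to_sector_limit[OF assms] by blast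
  show "strip_to_sector k m \<tau> \<in> closure (Qsector k (2 * m))"
    unfolding closure_sequential using f by blast
  have "(\<lambda>n. zstar k s (f n)) \<longlonglongrightarrow> zstar k s (strip_to_sector k m \<tau>)"
    unfolding zstar_def by (intro tendsto_intros f)
  then show "zstar k s (strip_to_sector k m \<tau>) \<in> closure (Qsector k (- 2 * s - 2 * m - 1))"
    unfolding closure_sequential
    by (intro exI[of _ "\<lambda>n. zstar k s (f n)"] conjI allI zstar_Qsector assms f)
qed

lemma closure_Qsector_even_cases:
  assumes "k > 0" "z \<in> closure (Qsector k (2 * m))" "z \<noteq> 0"
  obtains \<tau> where "in_strip \<tau>" "z = strip_to_sector k m \<tau>"
proof -
  \<comment> \<open>Two closed half-planes: their intersection contains the sector and, away from 0,
    confines the argument to [0, pi / k].\<close>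
  let ?C = "{z. 0 \<le> Im (z * epi k (- 2 * m)) \<and> Im (z * epi k (- 2 * m) * cis (- (pi / real k))) \<le> 0}"
  have pk: "0 < pi / real k" "pi / real k \<le> pi" using assms(1) by (auto simp: field_simps)
  have "Qsector k (2 * m) \<subseteq> ?C"
  proof
    fix z assume "z \<in> Qsector k (2 * m)"
    then obtain r t where rt: "r > 0" "0 < t" "t < pi / real k" "z = of_real r * cis t * epi k (2 * m)"
      using assms mem_Qsector_iff by blast
    have e: "z * epi k (- 2 * m) = of_real r * cis t"
      using epi_inverse[of k "2 * m"] rt(4) by (simp add: mult_ac)
    have "sin t \<ge> 0" "sin (pi / real k - t) \<ge> 0"
      using rt pk by (auto intro!: sin_ge_zero)
    moreover have "sin (t - pi / real k) = - sin (pi / real k - t)" by (metis minus_diff_eq sin_minus)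
    ultimately have "0 \<le> r * sin t" "r * sin (t - pi / real k) \<le> 0" using rt(1) by (simp_all add: mult_nonneg_nonpos)
    moreover have e': "of_real r * cis t * cis (- (pi / real k)) = of_real r * cis (t - pi / real k)"
      by (simp add: mult.assoc cis_mult)
    ultimately show "z \<in> ?C" unfolding mem_Collect_eq e e' by simp
  qed
  moreover have "closed ?C"
    by (intro closed_Collect_conj closed_Collect_le continuous_intros)
  ultimately have zC: "z \<in> ?C" using assms(2) closure_minimal by blast
  define y where "y = z * epi k (- 2 * m)"
  have "y \<noteq> 0" using assms(3) by (simp add: y_def)
  define r t where "r = cmod y" and "t = Arg y"
  have r: "r > 0" using \<open>y \<noteq> 0\<close> by (simp add: r_def)
  have y: "y = of_real r * cis t" using Arg_eq[OF \<open>y \<noteq> 0\<close>] by (simp add: r_def t_def cis_conv_exp)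
  have z: "z = of_real r * cis t * epi k (2 * m)"
  proof -
    have "z = y * epi k (2 * m)" by (simp add: y_def mult.assoc flip: epi_add)
    then show ?thesis by (simp add: y)
  qed
  have tr: "- pi < t" "t \<le> pi" using mpi_less_Arg Arg_le_pi by (auto simp: t_def)
  have e: "y * cis (- (pi / real k)) = of_real r * cis (t - pi / real k)"
    unfolding y by (simp add: mult.assoc cis_mult)
  have "0 \<le> Im y" "Im (y * cis (- (pi / real k))) \<le> 0"
    using zC unfolding mem_Collect_eq y_def[symmetric] by auto
  then have "0 \<le> r * sin t" "r * sin (t - pi / real k) \<le> 0"
    unfolding e by (simp_all add: y)
  then have s: "0 \<le> sin t" "sin (t - pi / real k) \<le> 0"
    using r by (simp_all only: zero_le_mult_iff mult_le_0_iff) auto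
  have t0: "0 \<le> t"
  proof (rule ccontr)
    assume "\<not> 0 \<le> t"
    then have "sin (- t) > 0" using tr by (intro sin_gt_zero) auto
    then show False using s by simp
  qed
  have t1: "t \<le> pi / real k"
  proof (rule ccontr)
    assume "\<not> ?thesis"
    then have "sin (t - pi / real k) > 0" using tr pk by (intro sin_gt_zero) auto
    then show False using s by simp
  qed
  show ?thesis
    by (rule that[of "Complex (real k * ln r) (real k * t)"])
       (use t0 t1 z assms(1) polar_strip_to_sector[OF assms(1) r] in \<open>auto simp: field_simps in_strip_def\<close>)
qed

lemma strip_representation:
  assumes "k > 0" "z \<noteq> 0"
  obtains m \<tau> where "in_strip \<tau>" "z = strip_to_sector k m \<tau> \<or> z = zstar k s (strip_to_sector k m \<tau>)"
proof -
  define r \<phi> where "r = cmod z" and "\<phi> = Arg z"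
  have r: "r > 0" using assms(2) by (simp add: r_def)
  have z: "z = of_real r * cis \<phi>" using Arg_eq[OF assms(2)] by (simp add: r_def \<phi>_def cis_conv_exp)
  define n where "n = \<lfloor>real k * \<phi> / pi\<rfloor>"
  define t where "t = \<phi> - of_int n * pi / real k"
  have "of_int n \<le> real k * \<phi> / pi" "real k * \<phi> / pi < of_int n + 1" unfolding n_def by linarith+
  then have "of_int n * pi \<le> real k * \<phi>" "real k * \<phi> < of_int n * pi + pi"
    by (auto simp: field_simps)
  moreover have "real k * t = real k * \<phi> - of_int n * pi" using assms(1) by (simp add: t_def field_simps)
  ultimately have t: "0 \<le> real k * t" "real k * t < pi" by linarith+
  have zt: "z = of_real r * cis t * epi k n"
    unfolding z t_def epi_cis by (simp add: mult.assoc cis_mult)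
  show ?thesis
  proof (cases "even n")
    case True
    then obtain m where "n = 2 * m" by blast
    then show ?thesis
      using that[of "Complex (real k * ln r) (real k * t)" m] zt polar_strip_to_sector[OF assms(1) r] t
      by (auto simp: in_strip_def)
  next
    case False
    then obtain j where j: "n = 2 * j + 1" by (rule oddE)
    \<comment> \<open>The reflection sends sector n to sector - 2 s - n - 1, which is 2 m for n = 2
      j + 1.\<close>
    define m where "m = - s - j - 1"
    have "epi k (- n) * epi k (- 2 * s) = epi k 1 * epi k (2 * m)"
      by (simp add: j m_def algebra_simps flip: epi_add)
    then have "zstar k s z = of_real r * (cis (- t) * epi k 1) * epi k (2 * m)"
      unfolding zstar_def zt by (simp add: cis_cnj mult_ac)
    also have "cis (- t) * epi k 1 = cis (pi / real k - t)" by (simp add: epi_1 cis_mult)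
    finally have "zstar k s z = strip_to_sector k m (Complex (real k * ln r) (real k * (pi / real k - t)))"
      using polar_strip_to_sector[OF assms(1) r] by simp
    then have "z = zstar k s (strip_to_sector k m (Complex (real k * ln r) (real k * (pi / real k - t))))"
      by (metis zstar_zstar)
    moreover have "in_strip (Complex (real k * ln r) (real k * (pi / real k - t)))"
    proof -
      have "real k * (pi / real k - t) = pi - real k * t" using assms(1) by (simp add: field_simps)
      then show ?thesis using t by (simp add: in_strip_def)
    qed
    ultimately show ?thesis using that by blast
  qed
qed

text \<open>On a boundary ray the reflection keeps \<tau> and changes only the sector index; this is
  how \<alpha>-points on the boundary will turn out to be fixed.\<close>

lemma zstar_strip_boundary:
  assumes "k > 0" "Im \<tau> = of_int b * pi"
  shows "zstar k s (strip_to_sector k m \<tau>) = strip_to_sector k (- m - s - b) \<tau>"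
proof -
  have "cis (Im \<tau> / real k) = epi k b" by (simp add: epi_cis assms(2))
  then have "strip_to_sector k m' \<tau> = of_real (exp (Re \<tau> / real k)) * epi k (b + 2 * m')" for m'
    unfolding strip_to_sector_polar by (simp add: epi_add mult_ac)
  moreover have "epi k (- (b + 2 * m)) * epi k (- 2 * s) = epi k (b + 2 * (- m - s - b))"
    by (simp add: algebra_simps flip: epi_add)
  ultimately show ?thesis by (simp add: zstar_def mult.assoc)
qed


section \<open>Alpha-points\<close>

locale alpha_points = strip_product +
  fixes s :: int and \<alpha> :: complex and G :: "complex \<Rightarrow> complex"
  assumes k_ge_2: "k \<ge> 2" and p_coprime: "gcd \<bar>p\<bar> (int k) = 1"
    and \<alpha>_nonzero: "\<alpha> \<noteq> 0" and \<alpha>_real: "Im (\<alpha> * epi k (p * s)) = 0"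
    and G_eq: "z \<noteq> 0 \<Longrightarrow> G z = z powi p * g (z ^ k)"
begin

lemma num_cnj: "num (cnj w) = cnj (num w)"
  using a.genus0_cnj[of w] c.genus0_cnj[of "1 / w"] by (simp add: num_def exp_cnj)

lemma den_cnj: "den (cnj w) = cnj (den w)"
  using b.genus0_cnj[of "- w"] d.genus0_cnj[of "- (1 / w)"] by (simp add: den_def)

text \<open>\<open>g\<close> commutes with conjugation, and since \<alpha> e_{ps} is real, the
  factor e_{-2sp} produced by z^p turns \<open>cnj \<alpha>\<close> back into \<alpha>.\<close>

lemma G_zstar:
  assumes "z \<noteq> 0" "G z = \<alpha>"
  shows "G (zstar k s z) = \<alpha>"
proof -
  have "zstar k s z \<noteq> 0" using assms(1) by (simp add: zstar_def)
  then have "G (zstar k s z) = zstar k s z powi p * g (zstar k s z ^ k)" by (rule G_eq)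
  also have "zstar k s z powi p = cnj (z powi p) * epi k (- 2 * s * p)"
    by (simp add: zstar_def power_int_mult_distrib epi_powi)
  also have "g (zstar k s z ^ k) = cnj (g (z ^ k))"
    unfolding zstar_power[OF k_pos] by (simp only: g_def num_cnj den_cnj complex_cnj_divide)
  finally have "G (zstar k s z) = cnj \<alpha> * epi k (- 2 * s * p)"
    using G_eq[OF assms(1)] assms(2) by (simp add: mult_ac)
  also have "epi k (- 2 * s * p) = cnj (epi k (p * s)) * epi k (- (p * s))"
    by (simp add: algebra_simps flip: epi_add)
  also have "cnj \<alpha> * (cnj (epi k (p * s)) * epi k (- (p * s))) = cnj (\<alpha> * epi k (p * s)) * epi k (- (p * s))"
    by simp
  also have "cnj (\<alpha> * epi k (p * s)) = \<alpha> * epi k (p * s)"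
    using \<alpha>_real by (simp add: complex_eq_iff del: complex_cnj_mult)
  finally show ?thesis using epi_inverse[of k "p * s"] by (simp add: mult.assoc)
qed

lemma G_strip_to_sector: "G (strip_to_sector k m \<tau>) = epi k (2 * m * p) * F \<tau>"
proof -
  have "strip_to_sector k m \<tau> \<noteq> 0" by (simp add: strip_to_sector_def)
  then have "G (strip_to_sector k m \<tau>) = strip_to_sector k m \<tau> powi p * g (exp \<tau>)"
    by (simp add: G_eq strip_to_sector_power[OF k_pos])
  also have "strip_to_sector k m \<tau> powi p = epi k (2 * m * p) * exp (of_int p * \<tau> / of_nat k)"
    by (simp add: strip_to_sector_def power_int_mult_distrib epi_powi exp_power_int)
  finally show ?thesis by (simp add: F_def mult_ac)
qed

text \<open>Here k Q z = z G' / G; in terms of z^k no branch has to be chosen.\<close>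

definition Q where "Q z = of_int p / of_nat k + h (z ^ k)"

text \<open>At a fixed point of \<open>zstar\<close> both factors are real, and the sign of \<open>sig\<close> is that of
  \<open>cos b * q\<close> on the boundary line \<open>Im = b\<close> of the strip.\<close>

definition sig where "sig z = Re (z ^ k) * Re (Q z)"

lemma Q_strip: "Q (strip_to_sector k m \<tau>) = q \<tau>"
  by (simp add: Q_def q_def strip_to_sector_power[OF k_pos])

lemma sig_strip:
  assumes "Im \<tau> \<in> {0, pi}"
  shows "sig (strip_to_sector k m \<tau>) = exp (Re \<tau>) * (cos (Im \<tau>) * Re (q \<tau>))"
  by (simp add: sig_def Q_strip strip_to_sector_power[OF k_pos] Re_exp)

lemma alpha_point_regular:
  assumes "z \<noteq> 0" "G z = \<alpha>"
  shows "num (z ^ k) \<noteq> 0" "den (z ^ k) \<noteq> 0"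
  using G_eq[OF assms(1)] assms(2) \<alpha>_nonzero by (auto simp: g_def)

lemma G_deriv:
  assumes "z \<noteq> 0" "num (z ^ k) \<noteq> 0" "den (z ^ k) \<noteq> 0"
  shows "(G has_field_derivative G z * (of_nat k * Q z / z)) (at z)"
proof -
  have "(g has_field_derivative g (z ^ k) * (h (z ^ k) / z ^ k)) (at (z ^ k))"
    by (rule g_deriv) (use assms in auto)
  moreover have "((\<lambda>z. z ^ k) has_field_derivative of_nat k * z ^ (k - 1)) (at z)"
    by (auto intro!: derivative_eq_intros)
  ultimately have "((\<lambda>z. g (z ^ k)) has_field_derivative
      g (z ^ k) * (h (z ^ k) / z ^ k) * (of_nat k * z ^ (k - 1))) (at z)"
    by (rule DERIV_chain2)
  moreover have "g (z ^ k) * (h (z ^ k) / z ^ k) * (of_nat k * z ^ (k - 1)) = g (z ^ k) * (of_nat k * h (z ^ k) / z)"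
    using assms(1) k_pos by (simp add: field_simps power_minus_mult flip: power_Suc)
  ultimately have d1: "((\<lambda>z. g (z ^ k)) has_field_derivative g (z ^ k) * (of_nat k * h (z ^ k) / z)) (at z)"
    by simp
  have d2: "((\<lambda>z. z powi p) has_field_derivative z powi p * (of_int p / z)) (at z)"
    using assms(1) by (auto intro!: derivative_eq_intros simp: power_int_diff)
  have "((\<lambda>z. z powi p * g (z ^ k)) has_field_derivative
      z powi p * g (z ^ k) * (of_int p / z + of_nat k * h (z ^ k) / z)) (at z)"
    by (rule log_derivative_mult[OF d2 d1])
  moreover have "of_int p / z + of_nat k * h (z ^ k) / z = of_nat k * Q z / z"
    using k_pos assms(1) by (simp add: Q_def field_simps)
  ultimately have D: "((\<lambda>z. z powi p * g (z ^ k)) has_field_derivative G z * (of_nat k * Q z / z)) (at z)"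
    using G_eq[OF assms(1)] by simp
  show ?thesis
    by (rule has_field_derivative_transform_within_open[OF D, of "- {0}"]) (use assms(1) G_eq in auto)
qed

lemma simple_if_Q_nonzero:
  assumes "z \<noteq> 0" "G z = \<alpha>" "Q z \<noteq> 0"
  shows "alpha_mult G \<alpha> z 1"
  using DERIV_imp_deriv[OF G_deriv[OF assms(1) alpha_point_regular[OF assms(1,2)]]] assms \<alpha>_nonzero k_pos
  by (simp add: alpha_mult_def)

text \<open>When Q z = 0, differentiating G' = G k Q / z leaves only the term with Q', a nonzero
  multiple of h' (z^k), and h' is positive at real arguments.\<close>

lemma double_if_Q_zero:
  assumes z: "z \<noteq> 0" "G z = \<alpha>" "Q z = 0" and real: "z ^ k \<in> \<real>"
  shows "alpha_mult G \<alpha> z 2" "\<not> alpha_mult G \<alpha> z 1"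
proof -
  note reg = alpha_point_regular[OF z(1,2)]
  have d0: "deriv G z = 0"
    using DERIV_imp_deriv[OF G_deriv[OF z(1) reg]] z by simp
  let ?U = "{z. z \<noteq> 0 \<and> num (z ^ k) \<noteq> 0 \<and> den (z ^ k) \<noteq> 0}"
  have "continuous_on (- {0}) (\<lambda>z. num (z ^ k))"
    by (rule continuous_on_compose2[OF continuous_num]) (auto intro!: continuous_intros)
  moreover have "continuous_on (- {0}) (\<lambda>z. den (z ^ k))"
    by (rule continuous_on_compose2[OF continuous_den]) (auto intro!: continuous_intros)
  ultimately have "open ((- {0} \<inter> (\<lambda>z. num (z ^ k)) -` (- {0})) \<inter> (- {0} \<inter> (\<lambda>z. den (z ^ k)) -` (- {0})))"
    by (intro open_Int continuous_open_preimage) auto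
  moreover have "?U = (- {0} \<inter> (\<lambda>z. num (z ^ k)) -` (- {0})) \<inter> (- {0} \<inter> (\<lambda>z. den (z ^ k)) -` (- {0}))" by auto
  ultimately have U: "open ?U" by simp
  have zU: "z \<in> ?U" using z reg by simp
  have e: "deriv G x = G x * (of_nat k * Q x / x)" if "x \<in> ?U" for x
    using DERIV_imp_deriv[OF G_deriv] that by simp
  have "(h has_field_derivative h' (z ^ k)) (at (z ^ k))"
    by (rule h_deriv) (use z reg in auto)
  moreover have "((\<lambda>z. z ^ k) has_field_derivative of_nat k * z ^ (k - 1)) (at z)"
    by (auto intro!: derivative_eq_intros)
  ultimately have "((\<lambda>z. h (z ^ k)) has_field_derivative h' (z ^ k) * (of_nat k * z ^ (k - 1))) (at z)"
    by (rule DERIV_chain2)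
  from DERIV_add[OF DERIV_const this]
  have "(Q has_field_derivative h' (z ^ k) * (of_nat k * z ^ (k - 1))) (at z)"
    unfolding Q_def[abs_def] by simp
  from DERIV_divide[OF DERIV_cmult[OF this, of "of_nat k"] DERIV_ident z(1)]
  have "((\<lambda>x. of_nat k * Q x / x) has_field_derivative of_nat k * (h' (z ^ k) * (of_nat k * z ^ (k - 1))) / z) (at z)"
    using z by simp
  from DERIV_mult[OF G_deriv[OF z(1) reg] this]
  have D: "((\<lambda>x. G x * (of_nat k * Q x / x)) has_field_derivative
      \<alpha> * (of_nat k * (h' (z ^ k) * (of_nat k * z ^ (k - 1))) / z)) (at z)"
    using z by (simp add: mult.commute)
  have "(deriv G has_field_derivative \<alpha> * (of_nat k * (h' (z ^ k) * (of_nat k * z ^ (k - 1))) / z)) (at z)"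
    by (rule has_field_derivative_transform_within_open[OF D U zU]) (simp add: e)
  then have d2: "deriv (deriv G) z = \<alpha> * (of_nat k * (h' (z ^ k) * (of_nat k * z ^ (k - 1))) / z)"
    by (rule DERIV_imp_deriv)
  obtain r where r: "z ^ k = of_real r" using real by (auto elim: Reals_cases)
  have "r \<noteq> 0" using r z(1) by auto
  then have "h' (z ^ k) \<noteq> 0" using h'_pos(2)[of r] reg unfolding r by auto
  then have "deriv (deriv G) z \<noteq> 0" unfolding d2 using \<alpha>_nonzero k_pos z(1) by simp
  moreover have "{1..<2::nat} = {1}" by auto
  ultimately show "alpha_mult G \<alpha> z 2"
    using z d0 by (simp add: alpha_mult_def numeral_2_eq_2)
  show "\<not> alpha_mult G \<alpha> z 1" using d0 by (simp add: alpha_mult_def)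
qed

lemma fixed_power_real:
  assumes "zstar k s z = z"
  shows "z ^ k \<in> \<real>"
  using zstar_power[OF k_pos, of s z] assms by (simp add: Reals_cnj_iff)

text \<open>At a fixed point z^k is real and nonzero and Q z is real, so \<open>sig z\<close>
  vanishes exactly when Q z does.\<close>

lemma fixed_multiplicity:
  assumes "z \<noteq> 0" "G z = \<alpha>" "zstar k s z = z"
  shows "sig z = 0 \<Longrightarrow> alpha_mult G \<alpha> z 2 \<and> \<not> alpha_mult G \<alpha> z 1"
    and "sig z \<noteq> 0 \<Longrightarrow> alpha_mult G \<alpha> z 1 \<and> \<not> alpha_mult G \<alpha> z 2"
proof -
  note re = fixed_power_real[OF assms(3)]
  note reg = alpha_point_regular[OF assms(1,2)]
  have "Im (z ^ k) = 0" "z ^ k \<noteq> 0" using re assms(1) by (auto simp: complex_is_Real_iff)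
  then have n: "Re (z ^ k) \<noteq> 0" by (simp add: complex_eq_iff)
  have "h (z ^ k) \<in> \<real>" by (rule h_real) (use re reg assms in auto)
  then have "Im (Q z) = 0" by (simp add: Q_def complex_is_Real_iff)
  then have iff: "sig z = 0 \<longleftrightarrow> Q z = 0" using n by (simp add: sig_def complex_eq_iff)
  show "alpha_mult G \<alpha> z 2 \<and> \<not> alpha_mult G \<alpha> z 1" if "sig z = 0"
    using double_if_Q_zero[OF assms(1,2) _ re] that iff by blast
  show "alpha_mult G \<alpha> z 1 \<and> \<not> alpha_mult G \<alpha> z 2" if "sig z \<noteq> 0"
    using simple_if_Q_nonzero[OF assms(1,2)] that iff by (auto simp: alpha_mult_def numeral_2_eq_2)
qed

lemma fixed_on_boundary:
  assumes "in_strip \<tau>" "G (strip_to_sector k m \<tau>) = \<alpha>"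
  shows "zstar k s (strip_to_sector k m \<tau>) = strip_to_sector k m \<tau> \<Longrightarrow> Im \<tau> \<in> {0, pi}"
proof -
  assume "zstar k s (strip_to_sector k m \<tau>) = strip_to_sector k m \<tau>"
  then have "exp \<tau> \<in> \<real>" using fixed_power_real strip_to_sector_power[OF k_pos] by metis
  then have "sin (Im \<tau>) = 0" by (simp add: complex_is_Real_iff Im_exp)
  then show "Im \<tau> \<in> {0, pi}" using sin_gt_zero[of "Im \<tau>"] assms(1) by (force simp: in_strip_def)
qed

lemma nonreal_simple:
  assumes "z \<noteq> 0" "G z = \<alpha>" "Im (z ^ k) \<noteq> 0"
  shows "alpha_mult G \<alpha> z 1"
proof (rule simple_if_Q_nonzero[OF assms(1,2)])
  show "Q z \<noteq> 0" using Im_h_nonzero[OF assms(3)] by (auto simp: Q_def complex_eq_iff)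
qed

end

section \<open>\<alpha>-points as lattice points of the level curve\<close>

locale alpha_curve = alpha_points +
  fixes L :: "complex \<Rightarrow> complex" and \<theta> :: "real \<Rightarrow> real"
  assumes level: "level_curve T L q (ln (cmod \<alpha>)) \<theta>"
    and L_exp: "\<tau> \<in> T \<Longrightarrow> F \<tau> = exp (L \<tau>)"
begin

sublocale lc: level_curve T L q "ln (cmod \<alpha>)" \<theta> by (rule level)

lemma strip_point:
  assumes "in_strip \<tau>" "G (strip_to_sector k m \<tau>) = \<alpha>"
  shows "\<tau> = lc.\<gamma> (Re \<tau>)" "lc.X (Re \<tau>)" "\<theta> (Re \<tau>) = Im \<tau>"
    "cis (lc.V (Re \<tau>)) * epi k (2 * m * p) = cis (Arg \<alpha>)"
proof -
  have e: "epi k (2 * m * p) * F \<tau> = \<alpha>" using assms(2) by (simp add: G_strip_to_sector)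
  then have "F \<tau> \<noteq> 0" using \<alpha>_nonzero by auto
  then have T: "\<tau> \<in> T" using assms(1) by (auto simp: T_def in_strip_def F_def g_def)
  have "cmod \<alpha> = exp (Re (L \<tau>))" using e L_exp[OF T] by (auto simp: norm_mult)
  then have R: "Re (L \<tau>) = ln (cmod \<alpha>)" by simp
  show \<theta>: "\<theta> (Re \<tau>) = Im \<tau>" by (rule lc.\<theta>_unique[OF T R])
  then show \<gamma>: "\<tau> = lc.\<gamma> (Re \<tau>)" by (simp add: lc.\<gamma>_def)
  then show "lc.X (Re \<tau>)" using R by (simp add: lc.X_def)
  have V: "lc.V (Re \<tau>) = Im (L \<tau>)" using \<gamma> by (simp add: lc.V_def)
  have "F \<tau> = of_real (cmod \<alpha>) * cis (lc.V (Re \<tau>))"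
    unfolding L_exp[OF T] exp_eq_polar V R using \<alpha>_nonzero by simp
  moreover have "\<alpha> = of_real (cmod \<alpha>) * cis (Arg \<alpha>)"
    using Arg_eq[OF \<alpha>_nonzero] by (simp add: cis_conv_exp)
  ultimately have "of_real (cmod \<alpha>) * (cis (lc.V (Re \<tau>)) * epi k (2 * m * p)) = of_real (cmod \<alpha>) * cis (Arg \<alpha>)"
    using e by (metis mult.commute mult.left_commute)
  then show "cis (lc.V (Re \<tau>)) * epi k (2 * m * p) = cis (Arg \<alpha>)" using \<alpha>_nonzero by simp
qed

text \<open>By \<open>strip_point_B\<close> and \<open>B_strip_point\<close> together with the
  reflection, this is the set of all k ln |z| with z an \<alpha>-point, whatever its sector.\<close>

definition B where "B = lc.lattice_points (Arg \<alpha>) (2 * pi / real k)"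

lemma cis_lattice: "cis (of_int n * (2 * pi / real k)) = epi k (2 * n)"
  by (simp add: epi_cis mult_ac)

lemma strip_point_B:
  assumes "in_strip \<tau>" "G (strip_to_sector k m \<tau>) = \<alpha>"
  shows "Re \<tau> \<in> B"
proof -
  note sp = strip_point[OF assms]
  let ?V = "lc.V (Re \<tau>)"
  have "cis (?V + of_int (2 * m * p) * pi / real k - Arg \<alpha>) = 1"
    using sp(4) by (simp add: epi_cis cis_mult flip: cis_divide)
  then have "exp (\<i> * of_real (?V + of_int (2 * m * p) * pi / real k - Arg \<alpha>)) = 1"
    by (simp add: cis_conv_exp)
  then obtain n :: int where "?V + of_int (2 * m * p) * pi / real k - Arg \<alpha> = of_int (2 * n) * pi"
    by (subst (asm) exp_eq_1) auto
  then have "?V = Arg \<alpha> + of_int (int k * n - m * p) * (2 * pi / real k)"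
    using k_pos by (simp add: field_simps)
  then show ?thesis unfolding B_def lc.lattice_points_def using sp(2) by blast
qed

lemma B_strip_point:
  assumes "x \<in> B"
  obtains m where "G (strip_to_sector k m (lc.\<gamma> x)) = \<alpha>"
proof -
  obtain n where n: "lc.X x" "lc.V x = Arg \<alpha> + of_int n * (2 * pi / real k)"
    using assms unfolding B_def lc.lattice_points_def by blast
  have "coprime p (int k)" using p_coprime by (simp add: coprime_iff_gcd_eq_1)
  \<comment> \<open>The inverse y of p modulo k selects the sector: with index - n y the factor
    e_{2mp} undoes the n lattice steps of V.\<close>
  then obtain y where y: "[p * y = 1] (mod int k)" using cong_solve_coprime_int by blast
  have T: "lc.\<gamma> x \<in> T" unfolding lc.\<gamma>_def by (rule lc.\<theta>_T)
  have "F (lc.\<gamma> x) = of_real (cmod \<alpha>) * cis (lc.V x)"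
    using n(1) \<alpha>_nonzero unfolding L_exp[OF T] exp_eq_polar lc.X_def lc.V_def by simp
  also have "cis (lc.V x) = cis (Arg \<alpha>) * epi k (2 * n)"
    unfolding n(2) cis_mult[symmetric] cis_lattice ..
  also have "of_real (cmod \<alpha>) * (cis (Arg \<alpha>) * epi k (2 * n)) = \<alpha> * epi k (2 * n)"
    using Arg_eq[OF \<alpha>_nonzero] by (simp add: cis_conv_exp)
  finally have "G (strip_to_sector k (- n * y) (lc.\<gamma> x)) = \<alpha> * (epi k (2 * (- n * y) * p) * epi k (2 * n))"
    by (simp add: G_strip_to_sector)
  also have "epi k (2 * (- n * y) * p) * epi k (2 * n) = 1"
  proof -
    have "int k dvd 1 - p * y" using y by (simp add: cong_iff_dvd_diff dvd_diff_commute)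
    then have "2 * int k dvd 2 * (n * (1 - p * y))" by (intro mult_dvd_mono dvd_refl dvd_mult)
    moreover have "2 * (- n * y) * p + 2 * n = 2 * (n * (1 - p * y))" by (simp add: algebra_simps)
    ultimately show ?thesis unfolding epi_add[symmetric] epi_eq_1_iff[OF k_pos] by metis
  qed
  finally show ?thesis using that by simp
qed

text \<open>Both points satisfy e_{2mp} F = \<alpha> with their own index, so a gain of j steps in V
  must be compensated by the passage from m to l.\<close>

lemma strip_points_cong:
  assumes "in_strip \<tau>" "G (strip_to_sector k m \<tau>) = \<alpha>" "in_strip \<tau>'" "G (strip_to_sector k l \<tau>') = \<alpha>"
    and V: "lc.V (Re \<tau>') = lc.V (Re \<tau>) + of_int j * (2 * pi / real k)"
  shows "[p * (m - l) = j] (mod int k)"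
proof -
  have "cis (lc.V (Re \<tau>')) * epi k (2 * l * p) = cis (lc.V (Re \<tau>)) * epi k (2 * m * p)"
    using strip_point(4)[OF assms(1,2)] strip_point(4)[OF assms(3,4)] by simp
  then have "cis (lc.V (Re \<tau>)) * epi k (2 * j + 2 * l * p) = cis (lc.V (Re \<tau>)) * epi k (2 * m * p)"
    unfolding V cis_mult[symmetric] cis_lattice epi_add by (simp add: mult.assoc)
  then have "epi k (2 * m * p) = epi k (2 * j + 2 * l * p)" by simp
  then have "2 * int k dvd 2 * (p * (m - l) - j)"
    unfolding epi_eq_iff[OF k_pos] by (simp add: algebra_simps)
  then have "int k dvd p * (m - l) - j" by (subst (asm) dvd_mult_cancel_left) simp
  then show ?thesis by (simp add: cong_iff_dvd_diff)
qed

lemma cong_cancel_p: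
  assumes "[p * x = p * y] (mod int k)"
  shows "[x = y] (mod int k)"
proof -
  have "coprime p (int k)" using p_coprime by (simp add: coprime_iff_gcd_eq_1)
  then show ?thesis using assms by (simp add: cong_mult_lcancel)
qed

text \<open>The abscissa determines the point of the curve and thus V, so p (m - l) is 0 modulo k,
  and p can be cancelled.\<close>

lemma strip_points_same_abs:
  assumes "in_strip \<tau>" "G (strip_to_sector k m \<tau>) = \<alpha>" "in_strip \<tau>'" "G (strip_to_sector k l \<tau>') = \<alpha>"
    and "Re \<tau> = Re \<tau>'"
  shows "\<tau> = \<tau>'" "[m = l] (mod int k)" "strip_to_sector k m \<tau> = strip_to_sector k l \<tau>'"
proof -
  show t: "\<tau> = \<tau>'" using strip_point(1)[OF assms(1,2)] strip_point(1)[OF assms(3,4)] assms(5) by simp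
  have "[p * (m - l) = 0] (mod int k)" using strip_points_cong[OF assms(1-4), of 0] t by simp
  then have "[m - l = 0] (mod int k)" using cong_cancel_p[of "m - l" 0] by simp
  then show c: "[m = l] (mod int k)" by (simp add: cong_iff_dvd_diff)
  show "strip_to_sector k m \<tau> = strip_to_sector k l \<tau>'"
    unfolding t by (rule strip_to_sector_cong[OF k_pos c])
qed

lemma representation:
  assumes "z \<noteq> 0" "G z = \<alpha>"
  obtains m \<tau> where "in_strip \<tau>" "G (strip_to_sector k m \<tau>) = \<alpha>" "norm (strip_to_sector k m \<tau>) = norm z"
    "z = strip_to_sector k m \<tau> \<or> z = zstar k s (strip_to_sector k m \<tau>)"
proof -
  obtain m \<tau> where r: "in_strip \<tau>" "z = strip_to_sector k m \<tau> \<or> z = zstar k s (strip_to_sector k m \<tau>)"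
    using strip_representation[OF k_pos assms(1)] by metis
  have "G (strip_to_sector k m \<tau>) = \<alpha>" "norm (strip_to_sector k m \<tau>) = norm z"
    using r(2) assms G_zstar[OF assms] by (metis zstar_zstar norm_zstar)+
  then show ?thesis using that r by blast
qed

text \<open>Representatives in even sectors with the same modulus coincide, so only the choice
  between a point and its reflection is left.\<close>

lemma same_modulus_iff:
  assumes "z \<noteq> 0" "G z = \<alpha>"
  shows "G w = \<alpha> \<and> norm w = norm z \<longleftrightarrow> w \<in> {z, zstar k s z}"
proof
  assume w: "G w = \<alpha> \<and> norm w = norm z"
  then have "w \<noteq> 0" using assms(1) by auto
  obtain m \<tau> where r: "in_strip \<tau>" "G (strip_to_sector k m \<tau>) = \<alpha>" "norm (strip_to_sector k m \<tau>) = norm z"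
    "z = strip_to_sector k m \<tau> \<or> z = zstar k s (strip_to_sector k m \<tau>)" using representation[OF assms] .
  obtain l \<tau>' where r': "in_strip \<tau>'" "G (strip_to_sector k l \<tau>') = \<alpha>" "norm (strip_to_sector k l \<tau>') = norm w"
    "w = strip_to_sector k l \<tau>' \<or> w = zstar k s (strip_to_sector k l \<tau>')"
    using representation[OF \<open>w \<noteq> 0\<close>] w by blast
  have "exp (Re \<tau> / real k) = exp (Re \<tau>' / real k)"
    using r(3) r'(3) w unfolding norm_strip_to_sector by linarith
  then have "Re \<tau> = Re \<tau>'" using k_pos by simp
  then have "strip_to_sector k m \<tau> = strip_to_sector k l \<tau>'"
    using strip_points_same_abs(3)[OF r(1,2) r'(1,2)] by blast
  then show "w \<in> {z, zstar k s z}" using r(4) r'(4) by auto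
next
  assume "w \<in> {z, zstar k s z}"
  then show "G w = \<alpha> \<and> norm w = norm z" using assms G_zstar by auto
qed

text \<open>The reflected point is an \<alpha>-point with the same \<tau> and possibly another
  sector index; \<open>strip_points_same_abs\<close> identifies the two.\<close>

lemma boundary_fixed:
  assumes "in_strip \<tau>" "G (strip_to_sector k m \<tau>) = \<alpha>" "Im \<tau> \<in> {0, pi}"
  shows "zstar k s (strip_to_sector k m \<tau>) = strip_to_sector k m \<tau>"
proof -
  obtain b :: int where b: "Im \<tau> = of_int b * pi" using assms(3) by (metis empty_iff insert_iff mult_1 mult_zero_left of_int_0 of_int_1)
  have "strip_to_sector k m \<tau> \<noteq> 0" by (simp add: strip_to_sector_def)
  then have "G (strip_to_sector k (- m - s - b) \<tau>) = \<alpha>"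
    using G_zstar assms(2) zstar_strip_boundary[OF k_pos b] by metis
  then show ?thesis
    unfolding zstar_strip_boundary[OF k_pos b]
    using strip_points_same_abs(3)[OF assms(1) _ assms(1,2) refl] by blast
qed

text \<open>The alternatives for V in terms of sectors: standing still preserves the index modulo k,
  a step 2 pi / k gives the congruence. \<open>sig\<close> differs from cos b * q by the positive
  factor exp (Re \<tau>).\<close>

lemma consecutive_strip_points:
  assumes \<tau>: "in_strip \<tau>" "G (strip_to_sector k m \<tau>) = \<alpha>"
    and \<tau>': "in_strip \<tau>'" "G (strip_to_sector k l \<tau>') = \<alpha>"
    and less: "Re \<tau> < Re \<tau>'"
    and gap: "\<not> (\<exists>z. G z = \<alpha> \<and> exp (Re \<tau> / real k) < norm z \<and> norm z < exp (Re \<tau>' / real k))"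
  shows "[m = l] (mod int k) \<and> Im \<tau> \<in> {0, pi} \<and> Im \<tau>' = Im \<tau> \<and>
      sig (strip_to_sector k m \<tau>) < 0 \<and> sig (strip_to_sector k l \<tau>') > 0
    \<or> [p * (m - l) = 1] (mod int k) \<and> (Im \<tau> \<in> {0, pi} \<longrightarrow> sig (strip_to_sector k m \<tau>) \<ge> 0)
        \<and> (Im \<tau>' \<in> {0, pi} \<longrightarrow> sig (strip_to_sector k l \<tau>') \<le> 0)"
proof -
  have \<delta>: "2 * pi / real k > 0" using k_pos by simp
  have gapB: "u \<notin> lc.lattice_points (Arg \<alpha>) (2 * pi / real k)" if u: "Re \<tau> < u" "u < Re \<tau>'" for u
  proof
    assume "u \<in> lc.lattice_points (Arg \<alpha>) (2 * pi / real k)"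
    then obtain j where "G (strip_to_sector k j (lc.\<gamma> u)) = \<alpha>" using B_strip_point[of u] B_def by blast
    moreover have "exp (Re \<tau> / real k) < norm (strip_to_sector k j (lc.\<gamma> u))"
      "norm (strip_to_sector k j (lc.\<gamma> u)) < exp (Re \<tau>' / real k)"
      using u k_pos by (simp_all add: norm_strip_to_sector lc.\<gamma>_def divide_strict_right_mono)
    ultimately show False using gap by blast
  qed
  note sp = strip_point[OF \<tau>] and sp' = strip_point[OF \<tau>']
  have e: "exp x * y < 0 \<longleftrightarrow> y < 0" "exp x * y > 0 \<longleftrightarrow> y > 0" "exp x * y \<le> 0 \<longleftrightarrow> y \<le> 0" "exp x * y \<ge> 0 \<longleftrightarrow> y \<ge> 0"
    for x y :: real by (auto simp: mult_less_0_iff zero_less_mult_iff mult_le_0_iff zero_le_mult_iff)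
  from lc.consecutive_lattice_points[OF \<delta> strip_point_B[OF \<tau>, unfolded B_def] strip_point_B[OF \<tau>', unfolded B_def] less gapB]
  consider
    (eq) "lc.V (Re \<tau>') = lc.V (Re \<tau>)" "Im \<tau> \<in> {0, pi}" "Im \<tau>' = Im \<tau>" "cos (Im \<tau>) * Re (q \<tau>) < 0" "cos (Im \<tau>') * Re (q \<tau>') > 0"
  | (step) "lc.V (Re \<tau>') = lc.V (Re \<tau>) + 2 * pi / real k" "Im \<tau> \<in> {0, pi} \<longrightarrow> cos (Im \<tau>) * Re (q \<tau>) \<ge> 0"
      "Im \<tau>' \<in> {0, pi} \<longrightarrow> cos (Im \<tau>') * Re (q \<tau>') \<le> 0"
    unfolding sp(1)[symmetric] sp'(1)[symmetric] sp(3) sp'(3) by blast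
  then show ?thesis
  proof cases
    case eq
    have "[p * (m - l) = p * 0] (mod int k)" using strip_points_cong[OF \<tau> \<tau>', of 0] eq(1) by simp
    then have "[m = l] (mod int k)" using cong_cancel_p[of "m - l" 0] by (simp add: cong_iff_dvd_diff)
    moreover have "Im \<tau>' \<in> {0, pi}" using eq by simp
    ultimately show ?thesis using eq(2-5) sig_strip[of \<tau>] sig_strip[of \<tau>'] e by simp
  next
    case step
    have "[p * (m - l) = 1] (mod int k)" using strip_points_cong[OF \<tau> \<tau>', of 1] step(1) by simp
    then show ?thesis using step(2,3) sig_strip[of \<tau>] sig_strip[of \<tau>'] e by simp
  qed
qed

end

context alpha_curve
begin

text \<open>A common ray through a fixed point decides the case. On it both points have the same
  index, and as k \<ge> 2 the congruence 0 = 1 rules out a step of V; off it V cannot stand still,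
  since that would give equal arguments.\<close>

lemma consecutive_alpha_points:
  assumes z: "z \<noteq> 0" "G z = \<alpha>" and w: "G w = \<alpha>" and less: "norm z < norm w"
    and gap: "\<not> (\<exists>v. G v = \<alpha> \<and> norm z < norm v \<and> norm v < norm w)"
  shows "(zstar k s z = z \<and> zstar k s w = w \<and> Arg z = Arg w \<and> sig z < 0 \<and> sig w > 0) \<or>
    ((zstar k s z = z \<or> zstar k s w = w \<longrightarrow> Arg z \<noteq> Arg w) \<and>
     (zstar k s z = z \<longrightarrow> sig z \<ge> 0) \<and> (zstar k s w = w \<longrightarrow> sig w \<le> 0) \<and>
     (\<forall>m l. z \<in> closure (Qsector k (2 * m)) \<or> zstar k s z \<in> closure (Qsector k (2 * m)) \<longrightarrow>
       [p * (m - l) = 1] (mod int k) \<longrightarrow>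
       w \<in> closure (Qsector k (2 * l)) \<union> closure (Qsector k (- 2 * s - 2 * l - 1))))"
proof -
  have "w \<noteq> 0" using less by auto
  obtain m \<tau> where r: "in_strip \<tau>" "G (strip_to_sector k m \<tau>) = \<alpha>" "norm (strip_to_sector k m \<tau>) = norm z"
    "z = strip_to_sector k m \<tau> \<or> z = zstar k s (strip_to_sector k m \<tau>)" using representation[OF z] .
  obtain l \<tau>' where r': "in_strip \<tau>'" "G (strip_to_sector k l \<tau>') = \<alpha>" "norm (strip_to_sector k l \<tau>') = norm w"
    "w = strip_to_sector k l \<tau>' \<or> w = zstar k s (strip_to_sector k l \<tau>')"
    using representation[OF \<open>w \<noteq> 0\<close> w] .
  have nz: "norm z = exp (Re \<tau> / real k)" "norm w = exp (Re \<tau>' / real k)"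
    using r(3) r'(3) by (simp_all add: norm_strip_to_sector)
  have lessR: "Re \<tau> < Re \<tau>'" using less k_pos unfolding nz by (simp add: divide_less_cancel)
  note gap' = gap[unfolded nz]
  have fix_z: "z = strip_to_sector k m \<tau>" "Im \<tau> \<in> {0, pi}" if "zstar k s z = z"
  proof -
    show e: "z = strip_to_sector k m \<tau>" using r(4) that by (metis zstar_zstar)
    show "Im \<tau> \<in> {0, pi}" using fixed_on_boundary[OF r(1,2)] that e by metis
  qed
  have fix_w: "w = strip_to_sector k l \<tau>'" "Im \<tau>' \<in> {0, pi}" if "zstar k s w = w"
  proof -
    show e: "w = strip_to_sector k l \<tau>'" using r'(4) that by (metis zstar_zstar)
    show "Im \<tau>' \<in> {0, pi}" using fixed_on_boundary[OF r'(1,2)] that e by metis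
  qed
  show ?thesis
  proof (cases "(zstar k s z = z \<or> zstar k s w = w) \<and> Arg z = Arg w")
    \<comment> \<open>Here w is a positive multiple of z, so both are fixed, and w has a
      representation with the index m of z.\<close>
    case True
    define \<rho> where "\<rho> = norm w / norm z"
    have \<rho>: "\<rho> > 0" using z(1) \<open>w \<noteq> 0\<close> by (simp add: \<rho>_def)
    have wz: "w = of_real \<rho> * z"
    proof -
      have "z = of_real (norm z) * cis (Arg z)" "w = of_real (norm w) * cis (Arg z)"
        using Arg_eq[OF z(1)] Arg_eq[OF \<open>w \<noteq> 0\<close>] True by (simp_all add: cis_conv_exp)
      then have "of_real \<rho> * z = of_real (\<rho> * norm z) * cis (Arg z)" by (metis mult.assoc of_real_mult)
      then show ?thesis using \<open>w = of_real (norm w) * cis (Arg z)\<close> z(1) by (simp add: \<rho>_def)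
    qed
    have fz: "zstar k s z = z" and fw: "zstar k s w = w"
      using True zstar_of_real_mult[of k s \<rho> z] \<rho> unfolding wz by auto
    define \<tau>'' where "\<tau>'' = Complex (Re \<tau> + real k * ln \<rho>) (Im \<tau>)"
    have "strip_to_sector k m \<tau>'' = of_real (exp (Re \<tau> / real k) * \<rho>) * cis (Im \<tau> / real k) * epi k (2 * m)"
      using k_pos \<rho> by (simp add: strip_to_sector_polar \<tau>''_def add_divide_distrib exp_add)
    then have w'': "w = strip_to_sector k m \<tau>''"
      unfolding wz fix_z(1)[OF fz] strip_to_sector_polar[of k m \<tau>] by (simp add: mult_ac)
    have s'': "in_strip \<tau>''" using r(1) by (simp add: in_strip_def \<tau>''_def)
    have "exp (Re \<tau>'' / real k) = exp (Re \<tau>' / real k)"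
      using nz(2) w'' norm_strip_to_sector[of k m \<tau>''] by simp
    then have R: "Re \<tau>'' = Re \<tau>'" using k_pos by simp
    have "\<not> [p * (m - m) = 1] (mod int k)" using k_ge_2 by (simp add: cong_def)
    then have "sig z < 0" "sig w > 0"
      using consecutive_strip_points[OF r(1,2) s'' w[unfolded w''] lessR[folded R] gap'[folded R]]
      unfolding w''[symmetric] fix_z(1)[OF fz, symmetric] by auto
    then show ?thesis using True fz fw by blast
  next
    case False
    from consecutive_strip_points[OF r(1,2) r'(1,2) lessR gap']
    consider "[m = l] (mod int k)" "Im \<tau> \<in> {0, pi}" "Im \<tau>' = Im \<tau>"
      | "[p * (m - l) = 1] (mod int k)" "Im \<tau> \<in> {0, pi} \<longrightarrow> sig (strip_to_sector k m \<tau>) \<ge> 0"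
        "Im \<tau>' \<in> {0, pi} \<longrightarrow> sig (strip_to_sector k l \<tau>') \<le> 0" by blast
    then show ?thesis
    proof cases
      case 1
      have z': "z = strip_to_sector k m \<tau>" "zstar k s z = z"
        using boundary_fixed[OF r(1,2) 1(2)] r(4) by auto
      have w': "w = strip_to_sector k m \<tau>'"
        using boundary_fixed[OF r'(1,2)] 1 r'(4) strip_to_sector_cong[OF k_pos 1(1), of \<tau>'] by auto
      have "Arg z = Arg w"
        unfolding z'(1) w' strip_to_sector_polar 1(3) mult.assoc by (simp add: Arg_times_of_real)
      then show ?thesis using False z'(2) by blast
    next
      case 2
      have "w \<in> closure (Qsector k (2 * l')) \<union> closure (Qsector k (- 2 * s - 2 * l' - 1))"
        if m': "z \<in> closure (Qsector k (2 * m')) \<or> zstar k s z \<in> closure (Qsector k (2 * m'))"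
          and l': "[p * (m' - l') = 1] (mod int k)" for m' l'
      proof -
        obtain y where y: "y \<in> closure (Qsector k (2 * m'))" "y = z \<or> y = zstar k s z" using m' by blast
        have y': "y \<noteq> 0" "G y = \<alpha>" "norm y = norm z"
          using y(2) z G_zstar[OF z] by (auto simp: zstar_def norm_mult)
        obtain \<sigma> where \<sigma>: "in_strip \<sigma>" "y = strip_to_sector k m' \<sigma>"
          using closure_Qsector_even_cases[OF k_pos y(1) y'(1)] .
        have "exp (Re \<sigma> / real k) = exp (Re \<tau> / real k)"
          using y'(3) nz(1) norm_strip_to_sector[of k m' \<sigma>] \<sigma>(2) by simp
        then have "Re \<sigma> = Re \<tau>" using k_pos by simp
        \<comment> \<open>Both indices belong to strip points that are \<alpha>-points of the same
          modulus, whether the given sector contains z or its reflection.\<close>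
        then have mm: "[m' = m] (mod int k)"
          using strip_points_same_abs(2)[OF \<sigma>(1) y'(2)[unfolded \<sigma>(2)] r(1,2)] by blast
        have "[p * (m - l) = p * (m' - l')] (mod int k)" using 2(1) l' by (meson cong_sym cong_trans)
        then have "[m - l = m' - l'] (mod int k)" by (rule cong_cancel_p)
        then have "int k dvd ((m - l) - (m' - l')) + (m' - m)"
          using mm unfolding cong_iff_dvd_diff by (rule dvd_add)
        then have "[l' = l] (mod int k)" by (simp add: cong_iff_dvd_diff)
        then have "strip_to_sector k l' \<tau>' = strip_to_sector k l \<tau>'" by (rule strip_to_sector_cong[OF k_pos])
        then show ?thesis using r'(4) strip_to_sector_closure(1)[OF k_pos r'(1), of l']
            strip_to_sector_closure(2)[OF k_pos r'(1), of s l'] by auto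
      qed
      moreover have "zstar k s z = z \<longrightarrow> sig z \<ge> 0" "zstar k s w = w \<longrightarrow> sig w \<le> 0"
        using 2(2,3) fix_z fix_w by auto
      ultimately show ?thesis using False by blast
    qed
  qed
qed

lemma alpha_pts_D:
  assumes "increasing_enumeration J \<xi> (Xi G \<alpha>)" "i \<in> J" "z \<in> alpha_pts G \<alpha> \<xi> i"
  shows "z \<noteq> 0" "G z = \<alpha>" "norm z = \<xi> i"
proof -
  have "\<xi> i \<in> Xi G \<alpha>" using assms(1,2) unfolding increasing_enumeration_def by blast
  then have "\<xi> i > 0" by (simp add: Xi_def)
  then show "z \<noteq> 0" "G z = \<alpha>" "norm z = \<xi> i" using assms(3) by (auto simp: alpha_pts_def)
qed

lemma enumerated_alpha_points:
  assumes enum: "increasing_enumeration J \<xi> (Xi G \<alpha>)" and J: "i \<in> J" "i + 1 \<in> J"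
    and z: "z \<in> alpha_pts G \<alpha> \<xi> i" and w: "w \<in> alpha_pts G \<alpha> \<xi> (i + 1)"
  shows "norm z < norm w"
    and "\<not> (\<exists>v. G v = \<alpha> \<and> norm z < norm v \<and> norm v < norm w)"
proof -
  have mono: "strict_mono_on J \<xi>" and im: "\<xi> ` J = Xi G \<alpha>"
    using enum by (auto simp: increasing_enumeration_def)
  note Z = alpha_pts_D[OF enum J(1) z] and W = alpha_pts_D[OF enum J(2) w]
  show "norm z < norm w" using strict_mono_onD[OF mono J] by (simp add: Z(3) W(3))
  show "\<not> (\<exists>v. G v = \<alpha> \<and> norm z < norm v \<and> norm v < norm w)"
  proof
    assume "\<exists>v. G v = \<alpha> \<and> norm z < norm v \<and> norm v < norm w"
    then obtain v where v: "G v = \<alpha>" "norm z < norm v" "norm v < norm w" by blast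
    then have "v \<noteq> 0" by auto
    have "G (of_real (norm v) * exp (\<i> * of_real (Arg v))) = \<alpha>" using Arg_eq[OF \<open>v \<noteq> 0\<close>] v(1) by simp
    then have "norm v \<in> Xi G \<alpha>"
      using \<open>v \<noteq> 0\<close> mpi_less_Arg[of v] Arg_le_pi[of v] unfolding Xi_def mem_Collect_eq
      by (intro conjI bexI[of _ "Arg v"]) simp_all
    then obtain j where j: "j \<in> J" "norm v = \<xi> j" using im by blast
    have "i < j"
    proof (rule ccontr)
      assume "\<not> i < j"
      then have "\<xi> j \<le> \<xi> i" using strict_mono_onD[OF mono j(1) J(1)] by (cases "i = j") auto
      then show False using v j Z by simp
    qed
    moreover have "j < i + 1"
    proof (rule ccontr)
      assume "\<not> j < i + 1"
      then have "\<xi> (i + 1) \<le> \<xi> j" using strict_mono_onD[OF mono J(2) j(1)] by (cases "j = i + 1") auto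
      then show False using v j W by simp
    qed
    ultimately show False by simp
  qed
qed

text \<open>On the boundary line Im = b pi one has z e_s = |z| e_{2m+b+s}, so for t > 0 the number 2
  m + b + s is divisible by 2 k. The ceiling absorbs b, which is 0 or 1.\<close>

lemma fixed_sector_index:
  assumes "z \<noteq> 0" "G z = \<alpha>" "zstar k s z = z" "z \<in> closure (Qsector k (2 * m))"
    and t: "z * epi k s = of_real t"
  shows "t > 0 \<Longrightarrow> [m = - \<lceil>real_of_int s / 2\<rceil>] (mod int k)"
    and "t < 0 \<Longrightarrow> [m = - \<lceil>real_of_int (s - int k) / 2\<rceil>] (mod int k)"
proof -
  obtain \<tau> where \<tau>: "in_strip \<tau>" "z = strip_to_sector k m \<tau>"
    using closure_Qsector_even_cases[OF k_pos assms(4,1)] .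
  have "Im \<tau> \<in> {0, pi}" using fixed_on_boundary[OF \<tau>(1)] assms \<tau>(2) by metis
  then obtain b :: int where b: "b \<in> {0, 1}" "Im \<tau> = of_int b * pi" by force
  have "cis (Im \<tau> / real k) = epi k b" by (simp add: epi_cis b(2))
  then have zs: "z * epi k s = of_real (norm z) * epi k (2 * m + b + s)"
    unfolding \<tau>(2) norm_strip_to_sector unfolding strip_to_sector_polar
    by (simp add: algebra_simps epi_add)
  then have nt: "norm z = \<bar>t\<bar>" using t by (metis abs_norm_cancel mult.right_neutral norm_epi norm_mult norm_of_real)
  have half: "2 * \<lceil>real_of_int x / 2\<rceil> = x + b" if ev: "even (x + b)" for x :: int
  proof -
    obtain y where "x + b = 2 * y" using ev by blast
    then have x: "x = 2 * y - b" by simp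
    have "\<lceil>real_of_int x / 2\<rceil> = y" unfolding x using b(1) by (auto simp: ceiling_eq_iff)
    then show ?thesis using x by simp
  qed
  have conclude: "[m = - \<lceil>real_of_int x / 2\<rceil>] (mod int k)" if d: "2 * int k dvd 2 * m + b + x" for x
  proof -
    have "even (2 * m + (x + b))" using d by (metis add.assoc add.commute dvd_mult_left)
    then have "2 * int k dvd 2 * (m + \<lceil>real_of_int x / 2\<rceil>)" using half[of x] d by (simp add: algebra_simps)
    then have "int k dvd m + \<lceil>real_of_int x / 2\<rceil>" by (subst (asm) dvd_mult_cancel_left) simp
    then show ?thesis by (simp add: cong_iff_dvd_diff)
  qed
  show "[m = - \<lceil>real_of_int s / 2\<rceil>] (mod int k)" if "t > 0"
  proof (rule conclude)
    have "epi k (2 * m + b + s) = 1" using zs t nt that by simp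
    then show "2 * int k dvd 2 * m + b + s" by (simp add: epi_eq_1_iff[OF k_pos])
  qed
  show "[m = - \<lceil>real_of_int (s - int k) / 2\<rceil>] (mod int k)" if "t < 0"
  proof (rule conclude)
    have "of_real t * (- epi k (2 * m + b + s)) = complex_of_real t * 1" using zs t nt that by simp
    then have "- epi k (2 * m + b + s) = 1" by (subst (asm) mult_left_cancel) (use that in auto)
    \<comment> \<open>The negative sign is absorbed as e_{-k}, which replaces s by s - k.\<close>
    moreover have "epi k (- int k) = - 1" using k_pos by (simp add: epi_cis cis.ctr complex_eq_iff)
    ultimately have "epi k (2 * m + b + (s - int k)) = 1"
      using epi_add[of k "2 * m + b + s" "- int k"] by (simp add: add_diff_eq)
    then show "2 * int k dvd 2 * m + b + (s - int k)" by (simp add: epi_eq_1_iff[OF k_pos])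
  qed
qed

text \<open>Up to reflection the point is in an open even sector, where the k-th power has positive
  imaginary part; a nonreal z^k excludes fixed points and multiple \<alpha>-points alike.\<close>

lemma interior_sector_point:
  assumes "z \<noteq> 0" "G z = \<alpha>" and z: "z \<in> Qsector k (2 * m) \<union> Qsector k (- 2 * s - 2 * m - 1)"
  shows "zstar k s z \<noteq> z" "alpha_mult G \<alpha> z 1" "alpha_mult G \<alpha> (zstar k s z) 1"
    "z \<in> closure (Qsector k (2 * m)) \<or> zstar k s z \<in> closure (Qsector k (2 * m))"
proof -
  have "z \<in> Qsector k (2 * m) \<or> zstar k s z \<in> Qsector k (2 * m)"
    using z zstar_Qsector[OF k_pos, of z "- 2 * s - 2 * m - 1" s] by auto
  then obtain y where y: "y \<in> Qsector k (2 * m)" "y = z \<or> y = zstar k s z" by blast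
  show "z \<in> closure (Qsector k (2 * m)) \<or> zstar k s z \<in> closure (Qsector k (2 * m))"
    using y closure_subset by blast
  obtain \<tau> where \<tau>: "0 < Im \<tau>" "Im \<tau> < pi" "y = strip_to_sector k m \<tau>"
    using Qsector_even_cases[OF k_pos y(1)] .
  have "Im (y ^ k) > 0" using Im_exp_pos[OF \<tau>(1,2)] by (simp add: \<tau>(3) strip_to_sector_power[OF k_pos])
  moreover have i': "Im (zstar k s z ^ k) = - Im (z ^ k)"
    unfolding zstar_power[OF k_pos] by (simp del: complex_cnj_power)
  ultimately have i: "Im (z ^ k) \<noteq> 0" using y(2) by auto
  then show "zstar k s z \<noteq> z" using fixed_power_real[of z] by (auto simp: complex_is_Real_iff)
  show "alpha_mult G \<alpha> z 1" by (rule nonreal_simple[OF assms(1,2) i])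
  show "alpha_mult G \<alpha> (zstar k s z) 1"
    by (rule nonreal_simple) (use assms(1) G_zstar[OF assms(1,2)] i i' in \<open>simp_all add: zstar_def\<close>)
qed

end

section \<open>From the given products to the abstract setting\<close>

definition reciprocals :: "nat set \<Rightarrow> (nat \<Rightarrow> real) \<Rightarrow> nat \<Rightarrow> real" where
  "reciprocals N a n = (if n \<in> N then 1 / a n else 0)"

lemma weights_reciprocals:
  assumes "\<forall>n\<in>N. a n > 0" "abs_convergent_prod (factors N f)"
    and "\<And>n. n \<in> N \<Longrightarrow> norm (f n - 1) = 1 / a n"
  shows "weights (reciprocals N a)"
proof
  show "0 \<le> reciprocals N a n" for n using assms(1) by (simp add: reciprocals_def less_imp_le)
  have "norm (factors N f n - 1) = reciprocals N a n" for n
    using assms(3) by (simp add: factors_def reciprocals_def)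
  then show "summable (reciprocals N a)" using abs_convergent_prod_imp_summable[OF assms(2)] by simp
qed

text \<open>A weight 0 outside N reproduces the factor 1 that \<open>factors\<close> puts
  there.\<close>

lemma prodinf_factors:
  "prodinf (factors N (\<lambda>n. 1 + w / of_real (a n))) = genus0 (reciprocals N a) w"
  "prodinf (factors N (\<lambda>n. 1 - w / of_real (a n))) = genus0 (reciprocals N a) (- w)"
  unfolding genus0_def by (rule arg_cong[of _ _ prodinf], force simp: factors_def reciprocals_def)+

lemma alpha_points_Gfun:
  assumes "k \<ge> 2" "gcd \<bar>p\<bar> (int k) = 1" "A \<ge> 0" "A0 \<ge> 0"
    and pos: "\<forall>\<nu>\<in>Na. a \<nu> > 0" "\<forall>\<mu>\<in>Nb. b \<mu> > 0" "\<forall>\<nu>\<in>Nc. c \<nu> > 0" "\<forall>\<mu>\<in>Nd. d \<mu> > 0"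
    and conv: "products_abs_convergent k Na a Nb b Nc c Nd d"
    and nontriv: "\<exists>z. z \<noteq> 0 \<and> Gfun k p A A0 Na a Nb b Nc c Nd d z \<noteq> z powi p"
    and "\<alpha> \<noteq> 0" "Im (\<alpha> * epi k (p * s)) = 0"
  shows "alpha_points (reciprocals Na a) (reciprocals Nb b) (reciprocals Nc c) (reciprocals Nd d)
    A A0 k p s \<alpha> (Gfun k p A A0 Na a Nb b Nc c Nd d)"
proof -
  \<comment> \<open>At z = 1 absolute convergence says precisely that the reciprocals of the
    parameters are summable.\<close>
  have c1: "abs_convergent_prod (factors Na (\<lambda>\<nu>. 1 + 1 / complex_of_real (a \<nu>)))"
    "abs_convergent_prod (factors Nb (\<lambda>\<nu>. 1 - 1 / complex_of_real (b \<nu>)))"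
    "abs_convergent_prod (factors Nc (\<lambda>\<nu>. 1 + 1 / complex_of_real (c \<nu>)))"
    "abs_convergent_prod (factors Nd (\<lambda>\<nu>. 1 - 1 / complex_of_real (d \<nu>)))"
    using conv[unfolded products_abs_convergent_def, rule_format, of 1] by simp_all
  interpret a: weights "reciprocals Na a"
    by (rule weights_reciprocals[OF pos(1) c1(1)]) (use pos in \<open>auto simp: norm_divide\<close>)
  interpret b: weights "reciprocals Nb b"
    by (rule weights_reciprocals[OF pos(2) c1(2)]) (use pos in \<open>auto simp: norm_divide\<close>)
  interpret c: weights "reciprocals Nc c"
    by (rule weights_reciprocals[OF pos(3) c1(3)]) (use pos in \<open>auto simp: norm_divide\<close>)
  interpret d: weights "reciprocals Nd d"
    by (rule weights_reciprocals[OF pos(4) c1(4)]) (use pos in \<open>auto simp: norm_divide\<close>)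
  let ?G = "Gfun k p A A0 Na a Nb b Nc c Nd d"
  have G: "?G z = exp (of_real A * z ^ k + of_real A0 / z ^ k) * z powi p *
      (genus0 (reciprocals Na a) (z ^ k) / genus0 (reciprocals Nb b) (- (z ^ k))) *
      (genus0 (reciprocals Nc c) (1 / z ^ k) / genus0 (reciprocals Nd d) (- (1 / z ^ k)))" for z
    unfolding Gfun_def prodinf_factors by (simp add: power_int_minus divide_inverse)
  \<comment> \<open>If all these data vanished, every factor would be 1 and G would be z^p.\<close>
  have nt: "A > 0 \<or> A0 > 0 \<or> (\<exists>j. reciprocals Na a j > 0 \<or> reciprocals Nb b j > 0
      \<or> reciprocals Nc c j > 0 \<or> reciprocals Nd d j > 0)"
  proof (rule ccontr)
    assume n: "\<not> (A > 0 \<or> A0 > 0 \<or> (\<exists>j. reciprocals Na a j > 0 \<or> reciprocals Nb b j > 0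
      \<or> reciprocals Nc c j > 0 \<or> reciprocals Nd d j > 0))"
    then have A: "A = 0" "A0 = 0" using assms(3,4) by auto
    have z: "reciprocals Na a j = 0" "reciprocals Nb b j = 0" "reciprocals Nc c j = 0" "reciprocals Nd d j = 0" for j
      using n a.nonneg[of j] b.nonneg[of j] c.nonneg[of j] d.nonneg[of j] by (auto simp: not_less intro: antisym)
    have "?G z = z powi p" for z unfolding G by (simp add: genus0_def z A)
    then show False using nontriv by blast
  qed
  interpret pf: pick_factor "reciprocals Na a" "reciprocals Nb b" "reciprocals Nc c" "reciprocals Nd d" A A0
    by unfold_locales (use assms(3,4) nt in auto)
  show ?thesis
  proof unfold_locales
    show "?G z = z powi p * pf.g (z ^ k)" for z
      unfolding G pf.g_def pf.num_def pf.den_def by (simp add: mult_ac)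
  qed (use assms in auto)
qed

lemma alpha_curve_exists:
  assumes "alpha_points ua ub uc ud A A0 k p s \<alpha> G"
  obtains L \<theta> where "alpha_curve ua ub uc ud A A0 k p s \<alpha> G L \<theta>"
proof -
  interpret alpha_points ua ub uc ud A A0 k p s \<alpha> G by fact
  obtain L where L: "log_strip T L q" "\<And>\<tau>. \<tau> \<in> T \<Longrightarrow> F \<tau> = exp (L \<tau>)"
    by (rule log_strip_exists) blast
  obtain \<theta> where "level_curve T L q (ln (cmod \<alpha>)) \<theta>"
    by (rule level_curve_exists[OF L]) blast+
  then have "alpha_curve ua ub uc ud A A0 k p s \<alpha> G L \<theta>"
    by (intro alpha_curve.intro alpha_curve_axioms.intro assms) (assumption, rule L(2))
  then show ?thesis using that by blast
qed

theorem theorem21: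
  fixes k :: nat and p s :: int and \<alpha> :: complex
    and A A0 :: real
    and Na Nb Nc Nd :: "nat set" and a b c d :: "nat \<Rightarrow> real"
    and G :: "complex \<Rightarrow> complex"
    and J :: "int set" and \<xi> :: "int \<Rightarrow> real"
  assumes "k \<ge> 2" and "gcd \<bar>p\<bar> (int k) = 1"
    and "A \<ge> 0" and "A0 \<ge> 0"
    and "\<forall>\<nu>\<in>Na. a \<nu> > 0" and "\<forall>\<mu>\<in>Nb. b \<mu> > 0"
    and "\<forall>\<nu>\<in>Nc. c \<nu> > 0" and "\<forall>\<mu>\<in>Nd. d \<mu> > 0"
    and "products_abs_convergent k Na a Nb b Nc c Nd d"
    and "G = Gfun k p A A0 Na a Nb b Nc c Nd d"
    and "\<exists>z. z \<noteq> 0 \<and> G z \<noteq> z powi p"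
    and "\<alpha> \<noteq> 0" and "Im (\<alpha> ^ k) = 0" and "Im (\<alpha> * epi k (p * s)) = 0"
    and "increasing_enumeration J \<xi> (Xi G \<alpha>)"
  shows
    \<comment> \<open>(a)\<close>
    "(\<forall>i\<in>J. \<forall>zi\<in>alpha_pts G \<alpha> \<xi> i. \<forall>z.
        G z = \<alpha> \<and> norm z = norm zi \<longleftrightarrow> z \<in> {zi, zstar k s zi})
   \<and> \<comment> \<open>(b)\<close>
     (\<forall>i\<in>J. \<forall>zi\<in>alpha_pts G \<alpha> \<xi> i. \<forall>m::int.
        zi \<in> Qsector k (2 * m) \<union> Qsector k (- 2 * s - 2 * m - 1) \<longrightarrow>
          zstar k s zi \<noteq> zi \<and> alpha_mult G \<alpha> zi 1 \<and> alpha_mult G \<alpha> (zstar k s zi) 1 \<and>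
          (i + 1 \<in> J \<longrightarrow>
            (\<forall>l::int. [p * (m - l) = 1] (mod int k) \<longrightarrow>
              (\<forall>w\<in>alpha_pts G \<alpha> \<xi> (i + 1).
                w \<in> closure (Qsector k (2 * l)) \<union> closure (Qsector k (- 2 * s - 2 * l - 1))))))
   \<and> \<comment> \<open>(c)\<close>
     (\<forall>i\<in>J. i + 1 \<in> J \<longrightarrow>
        (\<forall>zi\<in>alpha_pts G \<alpha> \<xi> i. \<forall>w\<in>alpha_pts G \<alpha> \<xi> (i + 1).
          zstar k s zi = zi \<and> Arg zi = Arg w \<longrightarrow>
            alpha_mult G \<alpha> zi 1 \<and> alpha_mult G \<alpha> w 1 \<and>
            (i - 1 \<in> J \<longrightarrow> (\<forall>v\<in>alpha_pts G \<alpha> \<xi> (i - 1). Arg zi \<noteq> Arg v)) \<and>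
            (i + 2 \<in> J \<longrightarrow> (\<forall>v\<in>alpha_pts G \<alpha> \<xi> (i + 2). Arg w \<noteq> Arg v))))
   \<and> \<comment> \<open>(d)\<close>
     (\<forall>i\<in>J. i + 1 \<in> J \<longrightarrow>
        (\<forall>zi\<in>alpha_pts G \<alpha> \<xi> i. \<forall>w\<in>alpha_pts G \<alpha> \<xi> (i + 1).
          zstar k s zi = zi \<and> Arg zi \<noteq> Arg w \<longrightarrow>
            (alpha_mult G \<alpha> zi 1 \<or> alpha_mult G \<alpha> zi 2) \<and>
            (i - 1 \<in> J \<longrightarrow>
              (\<forall>v\<in>alpha_pts G \<alpha> \<xi> (i - 1).
                (alpha_mult G \<alpha> zi 1 \<longleftrightarrow> Arg zi = Arg v) \<and>
                (alpha_mult G \<alpha> zi 2 \<longleftrightarrow> Arg zi \<noteq> Arg v))) \<and>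
            (\<forall>m::int.
              zi \<in> closure (Qsector k (2 * m)) \<inter> closure (Qsector k (- 2 * s - 2 * m - 1)) \<longrightarrow>
                (zi * epi k s \<in> \<real> \<and> Re (zi * epi k s) > 0 \<longrightarrow>
                  [m = - \<lceil>real_of_int s / 2\<rceil>] (mod int k)) \<and>
                (zi * epi k s \<in> \<real> \<and> Re (zi * epi k s) < 0 \<longrightarrow>
                  [m = - \<lceil>real_of_int (s - int k) / 2\<rceil>] (mod int k)) \<and>
                (\<forall>l::int. [p * (m - l) = 1] (mod int k) \<longrightarrow>
                  w \<in> closure (Qsector k (2 * l)) \<union> closure (Qsector k (- 2 * s - 2 * l - 1))))))
   \<and> \<comment> \<open>(e)\<close>
     (\<forall>i\<in>J. i + 1 \<notin> J \<longrightarrow>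
        (\<forall>zi\<in>alpha_pts G \<alpha> \<xi> i.
          zstar k s zi = zi \<longrightarrow> (\<exists>n\<le>2. alpha_mult G \<alpha> zi n)))"
proof -
  note enum = assms(15)
  obtain L \<theta> where "alpha_curve (reciprocals Na a) (reciprocals Nb b) (reciprocals Nc c) (reciprocals Nd d)
      A A0 k p s \<alpha> G L \<theta>"
    using alpha_curve_exists[OF alpha_points_Gfun[OF assms(1-9) assms(11)[unfolded assms(10)] assms(12,14)],
        folded assms(10)] .
  then interpret AC: alpha_curve "reciprocals Na a" "reciprocals Nb b" "reciprocals Nc c" "reciprocals Nd d"
    A A0 k p s \<alpha> G L \<theta> .
  note pt = AC.alpha_pts_D[OF enum]
  \<comment> \<open>\<open>S\<close> is the case of two consecutive points on one boundary ray with
    V standing still; \<open>D\<close> collects what holds when V makes a step.\<close>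
  define S where "S z w \<longleftrightarrow> zstar k s z = z \<and> zstar k s w = w \<and> Arg z = Arg w \<and> AC.sig z < 0 \<and> AC.sig w > 0"
    for z w
  define D where "D z w \<longleftrightarrow> (zstar k s z = z \<or> zstar k s w = w \<longrightarrow> Arg z \<noteq> Arg w) \<and>
     (zstar k s z = z \<longrightarrow> AC.sig z \<ge> 0) \<and> (zstar k s w = w \<longrightarrow> AC.sig w \<le> 0) \<and>
     (\<forall>m l. z \<in> closure (Qsector k (2 * m)) \<or> zstar k s z \<in> closure (Qsector k (2 * m)) \<longrightarrow>
       [p * (m - l) = 1] (mod int k) \<longrightarrow>
       w \<in> closure (Qsector k (2 * l)) \<union> closure (Qsector k (- 2 * s - 2 * l - 1)))" for z w
  have SD: "S z w \<or> D z w"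
    if J: "i \<in> J" "j \<in> J" "j = i + 1" and z: "z \<in> alpha_pts G \<alpha> \<xi> i" and w: "w \<in> alpha_pts G \<alpha> \<xi> j" for i j z w
    unfolding S_def D_def
    by (rule AC.consecutive_alpha_points[OF pt(1)[OF J(1) z] pt(2)[OF J(1) z] pt(2)[OF J(2) w]
          AC.enumerated_alpha_points[OF enum J(1) J(2)[unfolded J(3)] z w[unfolded J(3)]]])
  have part_a: "\<forall>i\<in>J. \<forall>zi\<in>alpha_pts G \<alpha> \<xi> i. \<forall>z. G z = \<alpha> \<and> norm z = norm zi \<longleftrightarrow> z \<in> {zi, zstar k s zi}"
    by (intro ballI allI AC.same_modulus_iff) (rule pt(1,2); assumption)+
  have part_b: "zstar k s z \<noteq> z \<and> alpha_mult G \<alpha> z 1 \<and> alpha_mult G \<alpha> (zstar k s z) 1 \<and>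
      (i + 1 \<in> J \<longrightarrow> (\<forall>l::int. [p * (m - l) = 1] (mod int k) \<longrightarrow> (\<forall>w\<in>alpha_pts G \<alpha> \<xi> (i + 1).
         w \<in> closure (Qsector k (2 * l)) \<union> closure (Qsector k (- 2 * s - 2 * l - 1)))))"
    if i: "i \<in> J" and z: "z \<in> alpha_pts G \<alpha> \<xi> i" and Q: "z \<in> Qsector k (2 * m) \<union> Qsector k (- 2 * s - 2 * m - 1)"
    for i z m
  proof -
    note in_sector = AC.interior_sector_point[OF pt(1)[OF i z] pt(2)[OF i z] Q]
    have "D z w" if "i + 1 \<in> J" "w \<in> alpha_pts G \<alpha> \<xi> (i + 1)" for w
      using SD[OF i that(1) refl z that(2)] in_sector(1) by (auto simp: S_def)
    then have "w \<in> closure (Qsector k (2 * l)) \<union> closure (Qsector k (- 2 * s - 2 * l - 1))"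
      if "i + 1 \<in> J" "w \<in> alpha_pts G \<alpha> \<xi> (i + 1)" "[p * (m - l) = 1] (mod int k)" for w l
      using that in_sector(4) unfolding D_def by meson
    then show ?thesis using in_sector(1-3) by simp
  qed
  have part_c: "alpha_mult G \<alpha> z 1 \<and> alpha_mult G \<alpha> w 1 \<and>
      (i - 1 \<in> J \<longrightarrow> (\<forall>v\<in>alpha_pts G \<alpha> \<xi> (i - 1). Arg z \<noteq> Arg v)) \<and>
      (i + 2 \<in> J \<longrightarrow> (\<forall>v\<in>alpha_pts G \<alpha> \<xi> (i + 2). Arg w \<noteq> Arg v))"
    if i: "i \<in> J" "i + 1 \<in> J" and z: "z \<in> alpha_pts G \<alpha> \<xi> i" and w: "w \<in> alpha_pts G \<alpha> \<xi> (i + 1)"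
      and "zstar k s z = z \<and> Arg z = Arg w" for i z w
  proof -
    have fixed: "zstar k s z = z" "Arg z = Arg w" using that by auto
    have S: "S z w" using SD[OF i refl z w] fixed by (auto simp: D_def)
    have "alpha_mult G \<alpha> z 1" "alpha_mult G \<alpha> w 1"
      using S AC.fixed_multiplicity(2)[OF pt(1,2)[OF i(1) z]] AC.fixed_multiplicity(2)[OF pt(1,2)[OF i(2) w]]
      by (auto simp: S_def)
    \<comment> \<open>\<open>S z w\<close> makes sig z negative, whereas \<open>S v z\<close> would
      make it positive; so \<open>D v z\<close> holds and separates the arguments. The successor of
      w is treated symmetrically.\<close>
    moreover have "Arg z \<noteq> Arg v" if v: "i - 1 \<in> J" "v \<in> alpha_pts G \<alpha> \<xi> (i - 1)" for v
      using SD[OF v(1) i(1) _ v(2) z] S by (auto simp: S_def D_def)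
    moreover have "Arg w \<noteq> Arg v" if v: "i + 2 \<in> J" "v \<in> alpha_pts G \<alpha> \<xi> (i + 2)" for v
      using SD[OF i(2) v(1) _ w v(2)] S by (auto simp: S_def D_def)
    ultimately show ?thesis by blast
  qed
  have part_d: "(alpha_mult G \<alpha> z 1 \<or> alpha_mult G \<alpha> z 2) \<and>
      (i - 1 \<in> J \<longrightarrow> (\<forall>v\<in>alpha_pts G \<alpha> \<xi> (i - 1).
          (alpha_mult G \<alpha> z 1 \<longleftrightarrow> Arg z = Arg v) \<and> (alpha_mult G \<alpha> z 2 \<longleftrightarrow> Arg z \<noteq> Arg v))) \<and>
      (\<forall>m::int. z \<in> closure (Qsector k (2 * m)) \<inter> closure (Qsector k (- 2 * s - 2 * m - 1)) \<longrightarrow>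
          (z * epi k s \<in> \<real> \<and> Re (z * epi k s) > 0 \<longrightarrow> [m = - \<lceil>real_of_int s / 2\<rceil>] (mod int k)) \<and>
          (z * epi k s \<in> \<real> \<and> Re (z * epi k s) < 0 \<longrightarrow>
            [m = - \<lceil>real_of_int (s - int k) / 2\<rceil>] (mod int k)) \<and>
          (\<forall>l::int. [p * (m - l) = 1] (mod int k) \<longrightarrow>
            w \<in> closure (Qsector k (2 * l)) \<union> closure (Qsector k (- 2 * s - 2 * l - 1))))"
    if i: "i \<in> J" "i + 1 \<in> J" and z: "z \<in> alpha_pts G \<alpha> \<xi> i" and w: "w \<in> alpha_pts G \<alpha> \<xi> (i + 1)"
      and "zstar k s z = z \<and> Arg z \<noteq> Arg w" for i z w
  proof -
    have fixed: "zstar k s z = z" "Arg z \<noteq> Arg w" using that by auto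
    note Z = pt(1,2)[OF i(1) z]
    have D: "D z w" using SD[OF i refl z w] fixed by (auto simp: S_def)
    have d1: "alpha_mult G \<alpha> z 1 \<or> alpha_mult G \<alpha> z 2" using AC.fixed_multiplicity[OF Z fixed(1)] by blast
    have d2: "(alpha_mult G \<alpha> z 1 \<longleftrightarrow> Arg z = Arg v) \<and> (alpha_mult G \<alpha> z 2 \<longleftrightarrow> Arg z \<noteq> Arg v)"
      if v: "i - 1 \<in> J" "v \<in> alpha_pts G \<alpha> \<xi> (i - 1)" for v
    proof -
      consider "S v z" | "D v z" using SD[OF v(1) i(1) _ v(2) z] by auto
      then show ?thesis
      proof cases
        case 1
        then show ?thesis using AC.fixed_multiplicity(2)[OF Z fixed(1)] by (auto simp: S_def)
      next
        case 2
        \<comment> \<open>As second point of \<open>D v z\<close> the sign is at most 0, as first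
          point of \<open>D z w\<close> at least 0.\<close>
        then have "AC.sig z = 0" "Arg v \<noteq> Arg z" using D fixed(1) unfolding D_def by auto
        then show ?thesis using AC.fixed_multiplicity(1)[OF Z fixed(1)] by auto
      qed
    qed
    have d3: "(z * epi k s \<in> \<real> \<and> Re (z * epi k s) > 0 \<longrightarrow> [m = - \<lceil>real_of_int s / 2\<rceil>] (mod int k)) \<and>
        (z * epi k s \<in> \<real> \<and> Re (z * epi k s) < 0 \<longrightarrow> [m = - \<lceil>real_of_int (s - int k) / 2\<rceil>] (mod int k)) \<and>
        (\<forall>l::int. [p * (m - l) = 1] (mod int k) \<longrightarrow>
          w \<in> closure (Qsector k (2 * l)) \<union> closure (Qsector k (- 2 * s - 2 * l - 1)))"
      if m: "z \<in> closure (Qsector k (2 * m))" for m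
    proof (intro conjI impI allI)
      \<comment> \<open>Here t is Re (z * epi k s); the two conjuncts of the premise supply its
        reality and its sign.\<close>
      note index = AC.fixed_sector_index[OF Z fixed(1) m of_real_Re[OF conjunct1, symmetric] conjunct2]
      show "[m = - \<lceil>real_of_int s / 2\<rceil>] (mod int k)" if "z * epi k s \<in> \<real> \<and> Re (z * epi k s) > 0"
        by (rule index(1)[OF that that])
      show "[m = - \<lceil>real_of_int (s - int k) / 2\<rceil>] (mod int k)" if "z * epi k s \<in> \<real> \<and> Re (z * epi k s) < 0"
        by (rule index(2)[OF that that])
      show "w \<in> closure (Qsector k (2 * l)) \<union> closure (Qsector k (- 2 * s - 2 * l - 1))"
        if "[p * (m - l) = 1] (mod int k)" for l
        using D m that unfolding D_def by meson
    qed
    show ?thesis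
      by (intro conjI; (rule d1
          | ((intro impI ballI)[1], (rule d2; assumption))
          | ((intro allI impI)[1], (rule d3, erule IntD1))))
  qed
  have part_e: "\<exists>n\<le>2. alpha_mult G \<alpha> z n"
    if "i \<in> J" "z \<in> alpha_pts G \<alpha> \<xi> i" "zstar k s z = z" for i z
  proof -
    have "alpha_mult G \<alpha> z 1 \<or> alpha_mult G \<alpha> z 2"
      using AC.fixed_multiplicity[OF pt(1,2)[OF that(1,2)] that(3)] by blast
    then show ?thesis by (metis one_le_numeral order_refl)
  qed
  show ?thesis
    by (intro conjI; (rule part_a
        | ((intro ballI allI impI)[1], (rule part_b; assumption))
        | ((intro ballI allI impI)[1], (rule part_c; assumption))
        | ((intro ballI allI impI)[1], (rule part_d; assumption))
        | ((intro ballI allI impI)[1], (rule part_e; assumption))))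
qed

end
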